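(* Let $\nu$ be a finite positive Borel measure on $\mathbb{T}$ that is singular with respect to arclength measure. Let $A$ be a bounded linear operator on $K_{e_\nu}$ that is $C_{e_\nu}$-symmetric and such that, for every positive Borel measure $\mu$ on $\mathbb{T}$ with $\mu\le\nu$, the compression $P_{K_{e_\mu}}A|_{K_{e_\mu}}$ of $A$ to $K_{e_\mu}$ is $C_{e_\mu}$-symmetric. Then $A\in\mathcal{T}_{e_\nu}$, that is, $A$ is a truncated Toeplitz operator on $K_{e_\nu}$.
   Context: Let $\mathbb{D}=\{z\in\mathbb{C}:|z|<1\}$ and $\mathbb{T}=\{z\in\mathbb{C}:|z|=1\}$. The Hardy space $H^2$ on $\mathbb{D}$ is viewed as a closed subspace of $L^2=L^2(\mathbb{T})$ (with respect to normalized arclength measure) by identifying analytic functions with their radial limits; similarly the algebra $H^\infty$ of bounded analytic functions on $\mathbb{D}$ is viewed as a subalgebra of $L^\infty(\mathbb{T})$. A function $u\in H^\infty$ is inner if $|u|=1$ almost everywhere on $\mathbb{T}$. Let $\chi$ denote the function $\chi(z)=z$. For an inner function $u$, the model space is $K_u=H^2\ominus uH^2$, and $P_{K_u}:L^2\to K_u$ is the orthogonal projection onto $K_u$. If $v$ is an inner divisor of $u$ (i.e. $v$ and $u/v$ are both inner), then $K_v\subset K_u$. For an inner function $u$, $C_u$ denotes the conjugation on $L^2$ (isometric, conjugate-linear involution) given by $C_uf=u\overline{\chi f}$; it maps $K_u$ bijectively onto itself and so also defines a conjugation on $K_u$. If $C$ is a conjugation on a Hilbert space $\mathcal{H}$,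 a bounded operator $A$ on $\mathcal{H}$ is called $C$-symmetric if $A^*=CAC$; equivalently, $\langle Af,f\rangle=\langle A(Cf),Cf\rangle$ for all $f\in\mathcal{H}$. A bounded linear operator $A$ on $K_u$ is a truncated Toeplitz operator if there is $\varphi\in L^2$ such that $Af=P_{K_u}(\varphi f)$ for every bounded function $f\in K_u$. The set of all truncated Toeplitz operators on $K_u$ is denoted $\mathcal{T}_u$. For a finite positive singular Borel measure $\nu$ on $\mathbb{T}$, $e_\nu$ is the singular inner function $$e_\nu(z)=\exp\left(-\int_{\mathbb{T}}\frac{\zeta+z}{\zeta-z}\,d\nu(\zeta)\right),\quad z\in\mathbb{D}.$$ For Borel measures on $\mathbb{T}$, $\mu\le\nu$ means $\mu(E)\le\nu(E)$ for every Borel set $E\subset\mathbb{T}$; in this case $\mu$ is also finite and singular and $e_\mu$ is an inner divisor of $e_\nu$. *)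

theory Defs
  imports "HOL-Analysis.Analysis"
begin

section \<open>The circle and its space $L^2$\<close>

abbreviation unit_disc :: "complex set"
  where "unit_disc \<equiv> ball 0 1"

abbreviation unit_circle :: "complex set"
  where "unit_circle \<equiv> sphere 0 1"

abbreviation borel_circle :: "complex measure"
  where "borel_circle \<equiv> restrict_space borel unit_circle"

definition arclength :: "complex measure"
  where "arclength = distr (uniform_measure lborel {0..<2 * pi}) borel_circle cis"

lemma sets_arclength [simp, measurable_cong]: "sets arclength = sets borel_circle"
  by (simp add: arclength_def)

lemma space_arclength [simp]: "space arclength = unit_circle"
  by (simp add: arclength_def space_restrict_space)

lemma emeasure_arclength_circle: "emeasure arclength unit_circle = 1"
proof -
  have m: "cis \<in> uniform_measure lborel {0..<2 * pi} \<rightarrow>\<^sub>M borel_circle"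
  proof (rule measurable_restrict_space2)
    have "cis \<in> borel_measurable borel"
      by (intro borel_measurable_continuous_onI continuous_on_cis continuous_on_id)
    then show "cis \<in> borel_measurable (uniform_measure lborel {0..<2 * pi})"
      by (simp cong: measurable_cong_sets)
  qed simp
  have "unit_circle \<in> sets borel_circle"
    by (simp add: sets_restrict_space_iff)
  moreover have "cis -` unit_circle = UNIV"
    by auto
  ultimately show ?thesis
    unfolding arclength_def by (simp add: emeasure_distr[OF m] ennreal_divide_self)
qed

definition square_integrable :: "(complex \<Rightarrow> complex) \<Rightarrow> bool"
  where "square_integrable f \<longleftrightarrow>
    f \<in> borel_measurable arclength \<and> integrable arclength (\<lambda>\<zeta>. (cmod (f \<zeta>))\<^sup>2)"

lemma square_integrable_mult_cnj:
  assumes "square_integrable f" "square_integrable g"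
  shows "integrable arclength (\<lambda>\<zeta>. f \<zeta> * cnj (g \<zeta>))"
proof (rule Bochner_Integration.integrable_bound)
  show "integrable arclength (\<lambda>\<zeta>. (cmod (f \<zeta>))\<^sup>2 + (cmod (g \<zeta>))\<^sup>2)"
    using assms by (auto simp: square_integrable_def)
  show "(\<lambda>\<zeta>. f \<zeta> * cnj (g \<zeta>)) \<in> borel_measurable arclength"
    using assms by (auto simp: square_integrable_def intro!: borel_measurable_times
        borel_measurable_continuous_on[OF continuous_on_cnj[OF continuous_on_id]])
  have "a * b \<le> a\<^sup>2 + b\<^sup>2" if "0 \<le> a" "0 \<le> b" for a b :: real
    using sum_squares_bound[of a b] mult_nonneg_nonneg[OF that] by linarith
  then show "AE \<zeta> in arclength.
      norm (f \<zeta> * cnj (g \<zeta>)) \<le> norm ((cmod (f \<zeta>))\<^sup>2 + (cmod (g \<zeta>))\<^sup>2)"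
    by (simp add: norm_mult)
qed

lemma square_integrable_zero: "square_integrable (\<lambda>_. 0)"
  by (simp add: square_integrable_def)

lemma square_integrable_cmult:
  "square_integrable f \<Longrightarrow> square_integrable (\<lambda>\<zeta>. c * f \<zeta>)"
  by (auto simp: square_integrable_def norm_mult power_mult_distrib intro: borel_measurable_times)

lemma square_integrable_add:
  assumes "square_integrable f" "square_integrable g"
  shows "square_integrable (\<lambda>\<zeta>. f \<zeta> + g \<zeta>)"
proof -
  have m [measurable]: "f \<in> borel_measurable arclength" "g \<in> borel_measurable arclength"
    using assms by (auto simp: square_integrable_def)
  have "integrable arclength (\<lambda>\<zeta>. (cmod (f \<zeta> + g \<zeta>))\<^sup>2)"
  proof (rule Bochner_Integration.integrable_bound)
    show "integrable arclength (\<lambda>\<zeta>. 2 * (cmod (f \<zeta>))\<^sup>2 + 2 * (cmod (g \<zeta>))\<^sup>2)"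
      using assms by (auto simp: square_integrable_def)
    have "(cmod (a + b))\<^sup>2 \<le> 2 * (cmod a)\<^sup>2 + 2 * (cmod b)\<^sup>2" for a b
    proof -
      have "(cmod (a + b))\<^sup>2 \<le> (cmod a + cmod b)\<^sup>2"
        by (simp add: norm_triangle_ineq power_mono)
      also have "\<dots> \<le> 2 * (cmod a)\<^sup>2 + 2 * (cmod b)\<^sup>2"
        using sum_squares_bound[of "cmod a" "cmod b"] by (simp add: power2_sum)
      finally show ?thesis .
    qed
    then show "AE \<zeta> in arclength. norm ((cmod (f \<zeta> + g \<zeta>))\<^sup>2)
        \<le> norm (2 * (cmod (f \<zeta>))\<^sup>2 + 2 * (cmod (g \<zeta>))\<^sup>2)"
      by simp
  qed measurable
  then show ?thesis by (simp add: square_integrable_def)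
qed

lemma square_integrable_uminus:
  "square_integrable f \<Longrightarrow> square_integrable (\<lambda>\<zeta>. - f \<zeta>)"
  by (simp add: square_integrable_def)

definition L2_rel :: "(complex \<Rightarrow> complex) \<Rightarrow> (complex \<Rightarrow> complex) \<Rightarrow> bool"
  where "L2_rel f g \<longleftrightarrow>
    square_integrable f \<and> square_integrable g \<and> (AE \<zeta> in arclength. f \<zeta> = g \<zeta>)"

text \<open>Values of representatives off the circle are irrelevant.\<close>

quotient_type circle_L2 = "complex \<Rightarrow> complex" / partial: L2_rel
proof (rule part_equivpI)
  show "\<exists>f. L2_rel f f"
    using square_integrable_zero by (auto simp: L2_rel_def)
  show "symp L2_rel"
    by (auto simp: symp_def L2_rel_def elim: eventually_mono)
  show "transp L2_rel"
    by (auto simp: transp_def L2_rel_def elim: eventually_elim2)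
qed

text \<open>
  The functions \<open>rep_circle_L2\<close> and \<open>abs_circle_L2\<close> pass between an element of $L^2$
  and a representative of it; \<open>abs_circle_L2\<close> is only meaningful on square integrable functions.
\<close>

lemma square_integrable_rep [simp]: "square_integrable (rep_circle_L2 f)"
  using Quotient_rep_reflp[OF Quotient_circle_L2] by (auto simp: L2_rel_def)

lemma rep_abs_circle_L2:
  assumes "square_integrable f"
  shows "AE \<zeta> in arclength. rep_circle_L2 (abs_circle_L2 f) \<zeta> = f \<zeta>"
  using Quotient_rep_abs[OF Quotient_circle_L2, of f] assms by (simp add: L2_rel_def)

lift_definition cscale :: "complex \<Rightarrow> circle_L2 \<Rightarrow> circle_L2" is "\<lambda>c f \<zeta>. c * f \<zeta>"
  by (auto simp: L2_rel_def square_integrable_cmult elim: eventually_mono)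

lift_definition cinner :: "circle_L2 \<Rightarrow> circle_L2 \<Rightarrow> complex"
  is "\<lambda>f g. \<integral>\<zeta>. f \<zeta> * cnj (g \<zeta>) \<partial>arclength"
proof -
  fix f f' g g' assume "L2_rel f f'" "L2_rel g g'"
  then have *: "integrable arclength (\<lambda>\<zeta>. f \<zeta> * cnj (g \<zeta>))"
      "integrable arclength (\<lambda>\<zeta>. f' \<zeta> * cnj (g' \<zeta>))"
      "AE \<zeta> in arclength. f \<zeta> * cnj (g \<zeta>) = f' \<zeta> * cnj (g' \<zeta>)"
    by (auto simp: L2_rel_def intro!: square_integrable_mult_cnj elim: eventually_elim2)
  show "(\<integral>\<zeta>. f \<zeta> * cnj (g \<zeta>) \<partial>arclength) = (\<integral>\<zeta>. f' \<zeta> * cnj (g' \<zeta>) \<partial>arclength)"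
    by (rule integral_cong_AE) (use * in auto)
qed

instantiation circle_L2 :: real_vector
begin

lift_definition zero_circle_L2 :: circle_L2 is "\<lambda>_. 0"
  by (simp add: L2_rel_def square_integrable_zero)

lift_definition plus_circle_L2 :: "circle_L2 \<Rightarrow> circle_L2 \<Rightarrow> circle_L2" is "\<lambda>f g \<zeta>. f \<zeta> + g \<zeta>"
  by (auto simp: L2_rel_def square_integrable_add elim: eventually_elim2)

lift_definition uminus_circle_L2 :: "circle_L2 \<Rightarrow> circle_L2" is "\<lambda>f \<zeta>. - f \<zeta>"
  by (auto simp: L2_rel_def square_integrable_uminus elim: eventually_mono)

definition minus_circle_L2 :: "circle_L2 \<Rightarrow> circle_L2 \<Rightarrow> circle_L2"
  where "minus_circle_L2 f g = f + - g"

definition scaleR_circle_L2 :: "real \<Rightarrow> circle_L2 \<Rightarrow> circle_L2"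
  where "scaleR_circle_L2 r f = cscale (of_real r) f"

instance
proof
  fix f g h :: circle_L2 and a b :: real
  show "f + g + h = f + (g + h)"
    by transfer (auto simp: L2_rel_def add.assoc square_integrable_add)
  show "f + g = g + f"
    by transfer (auto simp: L2_rel_def add.commute square_integrable_add)
  show "0 + f = f"
    by transfer (auto simp: L2_rel_def)
  show "- f + f = 0"
    by transfer (auto simp: L2_rel_def square_integrable_zero)
  show "f - g = f + - g"
    by (fact minus_circle_L2_def)
  show "a *\<^sub>R (f + g) = a *\<^sub>R f + a *\<^sub>R g" unfolding scaleR_circle_L2_def
    by transfer
      (auto simp: L2_rel_def distrib_left square_integrable_add square_integrable_cmult)
  show "(a + b) *\<^sub>R f = a *\<^sub>R f + b *\<^sub>R f" unfolding scaleR_circle_L2_def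
    by transfer
      (auto simp: L2_rel_def distrib_right square_integrable_add square_integrable_cmult)
  show "a *\<^sub>R b *\<^sub>R f = (a * b) *\<^sub>R f" unfolding scaleR_circle_L2_def
    by transfer (auto simp: L2_rel_def mult.assoc square_integrable_cmult)
  show "1 *\<^sub>R f = f" unfolding scaleR_circle_L2_def
    by transfer (auto simp: L2_rel_def)
qed

end

lemma cinner_add_left: "cinner (f + g) h = cinner f h + cinner g h"
  by transfer (auto simp: L2_rel_def distrib_right square_integrable_mult_cnj)

lemma cinner_cscale_left: "cinner (cscale c f) h = c * cinner f h"
  by transfer (auto simp: L2_rel_def mult.assoc)

lemma cinner_commute: "cinner f g = cnj (cinner g f)"
proof transfer
  fix f g :: "complex \<Rightarrow> complex"
  have "(\<integral>\<zeta>. cnj (g \<zeta> * cnj (f \<zeta>)) \<partial>arclength) = cnj (\<integral>\<zeta>. g \<zeta> * cnj (f \<zeta>) \<partial>arclength)"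
    by (rule Bochner_Integration.integral_cnj)
  then show "(\<integral>\<zeta>. f \<zeta> * cnj (g \<zeta>) \<partial>arclength) = cnj (\<integral>\<zeta>. g \<zeta> * cnj (f \<zeta>) \<partial>arclength)"
    by (simp add: mult.commute)
qed

lemma cinner_self: "cinner f f = of_real (\<integral>\<zeta>. (cmod (rep_circle_L2 f \<zeta>))\<^sup>2 \<partial>arclength)"
  unfolding cinner.rep_eq integral_complex_of_real[symmetric] complex_norm_square ..

lemma cinner_self_eq_0: "cinner f f = 0 \<longleftrightarrow> f = 0"
proof
  assume "cinner f f = 0"
  then have "(\<integral>\<zeta>. (cmod (rep_circle_L2 f \<zeta>))\<^sup>2 \<partial>arclength) = 0"
    unfolding cinner_self by simp
  then have "AE \<zeta> in arclength. (cmod (rep_circle_L2 f \<zeta>))\<^sup>2 = 0"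
    using square_integrable_rep[of f]
    by (subst (asm) integral_nonneg_eq_0_iff_AE) (auto simp: square_integrable_def)
  then have "L2_rel (rep_circle_L2 f) (\<lambda>_. 0)"
    by (simp add: L2_rel_def square_integrable_zero)
  then have "abs_circle_L2 (rep_circle_L2 f) = abs_circle_L2 (\<lambda>_. 0)"
    by (rule Quotient_rel_abs[OF Quotient_circle_L2])
  then show "f = 0"
    by (simp add: zero_circle_L2_def Quotient_abs_rep[OF Quotient_circle_L2])
next
  assume "f = 0"
  then show "cinner f f = 0"
    using cinner_cscale_left[of 0 f f] cinner_add_left[of 0 0 f] by simp
qed

instantiation circle_L2 :: real_inner
begin

definition inner_circle_L2 :: "circle_L2 \<Rightarrow> circle_L2 \<Rightarrow> real"
  where "inner_circle_L2 f g = Re (cinner f g)"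

definition norm_circle_L2 :: "circle_L2 \<Rightarrow> real"
  where "norm_circle_L2 f = sqrt (inner f f)"

definition sgn_circle_L2 :: "circle_L2 \<Rightarrow> circle_L2"
  where "sgn_circle_L2 f = f /\<^sub>R norm f"

definition dist_circle_L2 :: "circle_L2 \<Rightarrow> circle_L2 \<Rightarrow> real"
  where "dist_circle_L2 f g = norm (f - g)"

definition uniformity_circle_L2 :: "(circle_L2 \<times> circle_L2) filter"
  where "uniformity_circle_L2 = (INF e\<in>{0<..}. principal {(f, g). dist f g < e})"

definition open_circle_L2 :: "circle_L2 set \<Rightarrow> bool"
  where "open_circle_L2 U \<longleftrightarrow> (\<forall>f\<in>U. \<forall>\<^sub>F (f', g) in uniformity. f' = f \<longrightarrow> g \<in> U)"

instance
proof
  fix f g h :: circle_L2 and r :: real and U :: "circle_L2 set"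
  show "inner f g = inner g f"
    unfolding inner_circle_L2_def by (subst cinner_commute) simp
  show "inner (f + g) h = inner f h + inner g h"
    by (simp add: inner_circle_L2_def cinner_add_left)
  show "inner (r *\<^sub>R f) g = r * inner f g"
    by (simp add: inner_circle_L2_def scaleR_circle_L2_def cinner_cscale_left)
  show "0 \<le> inner f f"
    by (simp add: inner_circle_L2_def cinner_self)
  show "inner f f = 0 \<longleftrightarrow> f = 0"
    unfolding inner_circle_L2_def cinner_self_eq_0[symmetric] cinner_self by simp
  show "norm f = sqrt (inner f f)"
    by (fact norm_circle_L2_def)
  show "sgn f = f /\<^sub>R norm f"
    by (fact sgn_circle_L2_def)
  show "dist f g = norm (f - g)"
    by (fact dist_circle_L2_def)
  show "(uniformity :: (circle_L2 \<times> circle_L2) filter) =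
      (INF e\<in>{0<..}. principal {(f, g). dist f g < e})"
    by (fact uniformity_circle_L2_def)
  show "open U \<longleftrightarrow> (\<forall>f\<in>U. \<forall>\<^sub>F (f', g) in uniformity. f' = f \<longrightarrow> g \<in> U)"
    by (fact open_circle_L2_def)
qed

end

section \<open>Hardy space and model spaces\<close>

definition radial_limit :: "(complex \<Rightarrow> complex) \<Rightarrow> complex \<Rightarrow> complex"
  where "radial_limit u \<zeta> = Lim (at_left (1::real)) (\<lambda>r. u (of_real r * \<zeta>))"

definition hardy_disc :: "(complex \<Rightarrow> complex) set"
  where "hardy_disc = {f. f holomorphic_on unit_disc \<and>
    (\<exists>B. \<forall>r\<in>{0..<1::real}. (\<integral>\<zeta>. (cmod (f (of_real r * \<zeta>)))\<^sup>2 \<partial>arclength) \<le> B)}"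

definition H2 :: "circle_L2 set"
  where "H2 = {g. \<exists>f\<in>hardy_disc. AE \<zeta> in arclength.
    ((\<lambda>r. f (of_real r * \<zeta>)) \<longlongrightarrow> rep_circle_L2 g \<zeta>) (at_left (1::real))}"

text \<open>
  A function \<open>u\<close> on the disc (in the intended use, an inner function) acts on the circle
  through its radial limits, which determine its boundary values almost everywhere.
\<close>

definition model_space :: "(complex \<Rightarrow> complex) \<Rightarrow> circle_L2 set"
  where "model_space u = {f \<in> H2. \<forall>h\<in>H2.
    cinner f (abs_circle_L2 (\<lambda>\<zeta>. radial_limit u \<zeta> * rep_circle_L2 h \<zeta>)) = 0}"

text \<open>The description is proper for every \<open>g\<close> when \<open>K\<close> is a closed complex subspace.\<close>

definition proj :: "circle_L2 set \<Rightarrow> circle_L2 \<Rightarrow> circle_L2"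
  where "proj K g = (THE p. p \<in> K \<and> (\<forall>k\<in>K. cinner (g - p) k = 0))"

definition model_conj :: "(complex \<Rightarrow> complex) \<Rightarrow> circle_L2 \<Rightarrow> circle_L2"
  where "model_conj u f =
    abs_circle_L2 (\<lambda>\<zeta>. radial_limit u \<zeta> * cnj (\<zeta> * rep_circle_L2 f \<zeta>))"

section \<open>Operators on subspaces\<close>

text \<open>
  An operator on a subspace \<open>K\<close> is represented by a function on all of $L^2$, of which only the
  restriction to \<open>K\<close> matters.
\<close>

definition bounded_operator_on :: "circle_L2 set \<Rightarrow> (circle_L2 \<Rightarrow> circle_L2) \<Rightarrow> bool"
  where "bounded_operator_on K A \<longleftrightarrow>
    (\<forall>f\<in>K. A f \<in> K) \<and>
    (\<forall>f\<in>K. \<forall>g\<in>K. A (f + g) = A f + A g) \<and>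
    (\<forall>c. \<forall>f\<in>K. A (cscale c f) = cscale c (A f)) \<and>
    (\<exists>B. \<forall>f\<in>K. norm (A f) \<le> B * norm f)"

definition adjoint_on ::
    "circle_L2 set \<Rightarrow> (circle_L2 \<Rightarrow> circle_L2) \<Rightarrow> (circle_L2 \<Rightarrow> circle_L2) \<Rightarrow> bool"
  where "adjoint_on K A B \<longleftrightarrow>
    (\<forall>g\<in>K. B g \<in> K) \<and> (\<forall>f\<in>K. \<forall>g\<in>K. cinner (A f) g = cinner f (B g))"

text \<open>This is $A^* = CAC$, where the adjoint is taken in the Hilbert space \<open>K\<close>.\<close>

definition C_symmetric_on ::
    "circle_L2 set \<Rightarrow> (circle_L2 \<Rightarrow> circle_L2) \<Rightarrow> (circle_L2 \<Rightarrow> circle_L2) \<Rightarrow> bool"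
  where "C_symmetric_on K C A \<longleftrightarrow> adjoint_on K A (C \<circ> A \<circ> C)"

definition ess_bounded :: "circle_L2 \<Rightarrow> bool"
  where "ess_bounded f \<longleftrightarrow> (\<exists>M. AE \<zeta> in arclength. cmod (rep_circle_L2 f \<zeta>) \<le> M)"

definition truncated_Toeplitz :: "(complex \<Rightarrow> complex) \<Rightarrow> (circle_L2 \<Rightarrow> circle_L2) set"
  where "truncated_Toeplitz u = {A. bounded_operator_on (model_space u) A \<and>
    (\<exists>\<phi>::circle_L2. \<forall>f\<in>model_space u. ess_bounded f \<longrightarrow>
      A f = proj (model_space u)
        (abs_circle_L2 (\<lambda>\<zeta>. rep_circle_L2 \<phi> \<zeta> * rep_circle_L2 f \<zeta>)))}"

section \<open>Singular measures and singular inner functions\<close>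

definition mutually_singular :: "'a measure \<Rightarrow> 'a measure \<Rightarrow> bool"
  where "mutually_singular M N \<longleftrightarrow>
    (\<exists>E\<in>sets M \<inter> sets N. emeasure M E = 0 \<and> emeasure N (space N - E) = 0)"

definition singular_inner :: "complex measure \<Rightarrow> complex \<Rightarrow> complex"
  where "singular_inner \<nu> z = exp (- (\<integral>\<zeta>. (\<zeta> + z) / (\<zeta> - z) \<partial>\<nu>))"

end

(*
  Write u for the singular inner function of nu and, for mu <= nu, factor u = v w with w the
  singular inner function of mu. Composing the symmetry of A with respect to C_u with the symmetry
  of its compression to K_v gives <A w f, w g> = <A f, g> for f, g in K_v. Choose mu of mass
  d = nu(T)/N on an arc of length 2 pi/N around a point z0, which is possible by the pigeonhole
  principle. Then (z0 - z)(1 - w)/d tends to z0 + z in L^2 as N grows; this only involves the norm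
  and the first two Taylor coefficients of w. Applying the invariance to f = (z0 - z) F and
  g = (z0 - z) G with bounded F, G and letting N tend to infinity yields <A F, G> = <A z F, z G>
  whenever F, G, zF, zG lie in K_u, and by Sarason's theorem A is a truncated Toeplitz operator.

  The existence of radial limits rests on a maximal inequality for chordal balls (Vitali covering);
  since members of H^2 are L^2 limits of polynomials, no Lebesgue differentiation is needed.
*)
theory Submission
  imports Defs "HOL-Complex_Analysis.Cauchy_Integral_Formula"
begin

section \<open>The Hilbert space $L^2$ of the circle\<close>

text \<open>The obstacle is the pole of \<open>(z0 + z)/(z0 - z)\<close>: dividing by
  \<open>z0 - z\<close> leaves the model space, so the invariance is tested on
  \<open>(z0 - z) F\<close> with both \<open>F\<close> and \<open>z F\<close> in the space of
  \<open>v\<close>. As \<open>v\<close> changes with \<open>N\<close>, no fixed \<open>F\<close>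
  need serve; the test vectors are formulas in \<open>v\<close>, built from its backward shifts,
  bounded independently of \<open>v\<close> and convergent as \<open>v\<close> tends to
  \<open>u\<close>. Boundedness matters because the difference quotient is controlled in L^2 only.

  The powers of \<open>N\<close> must match. An arc of length of order \<open>1/N\<close> changes
  the first moment of the mass by a relative error of order \<open>1/N^2\<close>, which the squared
  L^2 distance divides by \<open>d\<close>; with \<open>d\<close> of order \<open>1/N\<close> the
  quotient tends to zero. An atom may carry more than \<open>d\<close>, so \<open>mu\<close> is a
  density with values in [0,1], not a restriction to the arc.

  To first order in \<open>d\<close> the invariance reads
  \<open><A (z0 - z) F, (z0 + z) G> + <A (z0 + z) F, (z0 - z) G> = 0\<close>. Mixed terms cancel and
  \<open>|z0| = 1\<close> gives the others opposite weights, whatever the point is, so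
  \<open>z0\<close> may move with \<open>N\<close>.\<close>

interpretation arclength: finite_measure arclength
  by (rule finite_measureI) (simp add: emeasure_arclength_circle)

lemma measure_arclength_circle [simp]: "measure arclength unit_circle = 1"
  by (simp add: measure_def emeasure_arclength_circle)

lemma borel_measurable_cnj [measurable]: "cnj \<in> borel_measurable borel"
  by (intro borel_measurable_continuous_onI continuous_intros)

lemma square_integrable_measurable [measurable_dest]:
  "square_integrable f \<Longrightarrow> f \<in> borel_measurable arclength"
  by (simp add: square_integrable_def)

lemma measurable_rep [measurable]: "rep_circle_L2 f \<in> borel_measurable arclength"
  using square_integrable_rep by (rule square_integrable_measurable)

lemma circle_L2_eq_iff: "f = g \<longleftrightarrow> (AE \<zeta> in arclength. rep_circle_L2 f \<zeta> = rep_circle_L2 g \<zeta>)"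
  using Quotient_rel_rep[OF Quotient_circle_L2, of f g] by (simp add: L2_rel_def)

lemma abs_circle_L2_eqI:
  assumes "square_integrable f" "square_integrable g" "AE \<zeta> in arclength. f \<zeta> = g \<zeta>"
  shows "abs_circle_L2 f = abs_circle_L2 g"
  using assms by (intro Quotient_rel_abs[OF Quotient_circle_L2]) (simp add: L2_rel_def)

lemma abs_rep_circle_L2 [simp]: "abs_circle_L2 (rep_circle_L2 f) = f"
  by (rule Quotient_abs_rep[OF Quotient_circle_L2])

lemma rep_plus: "AE \<zeta> in arclength. rep_circle_L2 (f + g) \<zeta> = rep_circle_L2 f \<zeta> + rep_circle_L2 g \<zeta>"
  unfolding plus_circle_L2_def map_fun_def comp_def id_def
  by (intro rep_abs_circle_L2 square_integrable_add square_integrable_rep)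

lemma rep_cscale: "AE \<zeta> in arclength. rep_circle_L2 (cscale c f) \<zeta> = c * rep_circle_L2 f \<zeta>"
  unfolding cscale_def map_fun_def comp_def id_def
  by (intro rep_abs_circle_L2 square_integrable_cmult square_integrable_rep)

lemma rep_uminus: "AE \<zeta> in arclength. rep_circle_L2 (- f) \<zeta> = - rep_circle_L2 f \<zeta>"
  unfolding uminus_circle_L2_def map_fun_def comp_def id_def
  by (intro rep_abs_circle_L2 square_integrable_uminus square_integrable_rep)

lemma rep_zero: "AE \<zeta> in arclength. rep_circle_L2 0 \<zeta> = 0"
  unfolding zero_circle_L2_def by (intro rep_abs_circle_L2 square_integrable_zero)

lemma rep_minus: "AE \<zeta> in arclength. rep_circle_L2 (f - g) \<zeta> = rep_circle_L2 f \<zeta> - rep_circle_L2 g \<zeta>"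
  unfolding minus_circle_L2_def using rep_plus[of f "- g"] rep_uminus[of g] by eventually_elim simp

lemma cscale_add_right: "cscale c (f + g) = cscale c f + cscale c g"
  unfolding circle_L2_eq_iff
  using rep_plus[of f g] rep_plus[of "cscale c f" "cscale c g"] rep_cscale[of c f] rep_cscale[of c g]
    rep_cscale[of c "f + g"]
  by eventually_elim (simp add: distrib_left)

lemma cscale_cscale [simp]: "cscale c (cscale d f) = cscale (c * d) f"
  unfolding circle_L2_eq_iff
  using rep_cscale[of c "cscale d f"] rep_cscale[of d f] rep_cscale[of "c * d" f]
  by eventually_elim simp

lemma cscale_one [simp]: "cscale 1 f = f"
  unfolding circle_L2_eq_iff using rep_cscale[of 1 f] by eventually_elim simp

lemma cscale_zero [simp]: "cscale 0 f = 0"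
  unfolding circle_L2_eq_iff using rep_cscale[of 0 f] rep_zero by eventually_elim simp

lemma cscale_zero_right [simp]: "cscale c 0 = 0"
  unfolding circle_L2_eq_iff using rep_cscale[of c 0] rep_zero by eventually_elim simp

lemma uminus_eq_cscale: "- f = cscale (- 1) f"
  unfolding circle_L2_eq_iff using rep_cscale[of "- 1" f] rep_uminus[of f] by eventually_elim simp

lemma cscale_minus_right: "cscale c (f - g) = cscale c f - cscale c g"
  by (simp add: minus_circle_L2_def cscale_add_right uminus_eq_cscale)

lemma cinner_cscale_right: "cinner f (cscale c g) = cnj c * cinner f g"
  by (subst (1 2) cinner_commute) (simp add: cinner_cscale_left)

lemma cinner_add_right: "cinner f (g + h) = cinner f g + cinner f h"
  by (subst (1 2 3) cinner_commute) (simp add: cinner_add_left)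

lemma cinner_minus_left: "cinner (f - g) h = cinner f h - cinner g h"
  by (simp add: minus_circle_L2_def cinner_add_left uminus_eq_cscale cinner_cscale_left)

lemma cinner_minus_right: "cinner f (g - h) = cinner f g - cinner f h"
  by (simp add: minus_circle_L2_def cinner_add_right uminus_eq_cscale cinner_cscale_right)

lemma cinner_uminus_left: "cinner (- f) h = - cinner f h"
  by (simp add: uminus_eq_cscale cinner_cscale_left)

lemma cinner_uminus_right: "cinner h (- f) = - cinner h f"
  by (simp add: uminus_eq_cscale cinner_cscale_right)

lemma cinner_zero_left [simp]: "cinner 0 f = 0"
  using cinner_cscale_left[of 0 0 f] by simp

lemma cinner_zero_right [simp]: "cinner f 0 = 0"
  using cinner_cscale_right[of f 0 0] by simp

lemma cinner_sum_left: "cinner (\<Sum>i\<in>I. f i) g = (\<Sum>i\<in>I. cinner (f i) g)"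
  by (induction I rule: infinite_finite_induct) (auto simp: cinner_add_left)

lemma cinner_sum_right: "cinner g (\<Sum>i\<in>I. f i) = (\<Sum>i\<in>I. cinner g (f i))"
  by (induction I rule: infinite_finite_induct) (auto simp: cinner_add_right)

lemmas cinner_simps = cinner_add_left cinner_add_right cinner_minus_left cinner_minus_right
  cinner_cscale_left cinner_cscale_right cinner_sum_left cinner_sum_right
  cinner_uminus_left cinner_uminus_right

lemma cinner_self_norm: "cinner f f = of_real ((norm f)\<^sup>2)"
proof -
  have "(norm f)\<^sup>2 = Re (cinner f f)"
    by (simp add: power2_norm_eq_inner inner_circle_L2_def)
  then show ?thesis by (simp add: cinner_self)
qed

lemma norm_sq_integral: "(norm f)\<^sup>2 = (\<integral>\<zeta>. (cmod (rep_circle_L2 f \<zeta>))\<^sup>2 \<partial>arclength)"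
  using cinner_self[of f] unfolding cinner_self_norm of_real_eq_iff .

lemma norm_cscale: "norm (cscale c f) = cmod c * norm f"
proof -
  have "complex_of_real ((norm (cscale c f))\<^sup>2) = (c * cnj c) * of_real ((norm f)\<^sup>2)"
    unfolding cinner_self_norm[symmetric] by (simp add: cinner_simps)
  also have "\<dots> = of_real ((cmod c * norm f)\<^sup>2)"
    by (simp add: power_mult_distrib flip: complex_norm_square)
  finally have "complex_of_real ((norm (cscale c f))\<^sup>2) = of_real ((cmod c * norm f)\<^sup>2)" .
  then show ?thesis unfolding of_real_eq_iff by (rule power2_eq_imp_eq) auto
qed

lemma cmod_cinner_le: "cmod (cinner f g) \<le> norm f * norm g"
proof (cases "cinner f g = 0")
  case False
  define c where "c = cnj (sgn (cinner f g))"
  have "cmod (cinner f g) = Re (c * cinner f g)"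
    using False by (simp add: c_def sgn_eq field_simps power2_eq_square flip: complex_norm_square)
  also have "\<dots> = inner (cscale c f) g"
    by (simp add: inner_circle_L2_def cinner_cscale_left)
  also have "\<dots> \<le> norm (cscale c f) * norm g"
    by (rule norm_cauchy_schwarz)
  also have "norm (cscale c f) = norm f"
    using False by (simp add: norm_cscale c_def norm_sgn)
  finally show ?thesis .
qed simp

lemma tendsto_cinner [tendsto_intros]:
  assumes f: "(f \<longlongrightarrow> a) F" and g: "(g \<longlongrightarrow> b) F"
  shows "((\<lambda>x. cinner (f x) (g x)) \<longlongrightarrow> cinner a b) F"
proof -
  have "bounded_bilinear cinner"
    by (rule bounded_bilinear.intro)
      (auto simp: cinner_simps scaleR_circle_L2_def scaleR_conv_of_real intro!: exI[of _ 1] cmod_cinner_le)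
  then show ?thesis using assms by (rule bounded_bilinear.tendsto)
qed

lemma tendsto_cscale [tendsto_intros]:
  assumes f: "(f \<longlongrightarrow> a) F" and g: "(g \<longlongrightarrow> b) F"
  shows "((\<lambda>x. cscale (f x) (g x)) \<longlongrightarrow> cscale a b) F"
proof -
  have "cscale (a + a') g = cscale a g + cscale a' g" for a a' g
    unfolding circle_L2_eq_iff
    using rep_cscale[of a g] rep_cscale[of a' g] rep_cscale[of "a + a'" g] rep_plus[of "cscale a g" "cscale a' g"]
    by eventually_elim (simp add: distrib_right)
  then have "bounded_bilinear cscale"
    by (intro bounded_bilinear.intro exI[of _ 1])
      (auto simp: cscale_add_right scaleR_circle_L2_def norm_cscale scaleR_conv_of_real mult.commute)
  then show ?thesis using assms by (rule bounded_bilinear.tendsto)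
qed

lemma cinner_eqI: "(\<And>h. cinner f h = cinner g h) \<Longrightarrow> f = g"
  using cinner_self_eq_0[of "f - g"] by (simp add: cinner_simps)

lemma cinner_eq_integral_abs:
  assumes "square_integrable f" "square_integrable g"
  shows "cinner (abs_circle_L2 f) (abs_circle_L2 g) = (\<integral>\<zeta>. f \<zeta> * cnj (g \<zeta>) \<partial>arclength)"
proof -
  have [measurable]: "f \<in> borel_measurable arclength" "g \<in> borel_measurable arclength"
    using assms by (auto dest: square_integrable_measurable)
  show ?thesis unfolding cinner.rep_eq
  proof (rule integral_cong_AE)
    show "AE \<zeta> in arclength. rep_circle_L2 (abs_circle_L2 f) \<zeta> * cnj (rep_circle_L2 (abs_circle_L2 g) \<zeta>)
        = f \<zeta> * cnj (g \<zeta>)"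
      using rep_abs_circle_L2[OF assms(1)] rep_abs_circle_L2[OF assms(2)] by eventually_elim simp
  qed measurable
qed

lemma norm_abs_sq:
  assumes "square_integrable f"
  shows "(norm (abs_circle_L2 f))\<^sup>2 = (\<integral>\<zeta>. (cmod (f \<zeta>))\<^sup>2 \<partial>arclength)"
proof -
  have [measurable]: "f \<in> borel_measurable arclength"
    using assms by (auto dest: square_integrable_measurable)
  show ?thesis unfolding norm_sq_integral
  proof (rule integral_cong_AE)
    show "AE \<zeta> in arclength. (cmod (rep_circle_L2 (abs_circle_L2 f) \<zeta>))\<^sup>2 = (cmod (f \<zeta>))\<^sup>2"
      using rep_abs_circle_L2[OF assms(1)] by eventually_elim simp
  qed measurable
qed

section \<open>Multiplication by bounded symbols, and complex conjugation\<close>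

definition bounded_symbol :: "(complex \<Rightarrow> complex) \<Rightarrow> bool"
  where "bounded_symbol b \<longleftrightarrow> b \<in> borel_measurable arclength \<and> (\<exists>M. AE \<zeta> in arclength. cmod (b \<zeta>) \<le> M)"

definition mult_L2 :: "(complex \<Rightarrow> complex) \<Rightarrow> circle_L2 \<Rightarrow> circle_L2"
  where "mult_L2 b f = abs_circle_L2 (\<lambda>\<zeta>. b \<zeta> * rep_circle_L2 f \<zeta>)"

lemma square_integrable_bounded_mult:
  assumes b: "b \<in> borel_measurable arclength" "AE \<zeta> in arclength. cmod (b \<zeta>) \<le> M" and f: "square_integrable f"
  shows "square_integrable (\<lambda>\<zeta>. b \<zeta> * f \<zeta>)"
    and "(\<integral>\<zeta>. (cmod (b \<zeta> * f \<zeta>))\<^sup>2 \<partial>arclength) \<le> M\<^sup>2 * (\<integral>\<zeta>. (cmod (f \<zeta>))\<^sup>2 \<partial>arclength)"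
proof -
  note [measurable] = b(1) square_integrable_measurable[OF f]
  have i: "integrable arclength (\<lambda>\<zeta>. M\<^sup>2 * (cmod (f \<zeta>))\<^sup>2)"
    using f by (simp add: square_integrable_def)
  have le: "AE \<zeta> in arclength. (cmod (b \<zeta> * f \<zeta>))\<^sup>2 \<le> M\<^sup>2 * (cmod (f \<zeta>))\<^sup>2"
    using b(2) by eventually_elim (auto simp: norm_mult power_mult_distrib intro!: mult_right_mono power_mono)
  have i': "integrable arclength (\<lambda>\<zeta>. (cmod (b \<zeta> * f \<zeta>))\<^sup>2)"
  proof (rule Bochner_Integration.integrable_bound[OF i])
    show "AE \<zeta> in arclength. norm ((cmod (b \<zeta> * f \<zeta>))\<^sup>2) \<le> norm (M\<^sup>2 * (cmod (f \<zeta>))\<^sup>2)"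
      using le by eventually_elim simp
  qed measurable
  then show "square_integrable (\<lambda>\<zeta>. b \<zeta> * f \<zeta>)"
    by (simp add: square_integrable_def)
  show "(\<integral>\<zeta>. (cmod (b \<zeta> * f \<zeta>))\<^sup>2 \<partial>arclength) \<le> M\<^sup>2 * (\<integral>\<zeta>. (cmod (f \<zeta>))\<^sup>2 \<partial>arclength)"
    using integral_mono_AE[OF i' i le] by simp
qed

lemma square_integrable_symbol_mult:
  "bounded_symbol b \<Longrightarrow> square_integrable f \<Longrightarrow> square_integrable (\<lambda>\<zeta>. b \<zeta> * f \<zeta>)"
  unfolding bounded_symbol_def by (auto intro: square_integrable_bounded_mult)

lemma rep_mult_L2:
  "bounded_symbol b \<Longrightarrow> AE \<zeta> in arclength. rep_circle_L2 (mult_L2 b f) \<zeta> = b \<zeta> * rep_circle_L2 f \<zeta>"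
  unfolding mult_L2_def by (intro rep_abs_circle_L2 square_integrable_symbol_mult) auto

lemma norm_mult_L2_le:
  assumes "b \<in> borel_measurable arclength" "AE \<zeta> in arclength. cmod (b \<zeta>) \<le> M" "0 \<le> M"
  shows "norm (mult_L2 b f) \<le> M * norm f"
proof (rule power2_le_imp_le)
  have "bounded_symbol b" using assms by (auto simp: bounded_symbol_def)
  show "(norm (mult_L2 b f))\<^sup>2 \<le> (M * norm f)\<^sup>2"
    unfolding mult_L2_def norm_abs_sq[OF square_integrable_symbol_mult[OF \<open>bounded_symbol b\<close> square_integrable_rep]]
      power_mult_distrib norm_sq_integral[of f]
    by (rule square_integrable_bounded_mult[OF assms(1,2) square_integrable_rep])
qed (use assms in auto)

lemma bounded_symbol_mult [intro]:
  assumes "bounded_symbol a" "bounded_symbol b" shows "bounded_symbol (\<lambda>\<zeta>. a \<zeta> * b \<zeta>)"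
proof -
  obtain M N where *: "AE \<zeta> in arclength. cmod (a \<zeta>) \<le> M" "AE \<zeta> in arclength. cmod (b \<zeta>) \<le> N"
    using assms by (auto simp: bounded_symbol_def)
  have "AE \<zeta> in arclength. cmod (a \<zeta> * b \<zeta>) \<le> M * N"
    using * by eventually_elim (auto simp: norm_mult intro!: mult_mono order_trans[OF norm_ge_zero])
  then show ?thesis using assms by (auto simp: bounded_symbol_def intro: borel_measurable_times)
qed

lemma bounded_symbol_cnj [intro]: "bounded_symbol a \<Longrightarrow> bounded_symbol (\<lambda>\<zeta>. cnj (a \<zeta>))"
  by (auto simp: bounded_symbol_def)

lemma bounded_symbol_add [intro]:
  assumes "bounded_symbol a" "bounded_symbol b" shows "bounded_symbol (\<lambda>\<zeta>. a \<zeta> + b \<zeta>)"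
proof -
  obtain M N where *: "AE \<zeta> in arclength. cmod (a \<zeta>) \<le> M" "AE \<zeta> in arclength. cmod (b \<zeta>) \<le> N"
    using assms by (auto simp: bounded_symbol_def)
  have "AE \<zeta> in arclength. cmod (a \<zeta> + b \<zeta>) \<le> M + N"
    using * by eventually_elim (auto intro: norm_triangle_mono)
  then show ?thesis using assms by (auto simp: bounded_symbol_def)
qed

lemma bounded_symbol_const [intro, simp]: "bounded_symbol (\<lambda>_. c)"
  by (auto simp: bounded_symbol_def)

lemma bounded_symbol_uminus [intro]: "bounded_symbol a \<Longrightarrow> bounded_symbol (\<lambda>\<zeta>. - a \<zeta>)"
  by (auto simp: bounded_symbol_def)

lemma bounded_symbol_diff [intro]:
  assumes "bounded_symbol a" "bounded_symbol b" shows "bounded_symbol (\<lambda>\<zeta>. a \<zeta> - b \<zeta>)"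
  using bounded_symbol_add[OF assms(1) bounded_symbol_uminus[OF assms(2)]] by simp

lemma bounded_symbol_square_integrable: "bounded_symbol b \<Longrightarrow> square_integrable b"
  using square_integrable_symbol_mult[of b "\<lambda>_. 1"] by (simp add: square_integrable_def)

lemma mult_L2_mult_L2 [simp]:
  assumes "bounded_symbol a" "bounded_symbol b"
  shows "mult_L2 a (mult_L2 b f) = mult_L2 (\<lambda>\<zeta>. a \<zeta> * b \<zeta>) f"
  unfolding circle_L2_eq_iff
  using rep_mult_L2[OF assms(1), of "mult_L2 b f"] rep_mult_L2[OF assms(2), of f]
    rep_mult_L2[OF bounded_symbol_mult[OF assms], of f]
  by eventually_elim simp

lemma mult_L2_cong:
  assumes "bounded_symbol a" "bounded_symbol b" "AE \<zeta> in arclength. a \<zeta> = b \<zeta>"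
  shows "mult_L2 a f = mult_L2 b f"
  unfolding circle_L2_eq_iff
  using rep_mult_L2[OF assms(1), of f] rep_mult_L2[OF assms(2), of f] assms(3)
  by eventually_elim simp

lemma mult_L2_const: "mult_L2 (\<lambda>_. c) f = cscale c f"
  unfolding circle_L2_eq_iff
  using rep_mult_L2[of "\<lambda>_. c" f, OF bounded_symbol_const] rep_cscale[of c f] by eventually_elim simp

lemma mult_L2_add:
  assumes b: "bounded_symbol b" shows "mult_L2 b (f + g) = mult_L2 b f + mult_L2 b g"
  unfolding circle_L2_eq_iff
  using rep_mult_L2[OF b, of f] rep_mult_L2[OF b, of g] rep_mult_L2[OF b, of "f + g"] rep_plus[of f g]
    rep_plus[of "mult_L2 b f" "mult_L2 b g"]
  by eventually_elim (simp add: distrib_left)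

lemma mult_L2_cscale:
  assumes b: "bounded_symbol b" shows "mult_L2 b (cscale c f) = cscale c (mult_L2 b f)"
  unfolding circle_L2_eq_iff
  using rep_mult_L2[OF b, of f] rep_mult_L2[OF b, of "cscale c f"] rep_cscale[of c f] rep_cscale[of c "mult_L2 b f"]
  by eventually_elim simp

lemma mult_L2_minus: "bounded_symbol b \<Longrightarrow> mult_L2 b (f - g) = mult_L2 b f - mult_L2 b g"
  by (simp add: minus_circle_L2_def mult_L2_add uminus_eq_cscale mult_L2_cscale)

lemma mult_L2_zero [simp]: "bounded_symbol b \<Longrightarrow> mult_L2 b 0 = 0"
  using mult_L2_cscale[of b 0 0] by simp

lemma mult_L2_sum: "bounded_symbol b \<Longrightarrow> mult_L2 b (\<Sum>i\<in>I. f i) = (\<Sum>i\<in>I. mult_L2 b (f i))"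
  by (induction I rule: infinite_finite_induct) (auto simp: mult_L2_add)

lemma mult_L2_diff_symbol:
  assumes "bounded_symbol a" "bounded_symbol b"
  shows "mult_L2 (\<lambda>\<zeta>. a \<zeta> - b \<zeta>) f = mult_L2 a f - mult_L2 b f"
  unfolding circle_L2_eq_iff
  using rep_mult_L2[OF assms(1), of f] rep_mult_L2[OF assms(2), of f]
    rep_mult_L2[OF bounded_symbol_diff[OF assms], of f] rep_minus[of "mult_L2 a f" "mult_L2 b f"]
  by eventually_elim (simp add: left_diff_distrib)

lemma mult_L2_add_symbol:
  assumes "bounded_symbol a" "bounded_symbol b"
  shows "mult_L2 (\<lambda>\<zeta>. a \<zeta> + b \<zeta>) f = mult_L2 a f + mult_L2 b f"
  unfolding circle_L2_eq_iff
  using rep_mult_L2[OF assms(1), of f] rep_mult_L2[OF assms(2), of f]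
    rep_mult_L2[OF bounded_symbol_add[OF assms], of f] rep_plus[of "mult_L2 a f" "mult_L2 b f"]
  by eventually_elim (simp add: distrib_right)

lemma mult_L2_abs:
  assumes b: "bounded_symbol b" and f: "square_integrable f"
  shows "mult_L2 b (abs_circle_L2 f) = abs_circle_L2 (\<lambda>\<zeta>. b \<zeta> * f \<zeta>)"
  unfolding mult_L2_def
proof (rule abs_circle_L2_eqI)
  show "AE \<zeta> in arclength. b \<zeta> * rep_circle_L2 (abs_circle_L2 f) \<zeta> = b \<zeta> * f \<zeta>"
    using rep_abs_circle_L2[OF f] by eventually_elim simp
qed (use assms in \<open>auto intro: square_integrable_symbol_mult\<close>)

lemma cinner_mult_L2_left:
  assumes b: "bounded_symbol b"
  shows "cinner (mult_L2 b f) g = cinner f (mult_L2 (\<lambda>\<zeta>. cnj (b \<zeta>)) g)"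
proof -
  have [measurable]: "b \<in> borel_measurable arclength" using b by (simp add: bounded_symbol_def)
  show ?thesis unfolding cinner.rep_eq
  proof (rule integral_cong_AE)
    show "AE \<zeta> in arclength. rep_circle_L2 (mult_L2 b f) \<zeta> * cnj (rep_circle_L2 g \<zeta>) =
        rep_circle_L2 f \<zeta> * cnj (rep_circle_L2 (mult_L2 (\<lambda>\<zeta>. cnj (b \<zeta>)) g) \<zeta>)"
      using rep_mult_L2[OF b, of f] rep_mult_L2[OF bounded_symbol_cnj[OF b], of g]
      by eventually_elim simp
  qed measurable
qed

lemma bounded_linear_mult_L2:
  assumes "bounded_symbol b" shows "bounded_linear (mult_L2 b)"
proof -
  obtain M where M: "AE \<zeta> in arclength. cmod (b \<zeta>) \<le> M" using assms by (auto simp: bounded_symbol_def)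
  have "AE \<zeta> in arclength. cmod (b \<zeta>) \<le> max 0 M" using M by eventually_elim auto
  then show ?thesis using assms norm_mult_L2_le[of b "max 0 M"]
    by (intro bounded_linear_intro[of _ "max 0 M"])
      (auto simp: mult_L2_add scaleR_circle_L2_def mult_L2_cscale bounded_symbol_def mult.commute)
qed

definition unimodular :: "(complex \<Rightarrow> complex) \<Rightarrow> bool"
  where "unimodular b \<longleftrightarrow> b \<in> borel_measurable arclength \<and> (AE \<zeta> in arclength. cmod (b \<zeta>) = 1)"

lemma unimodular_bounded [intro]: "unimodular b \<Longrightarrow> bounded_symbol b"
  unfolding unimodular_def bounded_symbol_def by (auto intro!: exI[of _ 1] elim: eventually_mono)

lemma unimodular_cnj [intro]: "unimodular b \<Longrightarrow> unimodular (\<lambda>\<zeta>. cnj (b \<zeta>))"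
  unfolding unimodular_def by auto

lemma mult_L2_unimodular_inverse:
  assumes "unimodular b"
  shows "mult_L2 b (mult_L2 (\<lambda>\<zeta>. cnj (b \<zeta>)) f) = f" "mult_L2 (\<lambda>\<zeta>. cnj (b \<zeta>)) (mult_L2 b f) = f"
proof -
  have *: "AE \<zeta> in arclength. b \<zeta> * cnj (b \<zeta>) = 1"
    using assms unfolding unimodular_def
    by (auto elim!: eventually_mono simp flip: complex_norm_square)
  have "mult_L2 b (mult_L2 (\<lambda>\<zeta>. cnj (b \<zeta>)) f) = mult_L2 (\<lambda>_. 1) f"
    using assms * by (subst mult_L2_mult_L2) (auto intro!: mult_L2_cong bounded_symbol_mult)
  then show "mult_L2 b (mult_L2 (\<lambda>\<zeta>. cnj (b \<zeta>)) f) = f" by (simp add: mult_L2_const)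
  have "mult_L2 (\<lambda>\<zeta>. cnj (b \<zeta>)) (mult_L2 b f) = mult_L2 (\<lambda>_. 1) f"
    using assms * by (subst mult_L2_mult_L2) (auto intro!: mult_L2_cong bounded_symbol_mult simp: mult.commute)
  then show "mult_L2 (\<lambda>\<zeta>. cnj (b \<zeta>)) (mult_L2 b f) = f" by (simp add: mult_L2_const)
qed

lemma cinner_mult_L2_unimodular:
  assumes "unimodular b" shows "cinner (mult_L2 b f) (mult_L2 b g) = cinner f g"
  using assms by (simp add: cinner_mult_L2_left unimodular_bounded mult_L2_unimodular_inverse del: mult_L2_mult_L2)

lemma norm_mult_L2_unimodular:
  assumes "unimodular b" shows "norm (mult_L2 b f) = norm f"
  using cinner_mult_L2_unimodular[OF assms, of f f] unfolding cinner_self_norm of_real_eq_iff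
  by (simp add: power2_eq_iff_nonneg)

lemma square_integrable_cnj: "square_integrable f \<Longrightarrow> square_integrable (\<lambda>\<zeta>. cnj (f \<zeta>))"
  by (auto simp: square_integrable_def)

definition cnj_L2 :: "circle_L2 \<Rightarrow> circle_L2"
  where "cnj_L2 f = abs_circle_L2 (\<lambda>\<zeta>. cnj (rep_circle_L2 f \<zeta>))"

lemma rep_cnj_L2: "AE \<zeta> in arclength. rep_circle_L2 (cnj_L2 f) \<zeta> = cnj (rep_circle_L2 f \<zeta>)"
  unfolding cnj_L2_def by (intro rep_abs_circle_L2 square_integrable_cnj square_integrable_rep)

lemma cnj_L2_cnj_L2 [simp]: "cnj_L2 (cnj_L2 f) = f"
  unfolding circle_L2_eq_iff using rep_cnj_L2[of f] rep_cnj_L2[of "cnj_L2 f"] by eventually_elim simp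

lemma cnj_L2_mult_L2:
  assumes b: "bounded_symbol b"
  shows "cnj_L2 (mult_L2 b f) = mult_L2 (\<lambda>\<zeta>. cnj (b \<zeta>)) (cnj_L2 f)"
  unfolding circle_L2_eq_iff
  using rep_cnj_L2[of f] rep_cnj_L2[of "mult_L2 b f"] rep_mult_L2[OF b, of f]
    rep_mult_L2[OF bounded_symbol_cnj[OF b], of "cnj_L2 f"]
  by eventually_elim simp

lemma cinner_cnj_L2: "cinner (cnj_L2 f) (cnj_L2 g) = cnj (cinner f g)"
proof -
  have "cinner (cnj_L2 f) (cnj_L2 g) = (\<integral>\<zeta>. cnj (rep_circle_L2 f \<zeta> * cnj (rep_circle_L2 g \<zeta>)) \<partial>arclength)"
    unfolding cinner.rep_eq
  proof (rule integral_cong_AE)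
    show "AE \<zeta> in arclength. rep_circle_L2 (cnj_L2 f) \<zeta> * cnj (rep_circle_L2 (cnj_L2 g) \<zeta>) =
        cnj (rep_circle_L2 f \<zeta> * cnj (rep_circle_L2 g \<zeta>))"
      using rep_cnj_L2[of f] rep_cnj_L2[of g] by eventually_elim simp
  qed measurable
  also have "\<dots> = cnj (cinner f g)"
    unfolding cinner.rep_eq by (rule Bochner_Integration.integral_cnj)
  finally show ?thesis .
qed

section \<open>Completeness and orthogonal projections\<close>

lemma integral_norm_le_norm:
  assumes "square_integrable f"
  shows "integrable arclength f" "(\<integral>\<zeta>. cmod (f \<zeta>) \<partial>arclength) \<le> norm (abs_circle_L2 f)"
proof -
  have sn: "square_integrable (\<lambda>\<zeta>. of_real (cmod (f \<zeta>)))"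
    using assms by (auto simp: square_integrable_def)
  have s1: "square_integrable (\<lambda>_. 1)" by (simp add: bounded_symbol_square_integrable)
  show "integrable arclength f"
    using square_integrable_mult_cnj[OF assms s1] by simp
  have n1: "norm (abs_circle_L2 (\<lambda>_. 1)) = 1"
    by (rule power2_eq_imp_eq) (simp_all add: norm_abs_sq[OF s1])
  \<comment> \<open>Cauchy-Schwarz against the constant \<open>1\<close>, which has norm one because
    arclength is a probability measure.\<close>
  have "complex_of_real (\<integral>\<zeta>. cmod (f \<zeta>) \<partial>arclength) = cinner (abs_circle_L2 (\<lambda>\<zeta>. of_real (cmod (f \<zeta>)))) (abs_circle_L2 (\<lambda>_. 1))"
    using cinner_eq_integral_abs[OF sn s1] by simp
  then have "(\<integral>\<zeta>. cmod (f \<zeta>) \<partial>arclength) \<le> norm (abs_circle_L2 (\<lambda>\<zeta>. of_real (cmod (f \<zeta>))))"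
    using cmod_cinner_le[of "abs_circle_L2 (\<lambda>\<zeta>. of_real (cmod (f \<zeta>)))" "abs_circle_L2 (\<lambda>_. 1)"] n1
    by (metis Re_complex_of_real abs_Re_le_cmod abs_ge_self mult.right_neutral order_trans)
  also have "\<dots> = norm (abs_circle_L2 f)"
    by (rule power2_eq_imp_eq) (simp_all add: norm_abs_sq[OF sn] norm_abs_sq[OF assms])
  finally show "(\<integral>\<zeta>. cmod (f \<zeta>) \<partial>arclength) \<le> norm (abs_circle_L2 f)" .
qed

text \<open>On a finite measure space a Cauchy sequence in L^2 is Cauchy in L^1, so a subsequence
  converges almost everywhere; Fatou's lemma then turns the pointwise limit into a norm limit of the
  whole sequence. \<open>circle_L2\<close> is only an instance of \<open>real_inner\<close>, so
  completeness is recorded as a separate fact.\<close>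

lemma circle_L2_Cauchy_convergent:
  fixes X :: "nat \<Rightarrow> circle_L2"
  assumes "Cauchy X" shows "convergent X"
proof -
  define s where "s n = rep_circle_L2 (X n)" for n
  have sq: "square_integrable (s n)" for n by (simp add: s_def)
  note [measurable] = square_integrable_measurable[OF sq]
  have norm_diff: "(norm (X i - X j))\<^sup>2 = (\<integral>\<zeta>. (cmod (s i \<zeta> - s j \<zeta>))\<^sup>2 \<partial>arclength)" for i j
    unfolding norm_sq_integral s_def
  proof (rule integral_cong_AE)
    show "AE \<zeta> in arclength. (cmod (rep_circle_L2 (X i - X j) \<zeta>))\<^sup>2 = (cmod (rep_circle_L2 (X i) \<zeta> - rep_circle_L2 (X j) \<zeta>))\<^sup>2"
      using rep_minus[of "X i" "X j"] by eventually_elim simp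
  qed measurable
  have sqd: "square_integrable (\<lambda>\<zeta>. s i \<zeta> - s j \<zeta>)" for i j
    using square_integrable_add[OF sq[of i] square_integrable_uminus[OF sq[of j]]] by simp
  have nabs: "norm (abs_circle_L2 (\<lambda>\<zeta>. s i \<zeta> - s j \<zeta>)) = norm (X i - X j)" for i j
    by (rule power2_eq_imp_eq) (simp_all add: norm_abs_sq[OF sqd] norm_diff)
  obtain r where r: "strict_mono r" and ae: "AE \<zeta> in arclength. Cauchy (\<lambda>i. s (r i) \<zeta>)"
  proof (rule cauchy_L1_AE_cauchy_subseq[of arclength s])
    show "integrable arclength (s n)" for n using integral_norm_le_norm(1)[OF sq] .
    fix e :: real assume "e > 0"
    then obtain N where N: "norm (X i - X j) < e" if "i \<ge> N" "j \<ge> N" for i j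
      using \<open>Cauchy X\<close> by (metis CauchyD)
    have "(\<integral>\<zeta>. norm (s i \<zeta> - s j \<zeta>) \<partial>arclength) < e" if "i \<ge> N" "j \<ge> N" for i j
      using integral_norm_le_norm(2)[OF sqd[of i j]] N[OF that] nabs[of i j] by simp
    then show "\<exists>N. \<forall>i\<ge>N. \<forall>j\<ge>N. (\<integral>\<zeta>. norm (s i \<zeta> - s j \<zeta>) \<partial>arclength) < e" by blast
  qed auto
  define g where "g \<zeta> = lim (\<lambda>i. s (r i) \<zeta>)" for \<zeta>
  have g [measurable]: "g \<in> borel_measurable arclength" unfolding g_def by measurable
  have lim: "AE \<zeta> in arclength. (\<lambda>i. s (r i) \<zeta>) \<longlonglongrightarrow> g \<zeta>"
    using ae by eventually_elim (simp add: g_def Cauchy_convergent convergent_LIMSEQ_iff[symmetric])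
  have key: "\<exists>N. \<forall>n\<ge>N. (\<integral>\<^sup>+\<zeta>. ennreal ((cmod (s n \<zeta> - g \<zeta>))\<^sup>2) \<partial>arclength) \<le> ennreal (e\<^sup>2)" if "e > 0" for e
  proof -
    obtain N where N: "norm (X i - X j) < e" if "i \<ge> N" "j \<ge> N" for i j
      using \<open>Cauchy X\<close> \<open>e > 0\<close> by (metis CauchyD)
    have "(\<integral>\<^sup>+\<zeta>. ennreal ((cmod (s n \<zeta> - g \<zeta>))\<^sup>2) \<partial>arclength) \<le> ennreal (e\<^sup>2)" if n: "n \<ge> N" for n
    proof -
      have "AE \<zeta> in arclength. ennreal ((cmod (s n \<zeta> - g \<zeta>))\<^sup>2) =
          liminf (\<lambda>i. ennreal ((cmod (s n \<zeta> - s (r i) \<zeta>))\<^sup>2))"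
        using lim
      proof eventually_elim
        case (elim \<zeta>)
        have "(\<lambda>i. ennreal ((cmod (s n \<zeta> - s (r i) \<zeta>))\<^sup>2)) \<longlonglongrightarrow> ennreal ((cmod (s n \<zeta> - g \<zeta>))\<^sup>2)"
          by (intro tendsto_intros elim)
        then show ?case by (intro lim_imp_Liminf[symmetric]) auto
      qed
      then have "(\<integral>\<^sup>+\<zeta>. ennreal ((cmod (s n \<zeta> - g \<zeta>))\<^sup>2) \<partial>arclength) =
          (\<integral>\<^sup>+\<zeta>. liminf (\<lambda>i. ennreal ((cmod (s n \<zeta> - s (r i) \<zeta>))\<^sup>2)) \<partial>arclength)"
        by (rule nn_integral_cong_AE)
      also have "\<dots> \<le> liminf (\<lambda>i. \<integral>\<^sup>+\<zeta>. ennreal ((cmod (s n \<zeta> - s (r i) \<zeta>))\<^sup>2) \<partial>arclength)"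
        by (rule nn_integral_liminf) measurable
      also have "\<dots> = liminf (\<lambda>i. ennreal ((norm (X n - X (r i)))\<^sup>2))"
        unfolding norm_diff using sqd
        by (subst nn_integral_eq_integral) (auto simp: square_integrable_def)
      also have "\<dots> \<le> liminf (\<lambda>i. ennreal (e\<^sup>2))"
      proof (rule Liminf_mono)
        show "\<forall>\<^sub>F i in sequentially. ennreal ((norm (X n - X (r i)))\<^sup>2) \<le> ennreal (e\<^sup>2)"
          using eventually_ge_at_top[of N]
        proof eventually_elim
          case (elim i)
          then have "r i \<ge> N" using seq_suble[OF r, of i] by linarith
          then show ?case using N[OF n, of "r i"] by (intro ennreal_leI power_mono) auto
        qed
      qed
      finally show ?thesis by (simp add: Liminf_const)
    qed
    then show ?thesis by blast
  qed
  \<comment> \<open>A single index with finite distance to \<open>g\<close> suffices: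
    \<open>g\<close> then differs from a square integrable function by a square integrable
    one.\<close>
  obtain N1 where N1: "(\<integral>\<^sup>+\<zeta>. ennreal ((cmod (s N1 \<zeta> - g \<zeta>))\<^sup>2) \<partial>arclength) \<le> ennreal (1\<^sup>2)"
    using key[of 1] by auto
  have "integrable arclength (\<lambda>\<zeta>. (cmod (s N1 \<zeta> - g \<zeta>))\<^sup>2)"
    by (rule integrableI_bounded) (use N1 in \<open>auto simp: top_unique less_top[symmetric] elim: order_le_less_trans\<close>)
  then have "square_integrable (\<lambda>\<zeta>. s N1 \<zeta> - g \<zeta>)"
    by (simp add: square_integrable_def)
  then have sg: "square_integrable g"
    using square_integrable_add[OF sq[of N1] square_integrable_uminus[OF \<open>square_integrable (\<lambda>\<zeta>. s N1 \<zeta> - g \<zeta>)\<close>]] by simp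
  have "X \<longlonglongrightarrow> abs_circle_L2 g"
  proof (rule LIMSEQ_I)
    fix e :: real assume "e > 0"
    then obtain N where N: "(\<integral>\<^sup>+\<zeta>. ennreal ((cmod (s n \<zeta> - g \<zeta>))\<^sup>2) \<partial>arclength) \<le> ennreal ((e/2)\<^sup>2)" if "n \<ge> N" for n
      using key[of "e/2"] by auto
    have "norm (X n - abs_circle_L2 g) < e" if n: "n \<ge> N" for n
    proof -
      have sd: "square_integrable (\<lambda>\<zeta>. s n \<zeta> - g \<zeta>)"
        using square_integrable_add[OF sq[of n] square_integrable_uminus[OF sg]] by simp
      have "(norm (X n - abs_circle_L2 g))\<^sup>2 = (\<integral>\<zeta>. (cmod (s n \<zeta> - g \<zeta>))\<^sup>2 \<partial>arclength)"
        unfolding norm_sq_integral s_def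
      proof (rule integral_cong_AE)
        show "AE \<zeta> in arclength. (cmod (rep_circle_L2 (X n - abs_circle_L2 g) \<zeta>))\<^sup>2 = (cmod (rep_circle_L2 (X n) \<zeta> - g \<zeta>))\<^sup>2"
          using rep_minus[of "X n" "abs_circle_L2 g"] rep_abs_circle_L2[OF sg] by eventually_elim simp
      qed measurable
      moreover have "ennreal (\<integral>\<zeta>. (cmod (s n \<zeta> - g \<zeta>))\<^sup>2 \<partial>arclength) \<le> ennreal ((e/2)\<^sup>2)"
        using N[OF n] sd by (subst nn_integral_eq_integral[symmetric]) (auto simp: square_integrable_def)
      ultimately have "(norm (X n - abs_circle_L2 g))\<^sup>2 \<le> (e/2)\<^sup>2"
        by (simp add: ennreal_le_iff)
      then have "norm (X n - abs_circle_L2 g) \<le> e/2" by (rule power2_le_imp_le) (use \<open>e > 0\<close> in auto)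
      then show ?thesis using \<open>e > 0\<close> by simp
    qed
    then show "\<exists>no. \<forall>n\<ge>no. norm (X n - abs_circle_L2 g) < e" by blast
  qed
  then show ?thesis by (auto simp: convergent_def)
qed

text \<open>Closedness is sequential, which is the form that the limit arguments below
  produce.\<close>

definition closed_csubspace :: "circle_L2 set \<Rightarrow> bool"
  where "closed_csubspace K \<longleftrightarrow> 0 \<in> K \<and> (\<forall>f\<in>K. \<forall>g\<in>K. f + g \<in> K) \<and> (\<forall>c. \<forall>f\<in>K. cscale c f \<in> K) \<and>
    (\<forall>X f. (\<forall>n::nat. X n \<in> K) \<longrightarrow> X \<longlonglongrightarrow> f \<longrightarrow> f \<in> K)"

lemma closed_csubspaceD:
  assumes "closed_csubspace K"
  shows "0 \<in> K" "f \<in> K \<Longrightarrow> g \<in> K \<Longrightarrow> f + g \<in> K" "f \<in> K \<Longrightarrow> cscale c f \<in> K"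
    "f \<in> K \<Longrightarrow> g \<in> K \<Longrightarrow> f - g \<in> K" "(\<And>n::nat. X n \<in> K) \<Longrightarrow> X \<longlonglongrightarrow> f \<Longrightarrow> f \<in> K"
  using assms unfolding closed_csubspace_def minus_circle_L2_def uminus_eq_cscale by blast+

text \<open>The Hardy space, the model spaces and the domain of the shift are all presented as
  annihilators, or as intersections with one, so that their closedness is immediate.\<close>

lemma closed_csubspace_annihilator: "closed_csubspace {f. \<forall>w\<in>W. cinner f w = 0}"
  unfolding closed_csubspace_def
proof (intro conjI allI impI ballI, goal_cases)
  case (4 X f)
  have "cinner f w = 0" if "w \<in> W" for w
  proof -
    have "(\<lambda>n. cinner (X n) w) \<longlonglongrightarrow> cinner f w" using 4 by (intro tendsto_intros)
    moreover have "cinner (X n) w = 0" for n using 4 that by auto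
    ultimately show ?thesis by (simp add: LIMSEQ_const_iff)
  qed
  then show ?case by simp
qed (auto simp: cinner_simps)

lemma closed_csubspace_Int: "closed_csubspace K \<Longrightarrow> closed_csubspace L \<Longrightarrow> closed_csubspace (K \<inter> L)"
  unfolding closed_csubspace_def by blast

text \<open>The parallelogram law makes a minimizing sequence for the distance Cauchy. Its limit
  cannot be improved by moving along any \<open>k\<close> in \<open>K\<close>, which forces
  orthogonality.\<close>

lemma orthogonal_projection_exists:
  assumes K: "closed_csubspace K"
  shows "\<exists>p\<in>K. \<forall>k\<in>K. cinner (g - p) k = 0"
proof -
  define d where "d = (INF k\<in>K. (norm (g - k))\<^sup>2)"
  have bdd: "bdd_below ((\<lambda>k. (norm (g - k))\<^sup>2) ` K)" by (rule bdd_belowI[of _ 0]) auto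
  have dle: "d \<le> (norm (g - k))\<^sup>2" if "k \<in> K" for k
    unfolding d_def by (rule cINF_lower[OF bdd that])
  have "\<exists>k\<in>K. (norm (g - k))\<^sup>2 < d + 1 / Suc n" for n
  proof -
    have "(INF k\<in>K. (norm (g - k))\<^sup>2) < d + 1 / Suc n" by (simp add: d_def)
    then show ?thesis using closed_csubspaceD(1)[OF K] by (subst (asm) cINF_less_iff[OF _ bdd]) auto
  qed
  then obtain X where X: "X n \<in> K" "(norm (g - X n))\<^sup>2 < d + 1 / Suc n" for n by metis
  have diff: "(norm (X n - X m))\<^sup>2 \<le> 2 / Suc n + 2 / Suc m" for n m
  proof -
    \<comment> \<open>The midpoint lies in \<open>K\<close>, so its squared distance to
      \<open>g\<close> is at least \<open>d\<close>; the parallelogram law compares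
      \<open>X n - X m\<close> with it.\<close>
    define k where "k = cscale (1/2) (X n + X m)"
    have "k \<in> K" unfolding k_def by (intro closed_csubspaceD(2,3)[OF K] X)
    have "cscale 2 (g - k) = (g - X n) + (g - X m)"
    proof -
      have "cscale 2 g = g + g"
        using scaleR_circle_L2_def[of 2 g] by (simp add: scaleR_2)
      then show ?thesis by (simp add: k_def cscale_minus_right)
    qed
    then have "norm ((g - X n) + (g - X m)) = 2 * norm (g - k)"
      by (metis norm_cscale norm_numeral)
    then have "4 * (norm (g - k))\<^sup>2 = (norm ((g - X n) + (g - X m)))\<^sup>2"
      by (simp add: power_mult_distrib)
    moreover have "(norm ((g - X n) + (g - X m)))\<^sup>2 + (norm ((g - X n) - (g - X m)))\<^sup>2
        = 2 * (norm (g - X n))\<^sup>2 + 2 * (norm (g - X m))\<^sup>2"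
      by (simp add: power2_norm_eq_inner inner_simps)
    moreover have "norm ((g - X n) - (g - X m)) = norm (X n - X m)"
      by (simp add: norm_minus_commute)
    ultimately have "(norm (X n - X m))\<^sup>2 = 2 * (norm (g - X n))\<^sup>2 + 2 * (norm (g - X m))\<^sup>2 - 4 * (norm (g - k))\<^sup>2"
      by simp
    then show ?thesis using X(2)[of n] X(2)[of m] dle[OF \<open>k \<in> K\<close>] by simp
  qed
  have "Cauchy X"
  proof (rule CauchyI)
    fix e :: real assume "e > 0"
    then obtain N where N: "4 / e\<^sup>2 < real N" using reals_Archimedean2 by blast
    have "norm (X m - X n) < e" if "m \<ge> N" "n \<ge> N" for m n
    proof -
      have "4 / e\<^sup>2 < real (Suc N)" using N by simp
      then have *: "4 / real (Suc N) < e\<^sup>2" using \<open>e > 0\<close> by (simp add: field_simps)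
      have "2 / real (Suc m) \<le> 2 / real (Suc N)" "2 / real (Suc n) \<le> 2 / real (Suc N)"
        using that by (auto intro!: divide_left_mono)
      then have "(norm (X m - X n))\<^sup>2 < e\<^sup>2" using diff[of m n] * by simp
      then show ?thesis using \<open>e > 0\<close> by (auto intro: power2_less_imp_less)
    qed
    then show "\<exists>M. \<forall>m\<ge>M. \<forall>n\<ge>M. norm (X m - X n) < e" by blast
  qed
  then obtain p where p: "X \<longlonglongrightarrow> p" using circle_L2_Cauchy_convergent convergent_def by blast
  then have "p \<in> K" using closed_csubspaceD(5)[OF K] X(1) by blast
  have "(\<lambda>n. (norm (g - X n))\<^sup>2) \<longlonglongrightarrow> (norm (g - p))\<^sup>2" by (intro tendsto_intros p)
  moreover have "(\<lambda>n. d + 1 / Suc n) \<longlonglongrightarrow> d + 0"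
    by (intro tendsto_intros LIMSEQ_Suc[OF lim_inverse_n', unfolded inverse_eq_divide])
  ultimately have pd: "(norm (g - p))\<^sup>2 \<le> d"
    using X(2) by (intro LIMSEQ_le[of _ _ "\<lambda>n. d + 1 / Suc n"]) (auto intro!: exI[of _ 0] less_imp_le)
  have "cinner (g - p) k = 0" if k: "k \<in> K" for k
  proof (cases "k = 0")
    case False
    \<comment> \<open>The coefficient of the component along \<open>k\<close>: subtracting it lowers
      the squared distance by exactly the last fraction below.\<close>
    define c where "c = cinner (g - p) k / of_real ((norm k)\<^sup>2)"
    have "p + cscale c k \<in> K" by (intro closed_csubspaceD(2,3)[OF K] \<open>p \<in> K\<close> k)
    then have "(norm (g - p))\<^sup>2 \<le> (norm (g - p - cscale c k))\<^sup>2"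
      using order_trans[OF pd dle] by (simp add: diff_diff_eq)
    moreover have "complex_of_real ((norm (g - p - cscale c k))\<^sup>2) =
        of_real ((norm (g - p))\<^sup>2 - (cmod (cinner (g - p) k))\<^sup>2 / (norm k)\<^sup>2)"
    proof -
      have gen: "cinner (w - v) (w - v) = cinner w w - cinner w v - cinner v w + cinner v v" for w v
        by (simp add: cinner_simps)
      have "complex_of_real ((norm (g - p - cscale c k))\<^sup>2) =
          of_real ((norm (g - p))\<^sup>2) - cnj c * cinner (g - p) k - c * cnj (cinner (g - p) k) + c * cnj c * of_real ((norm k)\<^sup>2)"
        unfolding cinner_self_norm[symmetric] gen
        using cinner_commute[of k "g - p"] by (simp add: cinner_cscale_left cinner_cscale_right)
      moreover have "cnj c * cinner (g - p) k = of_real ((cmod (cinner (g - p) k))\<^sup>2 / (norm k)\<^sup>2)"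
        "c * cnj (cinner (g - p) k) = of_real ((cmod (cinner (g - p) k))\<^sup>2 / (norm k)\<^sup>2)"
        unfolding c_def by (simp_all add: mult.commute flip: complex_norm_square)
      moreover have "c * cnj c * of_real ((norm k)\<^sup>2) = of_real ((cmod (cinner (g - p) k))\<^sup>2 / (norm k)\<^sup>2)"
        unfolding c_def using False by (simp add: field_simps power2_eq_square flip: complex_norm_square)
      ultimately show ?thesis by simp
    qed
    ultimately have "(cmod (cinner (g - p) k))\<^sup>2 / (norm k)\<^sup>2 \<le> 0"
      unfolding of_real_eq_iff by simp
    then show ?thesis using False by (simp add: divide_le_0_iff)
  qed simp
  then show ?thesis using \<open>p \<in> K\<close> by blast
qed

lemma proj_unique:
  assumes "closed_csubspace K" "p \<in> K" "\<And>k. k \<in> K \<Longrightarrow> cinner (g - p) k = 0"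
  shows "proj K g = p"
  unfolding proj_def
proof (rule the_equality)
  fix q assume q: "q \<in> K \<and> (\<forall>k\<in>K. cinner (g - q) k = 0)"
  then have "p - q \<in> K" using assms closed_csubspaceD(4) by blast
  then have "cinner (g - p) (p - q) = 0" "cinner (g - q) (p - q) = 0" using q assms by auto
  then have "cinner (p - q) (p - q) = 0" by (simp add: cinner_minus_left)
  then show "q = p" by (simp add: cinner_self_eq_0)
qed (use assms in auto)

lemma proj_in:
  assumes "closed_csubspace K" shows "proj K g \<in> K" "k \<in> K \<Longrightarrow> cinner (g - proj K g) k = 0"
proof -
  obtain p where "p \<in> K" "\<And>k. k \<in> K \<Longrightarrow> cinner (g - p) k = 0"
    using orthogonal_projection_exists[OF assms] by blast
  moreover from this have "proj K g = p" by (rule proj_unique[OF assms])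
  ultimately show "proj K g \<in> K" "k \<in> K \<Longrightarrow> cinner (g - proj K g) k = 0" by auto
qed

lemma cinner_proj_left: "closed_csubspace K \<Longrightarrow> k \<in> K \<Longrightarrow> cinner (proj K g) k = cinner g k"
  using proj_in(2)[of K k g] by (simp add: cinner_minus_left)

text \<open>The residue of \<open>f\<close> after projection to \<open>S\<close> lies in
  \<open>K\<close> and is orthogonal to \<open>S\<close>. This is how totality of a set of vectors
  is turned into equality of closed subspaces.\<close>

lemma subspace_eqI:
  assumes "closed_csubspace S" "closed_csubspace K" "S \<subseteq> K"
    and "\<And>f. f \<in> K \<Longrightarrow> (\<And>s. s \<in> S \<Longrightarrow> cinner f s = 0) \<Longrightarrow> f = 0"
  shows "S = K"
proof -
  have "f \<in> S" if "f \<in> K" for f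
  proof -
    have "f - proj S f \<in> K"
      using closed_csubspaceD(4)[OF assms(2) that] proj_in(1)[OF assms(1)] assms(3) by blast
    then have "f - proj S f = 0"
      using assms(4) proj_in(2)[OF assms(1)] by blast
    then show ?thesis using proj_in(1)[OF assms(1), of f] by simp
  qed
  then show ?thesis using assms(3) by blast
qed

section \<open>Fourier series\<close>

lemma measurable_arclengthI: "f \<in> borel_measurable borel \<Longrightarrow> f \<in> borel_measurable arclength"
  by (simp cong: measurable_cong_sets add: measurable_restrict_space1)

lemma sets_arclength_borel: "A \<in> sets arclength \<Longrightarrow> A \<in> sets borel"
  by (simp add: sets_restrict_space_iff)

lemma sets_arclength_Int [measurable]: "A \<in> sets borel \<Longrightarrow> A \<inter> unit_circle \<in> sets arclength"
  by (simp add: sets_restrict_space_iff)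

lemma measurable_indicator_arclength: "A \<in> sets borel \<Longrightarrow> indicator A \<in> borel_measurable arclength"
  by (intro measurable_arclengthI borel_measurable_indicator)

lemma AE_arclength_circle: "AE \<zeta> in arclength. cmod \<zeta> = 1"
  by (rule AE_I2) simp

lemma AE_arclengthI: "(\<And>\<zeta>. cmod \<zeta> = 1 \<Longrightarrow> P \<zeta>) \<Longrightarrow> AE \<zeta> in arclength. P \<zeta>"
  by (rule AE_I2) simp

lemma cnj_circle: "cmod \<zeta> = 1 \<Longrightarrow> cnj \<zeta> = inverse \<zeta>"
  using complex_norm_square[of \<zeta>] by (metis inverse_unique of_real_1 one_power2)

lemma measurable_cis_uniform:
  "cis \<in> uniform_measure lborel {0..<2 * pi} \<rightarrow>\<^sub>M borel_circle"
proof (rule measurable_restrict_space2)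
  have "cis \<in> borel_measurable borel"
    by (intro borel_measurable_continuous_onI continuous_on_cis continuous_on_id)
  then show "cis \<in> borel_measurable (uniform_measure lborel {0..<2 * pi})"
    by (simp cong: measurable_cong_sets)
qed simp

lemma integral_arclength:
  fixes f :: "complex \<Rightarrow> complex"
  assumes f: "f \<in> borel_measurable borel"
  shows "(\<integral>\<zeta>. f \<zeta> \<partial>arclength) = (\<integral>t. indicator {0..2*pi} t *\<^sub>R f (cis t) \<partial>lborel) / (2 * pi)"
proof -
  have cis [measurable]: "cis \<in> borel_measurable borel"
    by (intro borel_measurable_continuous_onI continuous_on_cis continuous_on_id)
  note [measurable] = f
  have "f \<in> borel_measurable borel_circle" using f by (rule measurable_restrict_space1)
  then have "(\<integral>\<zeta>. f \<zeta> \<partial>arclength) = (\<integral>t. f (cis t) \<partial>uniform_measure lborel {0..<2*pi})"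
    unfolding arclength_def by (rule integral_distr[OF measurable_cis_uniform])
  also have "uniform_measure lborel {0..<2*pi} = density lborel (\<lambda>t. ennreal (indicator {0..<2*pi} t / (2*pi)))"
    unfolding uniform_measure_def
  proof (rule density_cong)
    show "AE x in lborel. (indicator {0..<2 * pi} x :: ennreal) / emeasure lborel {0..<2 * pi} =
        ennreal (indicator {0..<2 * pi} x / (2 * pi))"
      by (rule AE_I2) (auto simp: indicator_def divide_ennreal simp flip: ennreal_1)
  qed measurable
  also have "(\<integral>t. f (cis t) \<partial>density lborel (\<lambda>t. ennreal (indicator {0..<2*pi} t / (2*pi)))) =
      (\<integral>t. (indicator {0..<2*pi} t / (2*pi)) *\<^sub>R f (cis t) \<partial>lborel)"
    by (rule integral_density) (auto simp: indicator_def)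
  \<comment> \<open>Adding the endpoint \<open>2 * pi\<close> changes a null set only and gives the
    closed interval that the fundamental theorem of calculus asks for.\<close>
  also have "\<dots> = (\<integral>t. (indicator {0..2*pi} t *\<^sub>R f (cis t)) / (2 * pi) \<partial>lborel)"
  proof (rule integral_cong_AE)
    show "AE t in lborel. (indicator {0..<2*pi} t / (2*pi)) *\<^sub>R f (cis t) = (indicator {0..2*pi} t *\<^sub>R f (cis t)) / (2 * pi)"
      using AE_lborel_singleton[of "2*pi"]
      by eventually_elim (auto simp: indicator_def scaleR_conv_of_real)
  qed measurable
  also have "\<dots> = (\<integral>t. indicator {0..2*pi} t *\<^sub>R f (cis t) \<partial>lborel) / (2 * pi)"
    by simp
  finally show ?thesis .
qed

lemma measurable_powi [measurable]: "(\<lambda>\<zeta>::complex. \<zeta> powi n) \<in> borel_measurable borel"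
  unfolding power_int_def by measurable

lemma integral_powi: "(\<integral>\<zeta>. \<zeta> powi n \<partial>arclength) = (if n = 0 then 1 else 0)"
proof (cases "n = 0")
  case False
  have "(\<integral>\<zeta>. \<zeta> powi n \<partial>arclength) = (\<integral>t. indicator {0..2*pi} t *\<^sub>R (cis t powi n) \<partial>lborel) / (2 * pi)"
    by (rule integral_arclength) measurable
  also have "(\<integral>t. indicator {0..2*pi} t *\<^sub>R (cis t powi n) \<partial>lborel) =
      (\<lambda>t. cis (of_int n * t) / (\<i> * of_int n)) (2 * pi) - (\<lambda>t. cis (of_int n * t) / (\<i> * of_int n)) 0"
  proof (rule integral_FTC_Icc)
    fix t :: real
    have "((\<lambda>t. cis (of_int n * t) / (\<i> * of_int n)) has_vector_derivative
        (of_int n *\<^sub>R (\<i> * cis (of_int n * t))) / (\<i> * of_int n)) (at t within {0..2*pi})"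
      unfolding has_vector_derivative_def
      by (auto intro!: derivative_eq_intros simp: scaleR_conv_of_real algebra_simps)
    then show "((\<lambda>t. cis (of_int n * t) / (\<i> * of_int n)) has_vector_derivative cis t powi n) (at t within {0..2*pi})"
      using False by (simp add: cis_power_int scaleR_conv_of_real)
  qed (auto simp: cis_power_int intro!: continuous_intros)
  also have "\<dots> = 0"
    using cis_multiple_2pi[of "of_int n"] by (simp add: mult_ac)
  finally show ?thesis using False by simp
qed simp

lemma mult_cnj_self: "z * cnj z = of_real ((cmod z)\<^sup>2)" "cnj z * z = of_real ((cmod z)\<^sup>2)"
  using complex_norm_square[of z] by (simp_all add: mult.commute)

lemma power_int_mult_circle: "cmod \<zeta> = 1 \<Longrightarrow> \<zeta> powi a * \<zeta> powi b = \<zeta> powi (a + b)"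
  by (subst power_int_add) auto

abbreviation zpow :: "int \<Rightarrow> complex \<Rightarrow> complex" where "zpow n \<equiv> \<lambda>\<zeta>. \<zeta> powi n"

lemma unimodular_zpow [intro, simp]: "unimodular (zpow n)"
  unfolding unimodular_def by (auto intro!: measurable_arclengthI AE_arclengthI simp: norm_power_int)

lemma bounded_zpow [intro, simp]: "bounded_symbol (zpow n)"
  by (rule unimodular_bounded) simp

definition ee :: "int \<Rightarrow> circle_L2" where "ee n = abs_circle_L2 (zpow n)"

definition zshift :: "int \<Rightarrow> circle_L2 \<Rightarrow> circle_L2" where "zshift n f = mult_L2 (zpow n) f"

definition cf :: "circle_L2 \<Rightarrow> int \<Rightarrow> complex" where "cf f n = cinner f (ee n)"

lemma square_integrable_zpow [simp]: "square_integrable (zpow n)"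
  by (rule bounded_symbol_square_integrable) simp

lemma rep_ee: "AE \<zeta> in arclength. rep_circle_L2 (ee n) \<zeta> = \<zeta> powi n"
  unfolding ee_def by (rule rep_abs_circle_L2) simp

lemma cnj_zpow: "cmod \<zeta> = 1 \<Longrightarrow> cnj \<zeta> powi n = \<zeta> powi (-n)"
  using cnj_circle[of "\<zeta> powi n"] by (simp add: norm_power_int power_int_minus)

lemma zshift_ee [simp]: "zshift k (ee n) = ee (k + n)"
proof -
  have "zshift k (ee n) = abs_circle_L2 (\<lambda>\<zeta>. \<zeta> powi k * \<zeta> powi n)"
    unfolding zshift_def ee_def by (rule mult_L2_abs) auto
  also have "\<dots> = ee (k + n)"
    unfolding ee_def
    by (rule abs_circle_L2_eqI) (auto intro!: AE_arclengthI square_integrable_symbol_mult simp: power_int_mult_circle)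
  finally show ?thesis .
qed

lemma zshift_zshift [simp]: "zshift k (zshift j f) = zshift (k + j) f"
  unfolding zshift_def mult_L2_mult_L2[OF bounded_zpow bounded_zpow]
  by (rule mult_L2_cong) (auto intro!: AE_arclengthI bounded_symbol_mult simp: power_int_mult_circle)

lemma zshift_0 [simp]: "zshift 0 f = f"
  unfolding zshift_def by (simp add: mult_L2_const)

lemma mult_cnj_zpow: "mult_L2 (\<lambda>\<zeta>. cnj \<zeta> powi k) f = zshift (-k) f"
  unfolding zshift_def
  using bounded_symbol_cnj[of "zpow k"] by (intro mult_L2_cong) (auto intro!: AE_arclengthI simp: cnj_zpow)

lemma cinner_zshift_left: "cinner (zshift k f) g = cinner f (zshift (-k) g)"
  unfolding zshift_def[of k] using cinner_mult_L2_left[of "zpow k" f g] by (simp add: mult_cnj_zpow)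

lemma cinner_zshift_zshift [simp]: "cinner (zshift k f) (zshift k g) = cinner f g"
  by (simp add: cinner_zshift_left)

lemma norm_zshift [simp]: "norm (zshift k f) = norm f"
  unfolding zshift_def by (rule norm_mult_L2_unimodular) simp

lemma zshift_simps:
  "zshift k (f + g) = zshift k f + zshift k g" "zshift k (f - g) = zshift k f - zshift k g"
  "zshift k (cscale c f) = cscale c (zshift k f)" "zshift k 0 = 0"
  "zshift k (\<Sum>i\<in>I. F i) = (\<Sum>i\<in>I. zshift k (F i))"
  unfolding zshift_def by (simp_all add: mult_L2_add mult_L2_minus mult_L2_cscale mult_L2_sum)

lemma bounded_linear_zshift: "bounded_linear (zshift k)"
  unfolding zshift_def by (rule bounded_linear_mult_L2) simp

lemma zshift_mult_L2: "bounded_symbol b \<Longrightarrow> zshift k (mult_L2 b f) = mult_L2 b (zshift k f)"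
  unfolding zshift_def by (simp add: mult.commute)

lemma cf_zshift: "cf (zshift k f) n = cf f (n - k)"
  unfolding cf_def by (simp add: cinner_zshift_left)

lemma cf_simps: "cf (f + g) n = cf f n + cf g n" "cf (f - g) n = cf f n - cf g n"
  "cf (cscale c f) n = c * cf f n" "cf 0 n = 0" "cf (\<Sum>i\<in>I. F i) n = (\<Sum>i\<in>I. cf (F i) n)"
  unfolding cf_def by (simp_all add: cinner_simps)

lemma cinner_ee_0: "cinner (ee n) (ee 0) = (if n = 0 then 1 else 0)"
  unfolding ee_def by (subst cinner_eq_integral_abs) (simp_all add: integral_powi bounded_symbol_square_integrable)

lemma cinner_ee: "cinner (ee m) (ee n) = (if m = n then 1 else 0)"
proof -
  have "cinner (ee m) (ee n) = cinner (ee m) (zshift n (ee 0))" by simp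
  also have "\<dots> = cinner (zshift (-n) (ee m)) (ee 0)" unfolding cinner_zshift_left by simp
  finally show ?thesis by (simp add: cinner_ee_0)
qed

lemma cf_ee: "cf (ee m) n = (if m = n then 1 else 0)"
  unfolding cf_def by (rule cinner_ee)

lemma norm_ee [simp]: "norm (ee n) = 1"
proof (rule power2_eq_imp_eq)
  show "(norm (ee n))\<^sup>2 = 1\<^sup>2"
    using cinner_self_norm[of "ee n"] unfolding cinner_ee by (simp flip: of_real_power)
qed auto

lemma cmod_cf_le: "cmod (cf f n) \<le> norm f"
  unfolding cf_def using cmod_cinner_le[of f "ee n"] by simp

lemma tendsto_cf: "(X \<longlongrightarrow> f) F \<Longrightarrow> ((\<lambda>n. cf (X n) k) \<longlongrightarrow> cf f k) F"
  unfolding cf_def by (intro tendsto_intros)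

text \<open>Real polynomial functions are generated by constants and real-linear functionals, and on
  the circle a functional is a trigonometric polynomial with frequencies \<open>1\<close> and
  \<open>-1\<close>. Multiplication by it only shifts and combines Fourier coefficients, hence
  preserves the property that all of them vanish.\<close>

lemma cf_mult_polynomial_zero:
  assumes "real_polynomial_function p"
  shows "bounded_symbol (\<lambda>\<zeta>. of_real (p \<zeta>)) \<and>
    (\<forall>g. (\<forall>n. cf g n = 0) \<longrightarrow> (\<forall>n. cf (mult_L2 (\<lambda>\<zeta>. of_real (p \<zeta>)) g) n = 0))"
  using assms
proof (induction p)
  case (linear f)
  interpret bounded_linear f by fact
  \<comment> \<open>Chosen so that \<open>f \<zeta>\<close> is twice the real part of
    \<open>cnj a * \<zeta>\<close>.\<close>
  define a where "a = Complex (f 1) (f \<i>) / 2"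
  have f: "of_real (f \<zeta>) = cnj a * \<zeta> powi 1 + a * \<zeta> powi (-1)" if "cmod \<zeta> = 1" for \<zeta>
  proof -
    have "f \<zeta> = f (Re \<zeta> *\<^sub>R 1 + Im \<zeta> *\<^sub>R \<i>)"
      by (rule arg_cong[of _ _ f]) (simp add: complex_eq_iff)
    also have "\<dots> = Re \<zeta> * f 1 + Im \<zeta> * f \<i>" unfolding add scaleR by simp
    finally have "f \<zeta> = Re \<zeta> * f 1 + Im \<zeta> * f \<i>" .
    moreover have "\<zeta> powi (-1) = cnj \<zeta>" using that by (simp add: cnj_circle power_int_minus)
    ultimately show ?thesis unfolding \<open>\<zeta> powi (-1) = cnj \<zeta>\<close> by (simp add: complex_eq_iff a_def field_simps)
  qed
  have b: "bounded_symbol (\<lambda>\<zeta>. cnj a * \<zeta> powi 1 + a * \<zeta> powi (-1))"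
    by (intro bounded_symbol_add bounded_symbol_mult bounded_symbol_const bounded_zpow)
  have m: "f \<in> borel_measurable borel"
    by (intro borel_measurable_continuous_onI linear_continuous_on bounded_linear_axioms)
  have b': "bounded_symbol (\<lambda>\<zeta>. of_real (f \<zeta>))"
    unfolding bounded_symbol_def
  proof (intro conjI exI)
    show "(\<lambda>\<zeta>. complex_of_real (f \<zeta>)) \<in> borel_measurable arclength"
      using m by (intro measurable_arclengthI) measurable
    show "AE \<zeta> in arclength. cmod (complex_of_real (f \<zeta>)) \<le> onorm f"
      using onorm[OF bounded_linear_axioms] by (intro AE_arclengthI) (metis norm_of_real mult.right_neutral real_norm_def)
  qed
  have "mult_L2 (\<lambda>\<zeta>. of_real (f \<zeta>)) g = cscale (cnj a) (zshift 1 g) + cscale a (zshift (-1) g)" for g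
  proof -
    have "mult_L2 (\<lambda>\<zeta>. of_real (f \<zeta>)) g = mult_L2 (\<lambda>\<zeta>. cnj a * \<zeta> powi 1 + a * \<zeta> powi (-1)) g"
      by (rule mult_L2_cong[OF b' b]) (auto intro!: AE_arclengthI simp: f)
    also have "\<dots> = mult_L2 (\<lambda>\<zeta>. cnj a * \<zeta> powi 1) g + mult_L2 (\<lambda>\<zeta>. a * \<zeta> powi (-1)) g"
      by (rule mult_L2_add_symbol) (intro bounded_symbol_mult bounded_symbol_const bounded_zpow)+
    also have "\<dots> = mult_L2 (\<lambda>_. cnj a) (mult_L2 (zpow 1) g) + mult_L2 (\<lambda>_. a) (mult_L2 (zpow (-1)) g)"
      by (simp only: mult_L2_mult_L2[OF bounded_symbol_const bounded_zpow])
    finally show ?thesis by (simp add: mult_L2_const zshift_def del: mult_L2_mult_L2)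
  qed
  with b' show ?case by (simp add: cf_simps cf_zshift)
next
  case (const c)
  show ?case by (simp add: mult_L2_const cf_simps)
next
  case (add p q)
  then show ?case
    by (auto simp: mult_L2_add_symbol cf_simps)
next
  case (mult p q)
  have "mult_L2 (\<lambda>\<zeta>. of_real (p \<zeta> * q \<zeta>)) g = mult_L2 (\<lambda>\<zeta>. of_real (p \<zeta>)) (mult_L2 (\<lambda>\<zeta>. of_real (q \<zeta>)) g)" for g
    using mult.IH by simp
  with mult.IH show ?case by (simp del: mult_L2_mult_L2) auto
qed

text \<open>By Stone-Weierstrass \<phi> is a uniform limit of polynomials on the circle.
  Multiplication by these keeps every coefficient zero, and the integral is the coefficient of index
  \<open>0\<close> of the product.\<close>

lemma integral_mult_continuous_zero:
  assumes g: "\<And>n. cf g n = 0" and c: "continuous_on UNIV \<phi>"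
  shows "(\<integral>\<zeta>. of_real (\<phi> \<zeta>) * rep_circle_L2 g \<zeta> \<partial>arclength) = 0"
proof -
  define \<Phi> where "\<Phi> = (\<lambda>\<zeta>. complex_of_real (\<phi> \<zeta>))"
  have cs: "continuous_on unit_circle \<phi>" using c continuous_on_subset by blast
  have "\<phi> \<in> borel_measurable borel" using c by (rule borel_measurable_continuous_onI)
  then have m: "\<Phi> \<in> borel_measurable arclength" unfolding \<Phi>_def by (intro measurable_arclengthI) measurable
  obtain M where M: "\<And>\<zeta>. \<zeta> \<in> unit_circle \<Longrightarrow> norm (\<phi> \<zeta>) \<le> M"
    using compact_continuous_image[OF cs compact_sphere] compact_imp_bounded bounded_iff by (metis imageI)
  have b: "bounded_symbol \<Phi>"
    unfolding bounded_symbol_def using m M by (auto intro!: exI[of _ M] AE_arclengthI simp: \<Phi>_def)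
  have le: "cmod (cf (mult_L2 \<Phi> g) 0) \<le> e * norm g" if "e > 0" for e
  proof -
    obtain p where p: "real_polynomial_function p" "\<And>\<zeta>. \<zeta> \<in> unit_circle \<Longrightarrow> \<bar>\<phi> \<zeta> - p \<zeta>\<bar> < e"
      using Stone_Weierstrass_real_polynomial_function[OF compact_sphere cs \<open>e > 0\<close>] by metis
    define P where "P = (\<lambda>\<zeta>. complex_of_real (p \<zeta>))"
    have P: "bounded_symbol P" "cf (mult_L2 P g) 0 = 0"
      using cf_mult_polynomial_zero[OF p(1)] g by (auto simp: P_def)
    have "cf (mult_L2 \<Phi> g) 0 = cf (mult_L2 (\<lambda>\<zeta>. \<Phi> \<zeta> - P \<zeta>) g) 0"
      by (simp add: mult_L2_diff_symbol[OF b P(1)] cf_simps P)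
    also have "cmod \<dots> \<le> norm (mult_L2 (\<lambda>\<zeta>. \<Phi> \<zeta> - P \<zeta>) g)" by (rule cmod_cf_le)
    also have "\<dots> \<le> e * norm g"
    proof (rule norm_mult_L2_le)
      show "(\<lambda>\<zeta>. \<Phi> \<zeta> - P \<zeta>) \<in> borel_measurable arclength"
        using bounded_symbol_diff[OF b P(1)] by (simp add: bounded_symbol_def)
      show "AE \<zeta> in arclength. cmod (\<Phi> \<zeta> - P \<zeta>) \<le> e"
        using p(2) by (auto intro!: AE_arclengthI less_imp_le simp: \<Phi>_def P_def simp flip: of_real_diff)
    qed (use that in auto)
    finally show ?thesis .
  qed
  have "cmod (cf (mult_L2 \<Phi> g) 0) \<le> 0"
  proof (rule field_le_epsilon)
    fix e :: real assume "e > 0"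
    have "norm g / (norm g + 1) \<le> 1" by (simp add: divide_le_eq_1 add_nonneg_pos)
    then have "e / (norm g + 1) * norm g \<le> e"
      using \<open>e > 0\<close> mult_left_mono[of "norm g / (norm g + 1)" 1 e] by simp
    then show "cmod (cf (mult_L2 \<Phi> g) 0) \<le> 0 + e"
      using le[of "e / (norm g + 1)"] \<open>e > 0\<close> by (simp add: add_nonneg_pos)
  qed
  moreover have "cf (mult_L2 \<Phi> g) 0 = (\<integral>\<zeta>. \<Phi> \<zeta> * rep_circle_L2 g \<zeta> \<partial>arclength)"
    unfolding cf_def mult_L2_def ee_def
    using cinner_eq_integral_abs[OF square_integrable_symbol_mult[OF b square_integrable_rep[of g]] square_integrable_zpow[of 0]]
    by simp
  ultimately show ?thesis by (simp add: \<Phi>_def)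
qed

lemma integrable_rep: "integrable arclength (rep_circle_L2 g)"
  by (rule integral_norm_le_norm) simp

lemma integrable_mult_indicator_arclength:
  assumes "A \<in> sets borel"
  shows "integrable arclength (\<lambda>\<zeta>. indicator A \<zeta> *\<^sub>R rep_circle_L2 g \<zeta>)"
proof (rule Bochner_Integration.integrable_bound[OF integrable_rep[of g]])
  show "(\<lambda>\<zeta>. indicator A \<zeta> *\<^sub>R rep_circle_L2 g \<zeta>) \<in> borel_measurable arclength"
    by (intro borel_measurable_scaleR measurable_indicator_arclength assms measurable_rep)
qed (auto simp: indicator_def)

text \<open>Closed sets generate the Borel sets and are stable under intersection, so a Dynkin
  argument reduces the claim to closed sets, whose indicators are limits of continuous
  functions.\<close>

lemma set_integral_rep_zero:
  assumes g: "\<And>n. cf g n = 0" and A: "A \<in> sets borel"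
  shows "(\<integral>\<zeta>. indicator A \<zeta> *\<^sub>R rep_circle_L2 g \<zeta> \<partial>arclength) = 0"
proof -
  let ?I = "\<lambda>A. (\<integral>\<zeta>. indicator A \<zeta> *\<^sub>R rep_circle_L2 g \<zeta> \<partial>arclength)"
  note [measurable] = measurable_indicator_arclength
  note int = integrable_mult_indicator_arclength
  have *: "Int_stable (Collect closed :: complex set set)" by (auto simp: Int_stable_def)
  have "Collect closed \<subseteq> Pow (UNIV :: complex set)" "A \<in> sigma_sets UNIV (Collect closed)"
    using A unfolding borel_eq_closed by simp_all
  with * show ?thesis
  proof (induction rule: sigma_sets_induct_disjoint)
    case (basic A)
    show ?case
    \<comment> \<open>\<open>infdist\<close> to the empty set is zero by convention, so the
      functions below would tend to one instead of zero there.\<close>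
    proof (cases "A = {}")
      case False
      have cl: "closed A" using basic by simp
      \<comment> \<open>Equal to one on \<open>A\<close> and, for positive \<open>k\<close>, zero at
        distance \<open>1 / k\<close> or more.\<close>
      define \<phi> where "\<phi> k \<zeta> = max 0 (1 - real k * infdist \<zeta> A)" for k \<zeta>
      have cont: "continuous_on UNIV (\<phi> k)" for k
        unfolding \<phi>_def by (intro continuous_intros)
      have "(\<lambda>k. \<integral>\<zeta>. of_real (\<phi> k \<zeta>) * rep_circle_L2 g \<zeta> \<partial>arclength) \<longlonglongrightarrow> ?I A"
      proof (rule integral_dominated_convergence[where w = "\<lambda>\<zeta>. norm (rep_circle_L2 g \<zeta>)"])
        show "AE \<zeta> in arclength. (\<lambda>k. of_real (\<phi> k \<zeta>) * rep_circle_L2 g \<zeta>) \<longlonglongrightarrow> indicator A \<zeta> *\<^sub>R rep_circle_L2 g \<zeta>"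
        proof (rule AE_I2)
          fix \<zeta>
          have "(\<lambda>k. \<phi> k \<zeta>) \<longlonglongrightarrow> indicator A \<zeta>"
          proof (cases "\<zeta> \<in> A")
            case True
            then show ?thesis by (simp add: \<phi>_def)
          next
            case 2: False
            then have pos: "infdist \<zeta> A > 0"
              using cl False infdist_pos_not_in_closed by blast
            obtain N where "1 / infdist \<zeta> A < real N" using reals_Archimedean2 by blast
            then have N: "1 < real N * infdist \<zeta> A" using pos by (simp add: field_simps)
            have "\<phi> k \<zeta> = 0" if "k \<ge> N" for k
            proof -
              have "real N * infdist \<zeta> A \<le> real k * infdist \<zeta> A" using that pos by (intro mult_right_mono) auto
              then show ?thesis using N by (simp add: \<phi>_def)
            qed
            then have "\<forall>\<^sub>F k in sequentially. \<phi> k \<zeta> = 0" using eventually_sequentially by blast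
            then show ?thesis using 2 by (simp add: tendsto_eventually)
          qed
          then show "(\<lambda>k. of_real (\<phi> k \<zeta>) * rep_circle_L2 g \<zeta>) \<longlonglongrightarrow> indicator A \<zeta> *\<^sub>R rep_circle_L2 g \<zeta>"
            unfolding scaleR_conv_of_real by (intro tendsto_intros)
        qed
        have "\<bar>\<phi> k \<zeta>\<bar> \<le> 1" for k \<zeta> by (simp add: \<phi>_def infdist_nonneg)
        then show "AE \<zeta> in arclength. norm (of_real (\<phi> k \<zeta>) * rep_circle_L2 g \<zeta>) \<le> norm (rep_circle_L2 g \<zeta>)" for k
          by (intro AE_I2) (simp add: norm_mult mult_left_le_one_le)
        show "(\<lambda>\<zeta>. of_real (\<phi> k \<zeta>) * rep_circle_L2 g \<zeta>) \<in> borel_measurable arclength" for k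
          by (intro borel_measurable_times measurable_rep measurable_arclengthI
              borel_measurable_continuous_onI[OF continuous_on_of_real[OF cont]])
        show "(\<lambda>\<zeta>. indicator A \<zeta> *\<^sub>R rep_circle_L2 g \<zeta>) \<in> borel_measurable arclength"
          using int[of A] cl by auto
      qed (use integrable_rep in auto)
      then show ?thesis unfolding integral_mult_continuous_zero[OF g cont] by (simp add: LIMSEQ_const_iff)
    qed simp
  next
    case (compl A)
    then have Ab: "A \<in> sets borel" unfolding borel_eq_closed by simp
    have "?I (UNIV - A) = (\<integral>\<zeta>. rep_circle_L2 g \<zeta> - indicator A \<zeta> *\<^sub>R rep_circle_L2 g \<zeta> \<partial>arclength)"
      by (intro Bochner_Integration.integral_cong) (auto simp: indicator_def)
    also have "\<dots> = (\<integral>\<zeta>. rep_circle_L2 g \<zeta> \<partial>arclength)"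
      using compl by (subst Bochner_Integration.integral_diff[OF integrable_rep int[OF Ab]]) simp
    also have "\<dots> = 0"
      using integral_mult_continuous_zero[OF g, of "\<lambda>_. 1"] by simp
    finally show ?case .
  next
    case (union A)
    then have Ab: "A i \<in> sets borel" for i unfolding borel_eq_closed by auto
    have "(\<lambda>n. \<integral>\<zeta>. (\<Sum>i<n. indicator (A i) \<zeta> *\<^sub>R rep_circle_L2 g \<zeta>) \<partial>arclength) \<longlonglongrightarrow> ?I (\<Union>i. A i)"
    proof (rule integral_dominated_convergence[where w = "\<lambda>\<zeta>. norm (rep_circle_L2 g \<zeta>)"])
      have ind: "(\<Sum>i<n. indicator (A i) \<zeta>) = (indicator (\<Union>i<n. A i) \<zeta> :: real)" for n \<zeta>
        using union(1) by (subst indicator_UN_disjoint) (auto intro: disjoint_family_on_mono)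
      show "AE \<zeta> in arclength. norm (\<Sum>i<n. indicator (A i) \<zeta> *\<^sub>R rep_circle_L2 g \<zeta>) \<le> norm (rep_circle_L2 g \<zeta>)" for n
        unfolding scaleR_left.sum[symmetric] ind by (auto simp: indicator_def)
      show "AE \<zeta> in arclength. (\<lambda>n. \<Sum>i<n. indicator (A i) \<zeta> *\<^sub>R rep_circle_L2 g \<zeta>) \<longlonglongrightarrow> indicator (\<Union>i. A i) \<zeta> *\<^sub>R rep_circle_L2 g \<zeta>"
        unfolding scaleR_left.sum[symmetric] ind
        by (intro AE_I2 tendsto_intros LIMSEQ_indicator_UN)
      show "(\<lambda>\<zeta>. indicator (\<Union>i. A i) \<zeta> *\<^sub>R rep_circle_L2 g \<zeta>) \<in> borel_measurable arclength"
        using Ab by (intro borel_measurable_integrable int sets.countable_UN) auto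
      show "(\<lambda>\<zeta>. \<Sum>i<n. indicator (A i) \<zeta> *\<^sub>R rep_circle_L2 g \<zeta>) \<in> borel_measurable arclength" for n
        by (intro borel_measurable_sum borel_measurable_integrable int Ab)
      show "integrable arclength (\<lambda>\<zeta>. norm (rep_circle_L2 g \<zeta>))"
        by (rule integrable_norm[OF integrable_rep])
    qed
    moreover have "(\<integral>\<zeta>. (\<Sum>i<n. indicator (A i) \<zeta> *\<^sub>R rep_circle_L2 g \<zeta>) \<partial>arclength) = 0" for n
      using union(3) by (subst Bochner_Integration.integral_sum) (auto intro: int Ab)
    ultimately show ?case by (simp add: LIMSEQ_const_iff)
  qed auto
qed

text \<open>On the set where the real part is positive the integral vanishes while the integrand is
  positive, so the set is null.\<close>

lemma AE_Re_rep_le_0: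
  assumes g: "\<And>n. cf g n = 0" shows "AE \<zeta> in arclength. Re (rep_circle_L2 g \<zeta>) \<le> 0"
proof -
  define A where "A = {\<zeta> \<in> space arclength. Re (rep_circle_L2 g \<zeta>) > 0}"
  have "A \<in> sets arclength" unfolding A_def by measurable
  then have A: "A \<in> sets borel" by (rule sets_arclength_borel)
  note [measurable] = measurable_indicator_arclength[OF A]
  have i: "integrable arclength (\<lambda>\<zeta>. indicator A \<zeta> *\<^sub>R rep_circle_L2 g \<zeta>)"
    by (rule integrable_mult_indicator_arclength[OF A])
  have "(\<integral>\<zeta>. Re (indicator A \<zeta> *\<^sub>R rep_circle_L2 g \<zeta>) \<partial>arclength) = 0"
    using set_integral_rep_zero[OF g A] integral_Re[OF i] by simp
  moreover have "AE \<zeta> in arclength. 0 \<le> Re (indicator A \<zeta> *\<^sub>R rep_circle_L2 g \<zeta>)"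
    by (rule AE_I2) (auto simp: A_def indicator_def)
  ultimately have "AE \<zeta> in arclength. Re (indicator A \<zeta> *\<^sub>R rep_circle_L2 g \<zeta>) = 0"
    using integral_nonneg_eq_0_iff_AE[OF integrable_Re[OF i]] by blast
  then show ?thesis
    using AE_space by eventually_elim (auto simp: A_def indicator_def split: if_splits)
qed

lemma cf_eq_0_imp_eq_0:
  assumes g: "\<And>n. cf g n = 0" shows "g = 0"
proof -
  have "AE \<zeta> in arclength. Re (c * rep_circle_L2 g \<zeta>) \<le> 0" for c
    using AE_Re_rep_le_0[of "cscale c g"] rep_cscale[of c g] g
    by (auto simp: cf_simps elim: eventually_elim2)
  \<comment> \<open>The four rotations bound the real and the imaginary part from both
    sides.\<close>
  from this[of 1] this[of "-1"] this[of "\<i>"] this[of "-\<i>"]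
  have "AE \<zeta> in arclength. rep_circle_L2 g \<zeta> = 0"
    by eventually_elim (simp add: complex_eq_iff)
  then show ?thesis unfolding circle_L2_eq_iff using rep_zero by eventually_elim simp
qed

lemma cf_eqI: "(\<And>n. cf f n = cf g n) \<Longrightarrow> f = g"
  using cf_eq_0_imp_eq_0[of "f - g"] by (simp add: cf_simps)

section \<open>Bessel, Riesz-Fischer, and series with nonnegative frequencies\<close>

definition taylor_sum :: "(nat \<Rightarrow> complex) \<Rightarrow> nat \<Rightarrow> circle_L2"
  where "taylor_sum a N = (\<Sum>n<N. cscale (a n) (ee (int n)))"

lemma norm_sq_sum_ee:
  assumes "finite I"
  shows "(norm (\<Sum>n\<in>I. cscale (a n) (ee (int n))))\<^sup>2 = (\<Sum>n\<in>I. (cmod (a n))\<^sup>2)"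
proof -
  have "complex_of_real ((norm (\<Sum>n\<in>I. cscale (a n) (ee (int n))))\<^sup>2) = of_real (\<Sum>n\<in>I. (cmod (a n))\<^sup>2)"
    unfolding cinner_self_norm[symmetric] using assms
    by (simp add: cinner_simps cinner_ee if_distrib mult_cnj_self cong: if_cong)
  then show ?thesis unfolding of_real_eq_iff .
qed

lemma cf_taylor_sum: "cf (taylor_sum a N) n = (if 0 \<le> n \<and> n < int N then a (nat n) else 0)"
proof (cases "0 \<le> n")
  case True
  then obtain k where k: "n = int k" using nonneg_int_cases by blast
  show ?thesis unfolding k taylor_sum_def by (simp add: cf_simps cf_ee if_distrib cong: if_cong)
next
  case False
  then have "int m \<noteq> n" for m by auto
  with False show ?thesis unfolding taylor_sum_def by (simp add: cf_simps cf_ee)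
qed

lemma bessel_taylor: "(\<Sum>n<N. (cmod (cf f (int n)))\<^sup>2) \<le> (norm f)\<^sup>2"
proof -
  define s where "s = taylor_sum (\<lambda>n. cf f (int n)) N"
  have "cinner f s = of_real (\<Sum>n<N. (cmod (cf f (int n)))\<^sup>2)"
    unfolding s_def taylor_sum_def by (simp add: cinner_simps mult_cnj_self flip: cf_def)
  moreover have "(norm s)\<^sup>2 = (\<Sum>n<N. (cmod (cf f (int n)))\<^sup>2)"
    unfolding s_def taylor_sum_def by (rule norm_sq_sum_ee) simp
  ultimately have "cinner f s = of_real ((norm s)\<^sup>2)" by metis
  then have "cmod (cinner f s) = (norm s)\<^sup>2" by (metis norm_of_real abs_power2)
  then have "norm s * norm s \<le> norm f * norm s"
    using cmod_cinner_le[of f s] by (simp add: power2_eq_square)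
  then have "norm s \<le> norm f" by (cases "s = 0") auto
  then have "(norm s)\<^sup>2 \<le> (norm f)\<^sup>2" by (simp add: power_mono)
  then show ?thesis using \<open>(norm s)\<^sup>2 = _\<close> by simp
qed

lemma riesz_fischer:
  assumes "summable (\<lambda>n. (cmod (a n))\<^sup>2)"
  obtains g where "taylor_sum a \<longlonglongrightarrow> g" "\<And>n. cf g (int n) = a n" "\<And>n. n < 0 \<Longrightarrow> cf g n = 0"
proof -
  have "Cauchy (taylor_sum a)"
    unfolding Cauchy_altdef2
  proof (intro allI impI)
    fix e :: real assume "e > 0"
    then obtain N where N: "\<And>m n. m \<ge> N \<Longrightarrow> norm (\<Sum>k=m..<n. (cmod (a k))\<^sup>2) < e\<^sup>2"
      using assms unfolding summable_Cauchy by (metis zero_less_power)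
    have "dist (taylor_sum a n) (taylor_sum a N) < e" if "n \<ge> N" for n
    proof -
      have "taylor_sum a n - taylor_sum a N = (\<Sum>k=N..<n. cscale (a k) (ee (int k)))"
        unfolding taylor_sum_def lessThan_atLeast0
        using sum.atLeastLessThan_concat[of 0 N n "\<lambda>k. cscale (a k) (ee (int k))"] that
        by (simp add: algebra_simps)
      then have "(norm (taylor_sum a n - taylor_sum a N))\<^sup>2 = (\<Sum>k=N..<n. (cmod (a k))\<^sup>2)"
        by (simp add: norm_sq_sum_ee)
      also have "\<dots> < e\<^sup>2" using N[of N n] by simp
      finally show ?thesis using \<open>e > 0\<close> by (auto simp: dist_norm intro: power2_less_imp_less)
    qed
    then show "\<exists>N. \<forall>n\<ge>N. dist (taylor_sum a n) (taylor_sum a N) < e" by blast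
  qed
  then obtain g where g: "taylor_sum a \<longlonglongrightarrow> g" using circle_L2_Cauchy_convergent convergent_def by blast
  have "cf g k = (if 0 \<le> k then a (nat k) else 0)" for k
  proof -
    have "(\<lambda>N. cf (taylor_sum a N) k) \<longlonglongrightarrow> cf g k" using g by (rule tendsto_cf)
    moreover have "\<forall>\<^sub>F N in sequentially. cf (taylor_sum a N) k = (if 0 \<le> k then a (nat k) else 0)"
      using eventually_gt_at_top[of "nat k"] by eventually_elim (auto simp: cf_taylor_sum)
    ultimately show ?thesis by (rule LIMSEQ_unique[OF _ tendsto_eventually])
  qed
  then show thesis using that[OF g] by simp
qed

text \<open>Bessel's inequality makes the coefficients square summable; the limit that Riesz-Fischer
  provides has the coefficients of \<open>f\<close>, and coefficients determine an element of
  L^2.\<close>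

lemma taylor_sum_tendsto:
  assumes "\<And>n. n < 0 \<Longrightarrow> cf f n = 0"
  shows "taylor_sum (\<lambda>n. cf f (int n)) \<longlonglongrightarrow> f"
proof -
  have "summable (\<lambda>n. (cmod (cf f (int n)))\<^sup>2)"
    by (rule summableI_nonneg_bounded[of _ "(norm f)\<^sup>2"]) (auto simp: bessel_taylor)
  then obtain g where g: "taylor_sum (\<lambda>n. cf f (int n)) \<longlonglongrightarrow> g" "\<And>n. cf g (int n) = cf f (int n)" "\<And>n. n < 0 \<Longrightarrow> cf g n = 0"
    using riesz_fischer by metis
  have "f = g"
  proof (rule cf_eqI)
    fix n show "cf f n = cf g n"
      using g(2)[of "nat n"] g(3)[of n] assms[of n] by (cases "n < 0") auto
  qed
  then show ?thesis using g(1) by simp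
qed

lemma cinner_eq_0_analytic:
  assumes "\<And>n. n < 0 \<Longrightarrow> cf h n = 0" "\<And>n. 0 \<le> n \<Longrightarrow> cf f n = 0"
  shows "cinner f h = 0"
proof -
  have "(\<lambda>N. cinner f (taylor_sum (\<lambda>n. cf h (int n)) N)) \<longlonglongrightarrow> cinner f h"
    by (intro tendsto_intros taylor_sum_tendsto assms)
  moreover have "cinner f (taylor_sum (\<lambda>n. cf h (int n)) N) = 0" for N
    unfolding taylor_sum_def using assms(2) by (simp add: cinner_simps flip: cf_def)
  ultimately show ?thesis by (simp add: LIMSEQ_const_iff)
qed

section \<open>Radial limits of analytic Fourier series\<close>

text \<open>The slope \<open>1 / 3\<close> is not optimal but comes directly from the cubic Taylor
  remainder: as \<open>pi / 2 < 2\<close>, the remainder is at most two thirds of the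
  argument.\<close>

lemma abs_sin_ge:
  assumes "\<bar>x\<bar> \<le> pi / 2" shows "\<bar>x\<bar> / 3 \<le> \<bar>sin x\<bar>"
proof -
  have "\<bar>sin x - (\<Sum>m<3. sin_coeff m * x ^ m)\<bar> \<le> inverse (fact 3) * \<bar>x\<bar> ^ 3"
    by (rule Maclaurin_sin_bound)
  then have *: "\<bar>sin x - x\<bar> \<le> \<bar>x\<bar> ^ 3 / 6"
    by (simp add: eval_nat_numeral sin_coeff_def)
  have "\<bar>x\<bar> \<le> 2" using assms pi_less_4 by simp
  then have "\<bar>x\<bar> ^ 2 \<le> 2 ^ 2" by (rule power_mono) simp
  then have "\<bar>x\<bar> ^ 2 * \<bar>x\<bar> \<le> 4 * \<bar>x\<bar>" by (intro mult_right_mono) auto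
  then have "\<bar>x\<bar> ^ 3 \<le> 4 * \<bar>x\<bar>" by (simp add: eval_nat_numeral)
  with * show ?thesis by linarith
qed

lemma cmod_cis_diff: "cmod (cis s - cis t) = 2 * \<bar>sin ((s - t) / 2)\<bar>"
proof -
  have "(cmod (cis s - cis t))\<^sup>2 = (cos s - cos t)\<^sup>2 + (sin s - sin t)\<^sup>2"
    by (simp add: cmod_power2)
  also have "\<dots> = (sin s ^ 2 + cos s ^ 2) + (sin t ^ 2 + cos t ^ 2) - 2 * (cos s * cos t + sin s * sin t)"
    by (simp add: power2_diff algebra_simps)
  also have "\<dots> = 2 - 2 * cos (s - t)"
    by (simp add: cos_diff)
  also have "\<dots> = (2 * \<bar>sin ((s - t) / 2)\<bar>)\<^sup>2"
  proof -
    have "2 * ((s - t) / 2) = s - t" by simp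
    then have "cos (s - t) = 1 - 2 * (sin ((s - t) / 2))\<^sup>2"
      using cos_double_sin[of "(s - t) / 2"] by (simp only:)
    then show ?thesis by (simp add: power_mult_distrib)
  qed
  finally show ?thesis by (rule power2_eq_imp_eq) auto
qed

text \<open>A chord of length \<rho> subtends an angle of at most \<open>3 * \<rho>\<close>. Angles
  are determined modulo \<open>2 * pi\<close> only, so three intervals of length
  \<open>6 * \<rho>\<close> are needed to catch the arc in the fundamental interval, and
  \<open>18 / (2 * pi) \<le> 3\<close>.\<close>

lemma measure_arc_le:
  assumes "cmod \<zeta> = 1" "0 \<le> \<rho>"
  shows "emeasure arclength (cball \<zeta> \<rho> \<inter> unit_circle) \<le> ennreal (3 * \<rho>)"
proof -
  define a where "a = Arg2pi \<zeta>"
  have a: "\<zeta> = cis a" "0 \<le> a" "a < 2 * pi"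
    using Arg2pi_eq[of \<zeta>] Arg2pi_ge_0[of \<zeta>] Arg2pi_lt_2pi[of \<zeta>] assms(1)
    by (auto simp: a_def cis_conv_exp)
  define I where "I b = {b - 3 * \<rho> .. b + 3 * \<rho>}" for b :: real
  define V where "V = I a \<union> I (a - 2 * pi) \<union> I (a + 2 * pi)"
  have sub: "{0..<2*pi} \<inter> (cis -` (cball \<zeta> \<rho> \<inter> unit_circle) \<inter> UNIV) \<subseteq> V"
  proof
    fix t assume t: "t \<in> {0..<2*pi} \<inter> (cis -` (cball \<zeta> \<rho> \<inter> unit_circle) \<inter> UNIV)"
    then have d: "cmod (cis t - cis a) \<le> \<rho>" by (simp add: a dist_norm norm_minus_commute)
    have key: "t \<in> I b" if "\<bar>t - b\<bar> \<le> pi" "cis b = cis a" for b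
    proof -
      have "\<bar>(t - b) / 2\<bar> / 3 \<le> \<bar>sin ((t - b) / 2)\<bar>" using that by (intro abs_sin_ge) simp
      also have "2 * \<bar>sin ((t - b) / 2)\<bar> \<le> \<rho>" using d cmod_cis_diff[of t b] that by simp
      finally show ?thesis by (simp add: I_def abs_le_iff)
    qed
    consider "\<bar>t - a\<bar> \<le> pi" | "t - a > pi" | "t - a < - pi" by linarith
    then show "t \<in> V"
    proof cases
      case 1 then show ?thesis using key[of a] by (simp add: V_def)
    next
      case 2
      then have "t \<in> I (a + 2 * pi)" using t a by (intro key) (auto simp flip: cis_mult)
      then show ?thesis by (simp add: V_def)
    next
      case 3
      then have "t \<in> I (a - 2 * pi)" using t a by (intro key) (auto simp flip: cis_divide)
      then show ?thesis by (simp add: V_def)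
    qed
  qed
  have A: "cball \<zeta> \<rho> \<inter> unit_circle \<in> sets borel_circle" using sets_arclength_Int[of "cball \<zeta> \<rho>"] by simp
  have cisb: "cis \<in> borel_measurable borel"
    by (intro borel_measurable_continuous_onI continuous_on_cis continuous_on_id)
  have B: "cis -` (cball \<zeta> \<rho> \<inter> unit_circle) \<in> sets borel"
    using measurable_sets[OF cisb, of "cball \<zeta> \<rho> \<inter> unit_circle"] by simp
  have "emeasure arclength (cball \<zeta> \<rho> \<inter> unit_circle) =
      emeasure lborel ({0..<2*pi} \<inter> (cis -` (cball \<zeta> \<rho> \<inter> unit_circle) \<inter> UNIV)) / ennreal (2 * pi)"
    unfolding arclength_def by (subst emeasure_distr[OF measurable_cis_uniform A]) (use B in simp)
  also have "\<dots> \<le> ennreal (18 * \<rho>) / ennreal (2 * pi)"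
  proof (rule divide_right_mono_ennreal)
    have "emeasure lborel ({0..<2*pi} \<inter> (cis -` (cball \<zeta> \<rho> \<inter> unit_circle) \<inter> UNIV)) \<le> emeasure lborel V"
      using sub by (rule emeasure_mono) (simp add: V_def I_def)
    also have "\<dots> \<le> emeasure lborel (I a \<union> I (a - 2 * pi)) + emeasure lborel (I (a + 2 * pi))"
      unfolding V_def by (rule emeasure_subadditive) (auto simp: I_def)
    also have "\<dots> \<le> (emeasure lborel (I a) + emeasure lborel (I (a - 2 * pi))) + emeasure lborel (I (a + 2 * pi))"
      by (rule add_right_mono, rule emeasure_subadditive) (auto simp: I_def)
    also have "\<dots> = ennreal (18 * \<rho>)"
      using assms(2) by (simp add: I_def flip: ennreal_plus)
    finally show "emeasure lborel ({0..<2*pi} \<inter> (cis -` (cball \<zeta> \<rho> \<inter> unit_circle) \<inter> UNIV)) \<le> ennreal (18 * \<rho>)" .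
  qed
  also have "\<dots> = ennreal (18 * \<rho> / (2 * pi))"
    using assms(2) by (simp add: divide_ennreal)
  also have "\<dots> \<le> ennreal (3 * \<rho>)"
  proof (rule ennreal_leI)
    have "18 * \<rho> \<le> 3 * \<rho> * (2 * pi)"
      using assms(2) pi_gt3 mult_left_mono[of 3 pi "6 * \<rho>"] by simp
    then show "18 * \<rho> / (2 * pi) \<le> 3 * \<rho>" by (simp add: divide_le_eq)
  qed
  finally show ?thesis .
qed

text \<open>Vitali selects disjoint balls whose fivefold enlargements cover \<open>E\<close>. An
  enlarged ball meets the circle in arclength at most \<open>3 * (5 * \<rho>)\<close>, whence the
  factor 15. Nothing makes \<open>E\<close> measurable, so the bound is stated for a measurable
  superset.\<close>

lemma maximal_weak_type:
  fixes H :: "complex \<Rightarrow> ennreal"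
  assumes H [measurable]: "H \<in> borel_measurable arclength" and "0 < \<alpha>"
    and E: "\<And>\<zeta>. \<zeta> \<in> E \<Longrightarrow> cmod \<zeta> = 1 \<and>
      (\<exists>\<rho>. 0 < \<rho> \<and> \<rho> \<le> B \<and> ennreal (\<alpha> * \<rho>) < (\<integral>\<^sup>+\<eta>. H \<eta> * indicator (cball \<zeta> \<rho>) \<eta> \<partial>arclength))"
  shows "\<exists>U\<in>sets arclength. E \<subseteq> U \<and> emeasure arclength U \<le> ennreal (15 / \<alpha>) * (\<integral>\<^sup>+\<eta>. H \<eta> \<partial>arclength)"
proof -
  obtain R where R: "\<And>\<zeta>. \<zeta> \<in> E \<Longrightarrow> 0 < R \<zeta> \<and> R \<zeta> \<le> B \<and>
      ennreal (\<alpha> * R \<zeta>) < (\<integral>\<^sup>+\<eta>. H \<eta> * indicator (cball \<zeta> (R \<zeta>)) \<eta> \<partial>arclength)"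
    using E by metis
  have cov: "E \<subseteq> (\<Union>\<zeta>\<in>E. cball \<zeta> (R \<zeta>))" using R by force
  obtain C where C: "countable C" "C \<subseteq> E"
      "pairwise (\<lambda>i j. disjnt (cball i (R i)) (cball j (R j))) C" "E \<subseteq> (\<Union>i\<in>C. cball i (5 * R i))"
  proof (rule Vitali_covering_lemma_cballs[OF cov])
    fix \<zeta> assume "\<zeta> \<in> E"
    then show "0 < R \<zeta> \<and> R \<zeta> \<le> B" using R by blast
  qed (rule that)
  \<comment> \<open>The countable family is indexed by all natural numbers, with the empty set
    outside the range, to fit countable additivity.\<close>
  define D where "D = to_nat_on C ` C"
  define X where "X n = (if n \<in> D then cball (from_nat_into C n) (R (from_nat_into C n)) \<inter> unit_circle else {})" for n
  define Y where "Y n = (if n \<in> D then cball (from_nat_into C n) (5 * R (from_nat_into C n)) \<inter> unit_circle else {})" for n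
  \<comment> \<open>With \<open>H\<close> absorbed into a measure, the integrals over the disjoint
    balls add up to at most the total integral.\<close>
  define M where "M = density arclength H"
  have inC: "from_nat_into C n \<in> C" if "n \<in> D" for n
    using that C(1) by (auto simp: D_def)
  have X [measurable]: "X n \<in> sets arclength" and Y [measurable]: "Y n \<in> sets arclength" for n
    using sets_arclength_Int by (auto simp: X_def Y_def simp del: sets_arclength)
  have disj: "disjoint_family X"
    unfolding disjoint_family_on_def
  proof (intro ballI impI)
    fix m n :: nat assume "m \<noteq> n"
    show "X m \<inter> X n = {}"
    proof (cases "m \<in> D \<and> n \<in> D")
      case True
      then have "from_nat_into C m \<noteq> from_nat_into C n"
        using \<open>m \<noteq> n\<close> C(1) by (auto simp: D_def)
      then show ?thesis using C(3) True inC by (auto simp: pairwise_def disjnt_def X_def)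
    qed (auto simp: X_def)
  qed
  have le: "emeasure arclength (Y n) \<le> ennreal (15 / \<alpha>) * emeasure M (X n)" for n
  proof (cases "n \<in> D")
    case True
    define \<zeta> where "\<zeta> = from_nat_into C n"
    have \<zeta>: "\<zeta> \<in> E" using inC[OF True] C(2) by (auto simp: \<zeta>_def)
    have "emeasure arclength (Y n) \<le> ennreal (3 * (5 * R \<zeta>))"
      using True R[OF \<zeta>] E[OF \<zeta>] measure_arc_le[of \<zeta> "5 * R \<zeta>"] by (simp add: Y_def \<zeta>_def[symmetric])
    also have "\<dots> = ennreal (15 / \<alpha>) * ennreal (\<alpha> * R \<zeta>)"
      using R[OF \<zeta>] \<open>0 < \<alpha>\<close> by (simp flip: ennreal_mult'')
    also have "\<dots> \<le> ennreal (15 / \<alpha>) * emeasure M (X n)"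
    proof (rule mult_left_mono)
      have "ennreal (\<alpha> * R \<zeta>) \<le> (\<integral>\<^sup>+\<eta>. H \<eta> * indicator (cball \<zeta> (R \<zeta>)) \<eta> \<partial>arclength)"
        using R[OF \<zeta>] by auto
      also have "\<dots> = (\<integral>\<^sup>+\<eta>. H \<eta> * indicator (X n) \<eta> \<partial>arclength)"
        using True by (intro nn_integral_cong) (auto simp: X_def \<zeta>_def indicator_def)
      also have "\<dots> = emeasure M (X n)" unfolding M_def by (rule emeasure_density[OF H X, symmetric])
      finally show "ennreal (\<alpha> * R \<zeta>) \<le> emeasure M (X n)" .
    qed simp
    finally show ?thesis .
  qed (simp add: Y_def)
  have "emeasure arclength (\<Union>n. Y n) \<le> (\<Sum>n. emeasure arclength (Y n))"
    by (rule emeasure_subadditive_countably) (use Y in auto)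
  also have "\<dots> \<le> (\<Sum>n. ennreal (15 / \<alpha>) * emeasure M (X n))"
    by (intro suminf_le le) auto
  also have "\<dots> = ennreal (15 / \<alpha>) * (\<Sum>n. emeasure M (X n))" by simp
  also have "(\<Sum>n. emeasure M (X n)) = emeasure M (\<Union>n. X n)"
    using X by (intro suminf_emeasure disj) (auto simp: M_def)
  also have "\<dots> \<le> emeasure M (space M)" by (rule emeasure_space)
  also have "\<dots> = (\<integral>\<^sup>+\<eta>. H \<eta> \<partial>arclength)"
    unfolding M_def space_density by (subst emeasure_density[OF H sets.top]) (intro nn_integral_cong, simp)
  finally have 1: "emeasure arclength (\<Union>n. Y n) \<le> ennreal (15 / \<alpha>) * (\<integral>\<^sup>+\<eta>. H \<eta> \<partial>arclength)"
    by (simp add: mult_left_mono)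
  have 2: "E \<subseteq> (\<Union>n. Y n)"
  proof
    fix \<zeta> assume z: "\<zeta> \<in> E"
    then obtain i where i: "i \<in> C" "\<zeta> \<in> cball i (5 * R i)" using C(4) by auto
    have "\<zeta> \<in> Y (to_nat_on C i)" using i C(1) E[OF z] by (auto simp: Y_def D_def)
    then show "\<zeta> \<in> (\<Union>n. Y n)" by auto
  qed
  show ?thesis using 1 2 Y by (intro bexI[of _ "\<Union>n. Y n"]) auto
qed

section \<open>Poisson kernel and radial maximal function\<close>

definition poisson :: "real \<Rightarrow> complex \<Rightarrow> complex \<Rightarrow> real"
  where "poisson r \<zeta> \<eta> = (1 - r\<^sup>2) / (cmod (1 - of_real r * \<zeta> * cnj \<eta>))\<^sup>2"

lemma cmod_poisson_denominator:
  assumes "cmod \<zeta> = 1" "cmod \<eta> = 1" "0 \<le> r" "r < 1"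
  shows "1 - r \<le> cmod (1 - of_real r * \<zeta> * cnj \<eta>)" "cmod (\<zeta> - \<eta>) / 2 \<le> cmod (1 - of_real r * \<zeta> * cnj \<eta>)"
proof -
  have "cmod (1 - of_real r * \<zeta> * cnj \<eta>) = cmod (\<eta> * (1 - of_real r * \<zeta> * cnj \<eta>))"
    using assms by (simp add: norm_mult)
  also have "\<eta> * (1 - of_real r * \<zeta> * cnj \<eta>) = \<eta> - of_real r * \<zeta>"
    using mult_cnj_self(1)[of \<eta>] assms by (simp add: algebra_simps)
  finally have *: "cmod (1 - of_real r * \<zeta> * cnj \<eta>) = cmod (\<eta> - of_real r * \<zeta>)" .
  have "cmod \<eta> \<le> cmod (\<eta> - of_real r * \<zeta>) + cmod (of_real r * \<zeta>)"
    using norm_triangle_ineq[of "\<eta> - of_real r * \<zeta>" "of_real r * \<zeta>"] by simp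
  then show 1: "1 - r \<le> cmod (1 - of_real r * \<zeta> * cnj \<eta>)"
    unfolding * using assms by (simp add: norm_mult)
  have "cmod (\<eta> - \<zeta>) \<le> cmod (\<eta> - of_real r * \<zeta>) + cmod (of_real r * \<zeta> - \<zeta>)"
    using norm_triangle_ineq[of "\<eta> - of_real r * \<zeta>" "of_real r * \<zeta> - \<zeta>"] by simp
  also have "of_real r * \<zeta> - \<zeta> = of_real (r - 1) * \<zeta>" by (simp add: algebra_simps)
  also have "cmod (of_real (r - 1) * \<zeta>) = 1 - r" using assms by (simp add: norm_mult del: of_real_diff)
  finally show "cmod (\<zeta> - \<eta>) / 2 \<le> cmod (1 - of_real r * \<zeta> * cnj \<eta>)"
    using 1 unfolding * by (simp add: norm_minus_commute)
qed

text \<open>Dyadic decomposition of the Poisson kernel around its peak.\<close>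

lemma poisson_le_dyadic:
  assumes z: "cmod \<zeta> = 1" "cmod \<eta> = 1" and r: "0 \<le> r" "r < 1"
  defines "K \<equiv> {k::nat. 2 ^ k * (1 - r) \<le> 4}"
  shows "finite K" "poisson r \<zeta> \<eta> \<le> (\<Sum>k\<in>K. 32 / (4 ^ k * (1 - r)) * indicator (cball \<zeta> (2 ^ k * (1 - r))) \<eta>)"
proof -
  define d where "d = 1 - r"
  have d: "0 < d" "d \<le> 1" using r by (auto simp: d_def)
  define q where "q = cmod (1 - of_real r * \<zeta> * cnj \<eta>)"
  have q: "d \<le> q" "cmod (\<zeta> - \<eta>) / 2 \<le> q"
    using cmod_poisson_denominator[OF z r] by (auto simp: q_def d_def)
  obtain n0 where n0: "4 / d < 2 ^ n0" using real_arch_pow[of 2 "4 / d"] by auto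
  have "k < n0" if "k \<in> K" for k
  proof -
    have "2 ^ k \<le> 4 / d" using that d by (simp add: K_def d_def pos_le_divide_eq)
    then have "(2::real) ^ k < 2 ^ n0" using n0 by (rule le_less_trans)
    then show ?thesis by simp
  qed
  then show fin: "finite K" by (meson finite_nat_set_iff_bounded)
  have ex: "\<exists>k. cmod (\<zeta> - \<eta>) \<le> 2 ^ k * d"
  proof (intro exI[of _ n0])
    have "cmod (\<zeta> - \<eta>) \<le> 2" using norm_triangle_ineq4[of \<zeta> \<eta>] z by simp
    also have "\<dots> \<le> 2 ^ n0 * d" using n0 d by (simp add: divide_less_eq)
    finally show "cmod (\<zeta> - \<eta>) \<le> 2 ^ n0 * d" .
  qed
  \<comment> \<open>The smallest dyadic ball around \<zeta> that contains \<eta>.\<close>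
  define k where "k = (LEAST k. cmod (\<zeta> - \<eta>) \<le> 2 ^ k * d)"
  have k: "cmod (\<zeta> - \<eta>) \<le> 2 ^ k * d" unfolding k_def using ex by (rule LeastI_ex)
  have num: "1 - r\<^sup>2 \<le> 2 * d" "0 \<le> 1 - r\<^sup>2"
  proof -
    have "1 - r\<^sup>2 = d * (1 + r)" by (simp add: d_def power2_eq_square algebra_simps)
    then show "1 - r\<^sup>2 \<le> 2 * d" "0 \<le> 1 - r\<^sup>2" using d r by auto
  qed
  have kK: "k \<in> K \<and> poisson r \<zeta> \<eta> \<le> 32 / (4 ^ k * d)"
  proof (cases k)
    case 0
    have "poisson r \<zeta> \<eta> \<le> 2 * d / d\<^sup>2"
      unfolding poisson_def q_def[symmetric] using num q d by (intro frac_le power_mono) auto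
    also have "\<dots> \<le> 32 / (4 ^ k * d)" using d 0 by (simp add: power2_eq_square divide_right_mono)
    finally show ?thesis using 0 d by (simp add: K_def d_def)
  next
    case (Suc j)
    \<comment> \<open>By minimality \<eta> lies outside the ball of half the radius. As chords are
      at most 2, the radius is at most 4, so \<open>k\<close> is in \<open>K\<close>; and the lower
      bound for the denominator gives
      \<open>2 * d / (2 ^ j * d / 2)\<^sup>2 = 32 / (4 ^ k * d)\<close>.\<close>
    then have j: "2 ^ j * d < cmod (\<zeta> - \<eta>)" using not_less_Least[of j "\<lambda>k. cmod (\<zeta> - \<eta>) \<le> 2 ^ k * d"] by (simp add: k_def[symmetric])
    also have "\<dots> \<le> 2" using norm_triangle_ineq4[of \<zeta> \<eta>] z by simp
    finally have "k \<in> K" using Suc by (simp add: K_def d_def mult.commute)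
    have q': "2 ^ j * d / 2 \<le> q" using q j by linarith
    have "poisson r \<zeta> \<eta> \<le> 2 * d / (2 ^ j * d / 2)\<^sup>2"
      unfolding poisson_def q_def[symmetric] using num q' d by (intro frac_le power_mono) auto
    also have "\<dots> = 32 / (4 ^ k * d)"
      using d Suc by (simp add: power2_eq_square field_simps flip: power_mult_distrib)
    finally show ?thesis using \<open>k \<in> K\<close> by simp
  qed
  have "32 / (4 ^ k * d) = 32 / (4 ^ k * d) * indicator (cball \<zeta> (2 ^ k * d)) \<eta>"
    using k by (simp add: dist_norm)
  also have "\<dots> \<le> (\<Sum>k\<in>K. 32 / (4 ^ k * d) * indicator (cball \<zeta> (2 ^ k * d)) \<eta>)"
    using kK fin d by (intro member_le_sum) auto
  finally show "poisson r \<zeta> \<eta> \<le> (\<Sum>k\<in>K. 32 / (4 ^ k * (1 - r)) * indicator (cball \<zeta> (2 ^ k * (1 - r))) \<eta>)"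
    using kK by (simp add: d_def)
qed

lemma measurable_poisson [measurable]: "poisson r \<zeta> \<in> borel_measurable borel"
  unfolding poisson_def[abs_def] by measurable

text \<open>In the dyadic majorant the ball of radius \<open>2 ^ k * (1 - r)\<close> carries height
  \<open>32 / (4 ^ k * (1 - r))\<close>, so it contributes at most
  \<open>32 * \<alpha> / 2 ^ k\<close>; the geometric series doubles the first term. Radii beyond 4
  do not occur in the majorant.\<close>

lemma poisson_maximal:
  assumes z: "cmod \<zeta> = 1" and r: "0 \<le> r" "r < 1" and H [measurable]: "H \<in> borel_measurable arclength" and "0 \<le> \<alpha>"
    and M: "\<And>\<rho>. 0 < \<rho> \<Longrightarrow> \<rho> \<le> 4 \<Longrightarrow> (\<integral>\<^sup>+\<eta>. H \<eta> * indicator (cball \<zeta> \<rho>) \<eta> \<partial>arclength) \<le> ennreal (\<alpha> * \<rho>)"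
  shows "(\<integral>\<^sup>+\<eta>. H \<eta> * ennreal (poisson r \<zeta> \<eta>) \<partial>arclength) \<le> ennreal (64 * \<alpha>)"
proof -
  define K where "K = {k::nat. 2 ^ k * (1 - r) \<le> 4}"
  define c where "c k = 32 / (4 ^ k * (1 - r))" for k :: nat
  note [measurable] = measurable_arclengthI[OF measurable_poisson] measurable_indicator_arclength
  have fin: "finite K" unfolding K_def using poisson_le_dyadic(1)[OF z z r] .
  have c: "0 \<le> c k" for k using r by (simp add: c_def)
  have "(\<integral>\<^sup>+\<eta>. H \<eta> * ennreal (poisson r \<zeta> \<eta>) \<partial>arclength) \<le>
      (\<integral>\<^sup>+\<eta>. (\<Sum>k\<in>K. ennreal (c k) * (H \<eta> * indicator (cball \<zeta> (2 ^ k * (1 - r))) \<eta>)) \<partial>arclength)"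
  proof (rule nn_integral_mono)
    fix \<eta> assume "\<eta> \<in> space arclength"
    then have "cmod \<eta> = 1" by simp
    have "ennreal (poisson r \<zeta> \<eta>) \<le> ennreal (\<Sum>k\<in>K. c k * indicator (cball \<zeta> (2 ^ k * (1 - r))) \<eta>)"
      using poisson_le_dyadic(2)[OF z \<open>cmod \<eta> = 1\<close> r] by (intro ennreal_leI) (simp add: K_def c_def)
    also have "\<dots> = (\<Sum>k\<in>K. ennreal (c k) * indicator (cball \<zeta> (2 ^ k * (1 - r))) \<eta>)"
      using c by (subst sum_ennreal[symmetric]) (auto simp: ennreal_mult ennreal_indicator)
    finally have "H \<eta> * ennreal (poisson r \<zeta> \<eta>) \<le> H \<eta> * (\<Sum>k\<in>K. ennreal (c k) * indicator (cball \<zeta> (2 ^ k * (1 - r))) \<eta>)"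
      by (rule mult_left_mono) simp
    then show "H \<eta> * ennreal (poisson r \<zeta> \<eta>) \<le> (\<Sum>k\<in>K. ennreal (c k) * (H \<eta> * indicator (cball \<zeta> (2 ^ k * (1 - r))) \<eta>))"
      by (simp add: sum_distrib_left mult_ac)
  qed
  also have "\<dots> = (\<Sum>k\<in>K. ennreal (c k) * (\<integral>\<^sup>+\<eta>. H \<eta> * indicator (cball \<zeta> (2 ^ k * (1 - r))) \<eta> \<partial>arclength))"
    by (subst nn_integral_sum) (auto simp: nn_integral_cmult)
  also have "\<dots> \<le> (\<Sum>k\<in>K. ennreal (c k) * ennreal (\<alpha> * (2 ^ k * (1 - r))))"
    using r by (intro sum_mono mult_left_mono M) (auto simp: K_def)
  also have "\<dots> = (\<Sum>k\<in>K. ennreal (32 * \<alpha> * (1/2) ^ k))"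
  proof (rule sum.cong)
    fix k
    have "ennreal (c k) * ennreal (\<alpha> * (2 ^ k * (1 - r))) = ennreal (c k * (\<alpha> * (2 ^ k * (1 - r))))"
      using c by (simp add: ennreal_mult')
    also have "c k * (\<alpha> * (2 ^ k * (1 - r))) = 32 * \<alpha> * (2 ^ k / 4 ^ k)"
      using r by (simp add: c_def)
    also have "(2::real) ^ k / 4 ^ k = (1/2) ^ k" by (simp flip: power_divide)
    finally show "ennreal (c k) * ennreal (\<alpha> * (2 ^ k * (1 - r))) = ennreal (32 * \<alpha> * (1/2) ^ k)" .
  qed simp
  also have "\<dots> = ennreal (\<Sum>k\<in>K. 32 * \<alpha> * (1/2) ^ k)"
    using \<open>0 \<le> \<alpha>\<close> by (intro sum_ennreal) auto
  also have "\<dots> \<le> ennreal (64 * \<alpha>)"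
  proof (rule ennreal_leI)
    have "(\<Sum>k\<in>K. (1/2 :: real) ^ k) \<le> (\<Sum>k. (1/2) ^ k)"
      by (rule sum_le_suminf) (use fin in \<open>auto intro!: summable_geometric\<close>)
    also have "\<dots> = 2" by (subst suminf_geometric) auto
    finally show "(\<Sum>k\<in>K. 32 * \<alpha> * (1/2) ^ k) \<le> 64 * \<alpha>"
      using \<open>0 \<le> \<alpha>\<close> mult_left_mono[of "\<Sum>k\<in>K. (1/2 :: real) ^ k" 2 "32 * \<alpha>"] by (simp add: sum_distrib_left)
  qed
  finally show ?thesis .
qed

lemma cf_integral: "cf h n = (\<integral>\<eta>. rep_circle_L2 h \<eta> * \<eta> powi (-n) \<partial>arclength)"
proof -
  have [measurable]: "zpow k \<in> borel_measurable arclength" for k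
    by (intro measurable_arclengthI measurable_powi)
  show ?thesis unfolding cf_def cinner.rep_eq
  proof (rule integral_cong_AE)
    show "AE \<eta> in arclength. rep_circle_L2 h \<eta> * cnj (rep_circle_L2 (ee n) \<eta>) = rep_circle_L2 h \<eta> * \<eta> powi (-n)"
      using rep_ee[of n] AE_arclength_circle by eventually_elim (simp add: cnj_zpow)
  qed measurable
qed

lemma poisson_series:
  assumes x: "cmod x < 1"
  shows "(\<lambda>n. x ^ n + cnj x ^ Suc n) sums of_real ((1 - (cmod x)\<^sup>2) / (cmod (1 - x))\<^sup>2)"
proof -
  have "x \<noteq> 1" using x by auto
  then have ne: "1 - x \<noteq> 0" "1 - cnj x \<noteq> 0" by (auto simp: complex_eq_iff)
  have "(\<lambda>n. x ^ n + cnj x * cnj x ^ n) sums (1 / (1 - x) + cnj x * (1 / (1 - cnj x)))"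
    using x by (intro sums_add sums_mult geometric_sums) auto
  also have "1 / (1 - x) + cnj x * (1 / (1 - cnj x)) = (1 - x * cnj x) / ((1 - x) * (1 - cnj x))"
    using ne by (simp add: divide_simps) (simp add: algebra_simps)
  also have "(1 - x) * (1 - cnj x) = of_real ((cmod (1 - x))\<^sup>2)" using mult_cnj_self(1)[of "1 - x"] by simp
  also have "1 - x * cnj x = of_real (1 - (cmod x)\<^sup>2)" using mult_cnj_self(1)[of x] by simp
  finally show ?thesis by simp
qed

text \<open>When the kernel is expanded in powers of \<open>x\<close> and its conjugate, the
  conjugate powers meet coefficients of negative index only, and these vanish. The Poisson integral
  is therefore the power series of \<open>h\<close>.\<close>

lemma cf_poisson_sums:
  assumes h: "\<And>n. n < 0 \<Longrightarrow> cf h n = 0" and z: "cmod \<zeta> = 1" and r: "0 \<le> r" "r < 1"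
  shows "(\<lambda>n. cf h (int n) * (of_real r * \<zeta>) ^ n) sums (\<integral>\<eta>. rep_circle_L2 h \<eta> * of_real (poisson r \<zeta> \<eta>) \<partial>arclength)"
proof -
  define x where "x \<eta> = of_real r * \<zeta> * cnj \<eta>" for \<eta>
  \<comment> \<open>\<open>Suc n\<close> keeps the constant term of the kernel from being counted
    twice.\<close>
  define k where "k n \<eta> = x \<eta> ^ n + cnj (x \<eta>) ^ Suc n" for n \<eta>
  have nx: "cmod (x \<eta>) = r" if "cmod \<eta> = 1" for \<eta> using that z r by (simp add: x_def norm_mult)
  have [measurable]: "x \<in> borel_measurable borel" unfolding x_def[abs_def] by measurable
  have km: "k n \<in> borel_measurable arclength" for n
    unfolding k_def[abs_def] by (intro measurable_arclengthI) measurable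
  note [measurable] = km measurable_arclengthI[OF measurable_poisson]
  have kb: "cmod (k n \<eta>) \<le> 2 * r ^ n" if "cmod \<eta> = 1" for n \<eta>
  proof -
    have "cmod (k n \<eta>) \<le> cmod (x \<eta> ^ n) + cmod (cnj (x \<eta>) ^ Suc n)" unfolding k_def by (rule norm_triangle_ineq)
    also have "\<dots> = r ^ n + r ^ n * r" using nx[OF that] by (simp add: norm_power norm_mult)
    also have "\<dots> \<le> r ^ n + r ^ n * 1" using r by (intro add_left_mono mult_left_mono) auto
    finally show ?thesis by simp
  qed
  have ki: "integrable arclength (\<lambda>\<eta>. rep_circle_L2 h \<eta> * k n \<eta>)" for n
  proof (rule Bochner_Integration.integrable_bound[OF integrable_norm[OF integrable_rep[of h], THEN integrable_mult_left[of 2]]])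
    have "2 * r ^ n \<le> 2" for n using r power_le_one[of r n] by simp
    then show "AE \<eta> in arclength. norm (rep_circle_L2 h \<eta> * k n \<eta>) \<le> norm (norm (rep_circle_L2 h \<eta>) * 2)"
      using order_trans[OF kb] by (intro AE_arclengthI) (simp add: norm_mult mult_left_mono)
  qed measurable
  have kint: "(\<integral>\<eta>. rep_circle_L2 h \<eta> * k n \<eta> \<partial>arclength) = cf h (int n) * (of_real r * \<zeta>) ^ n" for n
  proof -
    have zi: "integrable arclength (\<lambda>\<eta>. rep_circle_L2 h \<eta> * \<eta> powi j)" for j
    proof -
      have "integrable arclength (\<lambda>\<eta>. rep_circle_L2 h \<eta> * cnj (zpow (-j) \<eta>))"
        by (rule square_integrable_mult_cnj) auto
      then show ?thesis
        by (rule Bochner_Integration.integrable_cong[THEN iffD1, rotated 2]) (auto simp: cnj_zpow)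
    qed
    have "(\<integral>\<eta>. rep_circle_L2 h \<eta> * k n \<eta> \<partial>arclength) =
        (\<integral>\<eta>. (of_real r * \<zeta>) ^ n * (rep_circle_L2 h \<eta> * \<eta> powi (- int n)) +
          (of_real r * cnj \<zeta>) ^ Suc n * (rep_circle_L2 h \<eta> * \<eta> powi (- (- int (Suc n)))) \<partial>arclength)"
    proof (rule Bochner_Integration.integral_cong)
      fix \<eta> assume "\<eta> \<in> space arclength"
      then have e: "cmod \<eta> = 1" by simp
      have "cnj \<eta> ^ n = \<eta> powi (- int n)" using cnj_zpow[OF e, of "int n"] by simp
      moreover have "\<eta> powi (- (- int (Suc n))) = \<eta> ^ Suc n" by (metis minus_minus power_int_of_nat)
      ultimately show "rep_circle_L2 h \<eta> * k n \<eta> = (of_real r * \<zeta>) ^ n * (rep_circle_L2 h \<eta> * \<eta> powi (- int n)) +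
          (of_real r * cnj \<zeta>) ^ Suc n * (rep_circle_L2 h \<eta> * \<eta> powi (- (- int (Suc n))))"
        unfolding k_def x_def by (simp only: complex_cnj_mult complex_cnj_cnj complex_cnj_complex_of_real power_mult_distrib) (simp only: algebra_simps)
    qed simp
    also have "\<dots> = (of_real r * \<zeta>) ^ n * cf h (int n) + (of_real r * cnj \<zeta>) ^ Suc n * cf h (- int (Suc n))"
      unfolding cf_integral by (subst Bochner_Integration.integral_add) (intro integrable_mult_right zi | simp only: integral_mult_right_zero)+
    also have "cf h (- int (Suc n)) = 0" by (rule h) simp
    finally show ?thesis by (simp add: mult.commute)
  qed
  have "(\<lambda>n. \<integral>\<eta>. rep_circle_L2 h \<eta> * k n \<eta> \<partial>arclength) sums (\<integral>\<eta>. (\<Sum>n. rep_circle_L2 h \<eta> * k n \<eta>) \<partial>arclength)"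
  proof (rule sums_integral[OF ki])
    have sm: "summable (\<lambda>n. 2 * r ^ n)" using r by (intro summable_mult summable_geometric) auto
    show "AE \<eta> in arclength. summable (\<lambda>n. norm (rep_circle_L2 h \<eta> * k n \<eta>))"
    proof (rule AE_arclengthI)
      fix \<eta> :: complex assume "cmod \<eta> = 1"
      then show "summable (\<lambda>n. norm (rep_circle_L2 h \<eta> * k n \<eta>))"
        using kb by (intro summable_comparison_test'[OF summable_mult[OF sm, of "cmod (rep_circle_L2 h \<eta>)"], of 0])
          (auto simp: norm_mult intro!: mult_left_mono)
    qed
    show "summable (\<lambda>n. \<integral>\<eta>. norm (rep_circle_L2 h \<eta> * k n \<eta>) \<partial>arclength)"
    proof (rule summable_comparison_test'[OF summable_mult[OF sm, of "\<integral>\<eta>. cmod (rep_circle_L2 h \<eta>) \<partial>arclength"], of 0])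
      fix n
      have "(\<integral>\<eta>. norm (rep_circle_L2 h \<eta> * k n \<eta>) \<partial>arclength) \<le> (\<integral>\<eta>. cmod (rep_circle_L2 h \<eta>) * (2 * r ^ n) \<partial>arclength)"
        using kb by (intro integral_mono_AE integrable_norm[OF ki] integrable_mult_left integrable_norm[OF integrable_rep] AE_arclengthI)
          (auto simp: norm_mult intro!: mult_left_mono)
      then show "norm (\<integral>\<eta>. norm (rep_circle_L2 h \<eta> * k n \<eta>) \<partial>arclength) \<le> (\<integral>\<eta>. cmod (rep_circle_L2 h \<eta>) \<partial>arclength) * (2 * r ^ n)"
        by simp
    qed
  qed
  also have "(\<integral>\<eta>. (\<Sum>n. rep_circle_L2 h \<eta> * k n \<eta>) \<partial>arclength) = (\<integral>\<eta>. rep_circle_L2 h \<eta> * of_real (poisson r \<zeta> \<eta>) \<partial>arclength)"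
  proof (rule Bochner_Integration.integral_cong)
    fix \<eta> assume "\<eta> \<in> space arclength"
    then have e: "cmod \<eta> = 1" by simp
    have "(\<lambda>n. k n \<eta>) sums of_real (poisson r \<zeta> \<eta>)"
      using poisson_series[of "x \<eta>"] nx[OF e] r by (simp add: k_def poisson_def x_def)
    then have "(\<lambda>n. rep_circle_L2 h \<eta> * k n \<eta>) sums (rep_circle_L2 h \<eta> * of_real (poisson r \<zeta> \<eta>))"
      by (rule sums_mult)
    then show "(\<Sum>n. rep_circle_L2 h \<eta> * k n \<eta>) = rep_circle_L2 h \<eta> * of_real (poisson r \<zeta> \<eta>)"
      by (rule sums_unique[symmetric])
  qed simp
  finally show ?thesis unfolding kint .
qed

lemma nn_integral_rep_le: "(\<integral>\<^sup>+\<eta>. ennreal (cmod (rep_circle_L2 h \<eta>)) \<partial>arclength) \<le> ennreal (norm h)"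
proof -
  have "(\<integral>\<^sup>+\<eta>. ennreal (cmod (rep_circle_L2 h \<eta>)) \<partial>arclength) = ennreal (\<integral>\<eta>. cmod (rep_circle_L2 h \<eta>) \<partial>arclength)"
    by (intro nn_integral_eq_integral integrable_norm integrable_rep) auto
  also have "\<dots> \<le> ennreal (norm h)"
    using integral_norm_le_norm(2)[OF square_integrable_rep[of h]] by (intro ennreal_leI) simp
  finally show ?thesis .
qed

text \<open>Of the constant 16, fifteen come from the covering argument, which controls the values
  along the radius, and one from Markov's inequality, which controls the boundary value
  itself.\<close>

lemma radial_maximal:
  assumes h: "\<And>n. n < 0 \<Longrightarrow> cf h n = 0" and "0 < \<alpha>"
  shows "\<exists>U\<in>sets arclength. emeasure arclength U \<le> ennreal (16 / \<alpha> * norm h) \<and>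
    (\<forall>\<zeta>. cmod \<zeta> = 1 \<longrightarrow> \<zeta> \<notin> U \<longrightarrow> cmod (rep_circle_L2 h \<zeta>) \<le> \<alpha> \<and>
      (\<forall>r. 0 \<le> r \<longrightarrow> r < 1 \<longrightarrow> cmod (\<Sum>n. cf h (int n) * (of_real r * \<zeta>) ^ n) \<le> 64 * \<alpha>))"
proof -
  define H where "H \<eta> = ennreal (cmod (rep_circle_L2 h \<eta>))" for \<eta>
  have Hm [measurable]: "H \<in> borel_measurable arclength" unfolding H_def[abs_def] by measurable
  define E where "E = {\<zeta>. cmod \<zeta> = 1 \<and> (\<exists>\<rho>. 0 < \<rho> \<and> \<rho> \<le> 4 \<and> ennreal (\<alpha> * \<rho>) < (\<integral>\<^sup>+\<eta>. H \<eta> * indicator (cball \<zeta> \<rho>) \<eta> \<partial>arclength))}"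
  obtain U where U: "U \<in> sets arclength" "E \<subseteq> U" "emeasure arclength U \<le> ennreal (15 / \<alpha>) * (\<integral>\<^sup>+\<eta>. H \<eta> \<partial>arclength)"
    using maximal_weak_type[OF Hm \<open>0 < \<alpha>\<close>, of E 4] by (auto simp: E_def)
  define V where "V = {\<zeta> \<in> space arclength. 1 \<le> ennreal (1 / \<alpha>) * H \<zeta>}"
  have V: "V \<in> sets arclength" unfolding V_def by measurable
  have "emeasure arclength V \<le> ennreal (1 / \<alpha>) * (\<integral>\<^sup>+\<eta>. H \<eta> * indicator (space arclength) \<eta> \<partial>arclength)"
    unfolding V_def
  proof (rule nn_integral_Markov_inequality)
    show "(\<lambda>\<zeta>. H \<zeta> * indicator (space arclength) \<zeta>) \<in> borel_measurable arclength" by measurable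
  qed (rule sets.top)
  also have "(\<integral>\<^sup>+\<eta>. H \<eta> * indicator (space arclength) \<eta> \<partial>arclength) = (\<integral>\<^sup>+\<eta>. H \<eta> \<partial>arclength)"
    by (intro nn_integral_cong) auto
  finally have Vle: "emeasure arclength V \<le> ennreal (1 / \<alpha>) * (\<integral>\<^sup>+\<eta>. H \<eta> \<partial>arclength)" .
  have "emeasure arclength (U \<union> V) \<le> emeasure arclength U + emeasure arclength V"
    by (rule emeasure_subadditive[OF U(1) V])
  also have "\<dots> \<le> ennreal (15 / \<alpha>) * (\<integral>\<^sup>+\<eta>. H \<eta> \<partial>arclength) + ennreal (1 / \<alpha>) * (\<integral>\<^sup>+\<eta>. H \<eta> \<partial>arclength)"
    by (intro add_mono U(3) Vle)
  also have "\<dots> = ennreal (16 / \<alpha>) * (\<integral>\<^sup>+\<eta>. H \<eta> \<partial>arclength)"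
    using \<open>0 < \<alpha>\<close> by (simp add: add_divide_distrib flip: distrib_right ennreal_plus)
  also have "\<dots> \<le> ennreal (16 / \<alpha>) * ennreal (norm h)"
    unfolding H_def by (intro mult_left_mono nn_integral_rep_le) auto
  also have "\<dots> = ennreal (16 / \<alpha> * norm h)"
    using \<open>0 < \<alpha>\<close> by (subst ennreal_mult) auto
  finally have 1: "emeasure arclength (U \<union> V) \<le> ennreal (16 / \<alpha> * norm h)" .
  have 2: "cmod (rep_circle_L2 h \<zeta>) \<le> \<alpha>" if "cmod \<zeta> = 1" "\<zeta> \<notin> U \<union> V" for \<zeta>
  proof (rule ccontr)
    assume "\<not> cmod (rep_circle_L2 h \<zeta>) \<le> \<alpha>"
    then have "1 \<le> ennreal (1 / \<alpha> * cmod (rep_circle_L2 h \<zeta>))"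
      using \<open>0 < \<alpha>\<close> unfolding ennreal_1[symmetric] by (intro ennreal_leI) (simp add: field_simps)
    also have "\<dots> = ennreal (1 / \<alpha>) * ennreal (cmod (rep_circle_L2 h \<zeta>))"
      using \<open>0 < \<alpha>\<close> by (intro ennreal_mult) auto
    finally have "\<zeta> \<in> V" using that by (simp add: V_def H_def)
    then show False using that by simp
  qed
  have 3: "cmod (\<Sum>n. cf h (int n) * (of_real r * \<zeta>) ^ n) \<le> 64 * \<alpha>"
    if z: "cmod \<zeta> = 1" "\<zeta> \<notin> U \<union> V" and r: "0 \<le> r" "r < 1" for \<zeta> r
  proof -
    have "(\<Sum>n. cf h (int n) * (of_real r * \<zeta>) ^ n) = (\<integral>\<eta>. rep_circle_L2 h \<eta> * of_real (poisson r \<zeta> \<eta>) \<partial>arclength)"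
      using cf_poisson_sums[OF h z(1) r] by (simp add: sums_iff)
    moreover have "ennreal (cmod (\<integral>\<eta>. rep_circle_L2 h \<eta> * of_real (poisson r \<zeta> \<eta>) \<partial>arclength)) \<le>
        (\<integral>\<^sup>+\<eta>. ennreal (cmod (rep_circle_L2 h \<eta> * of_real (poisson r \<zeta> \<eta>))) \<partial>arclength)"
    proof (cases "integrable arclength (\<lambda>\<eta>. rep_circle_L2 h \<eta> * of_real (poisson r \<zeta> \<eta>))")
      case True
      then show ?thesis by (rule integral_norm_bound_ennreal)
    qed (simp add: not_integrable_integral_eq)
    moreover have "(\<integral>\<^sup>+\<eta>. ennreal (cmod (rep_circle_L2 h \<eta> * of_real (poisson r \<zeta> \<eta>))) \<partial>arclength) =
        (\<integral>\<^sup>+\<eta>. H \<eta> * ennreal (poisson r \<zeta> \<eta>) \<partial>arclength)"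
    proof (intro nn_integral_cong)
      fix \<eta>
      have "r\<^sup>2 \<le> 1" using r by (simp add: power_le_one)
      then have "0 \<le> poisson r \<zeta> \<eta>" by (simp add: poisson_def)
      then show "ennreal (cmod (rep_circle_L2 h \<eta> * of_real (poisson r \<zeta> \<eta>))) = H \<eta> * ennreal (poisson r \<zeta> \<eta>)"
        by (simp add: H_def norm_mult ennreal_mult)
    qed
    moreover have "\<dots> \<le> ennreal (64 * \<alpha>)"
    proof (rule poisson_maximal[OF z(1) r Hm])
      fix \<rho> :: real assume "0 < \<rho>" "\<rho> \<le> 4"
      then show "(\<integral>\<^sup>+\<eta>. H \<eta> * indicator (cball \<zeta> \<rho>) \<eta> \<partial>arclength) \<le> ennreal (\<alpha> * \<rho>)"
        using z U(2) by (force simp: E_def not_less[symmetric])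
    qed (use \<open>0 < \<alpha>\<close> in auto)
    ultimately have "ennreal (cmod (\<Sum>n. cf h (int n) * (of_real r * \<zeta>) ^ n)) \<le> ennreal (64 * \<alpha>)"
      by (auto intro: order_trans)
    then show ?thesis using \<open>0 < \<alpha>\<close> by (simp add: ennreal_le_iff)
  qed
  show ?thesis using 1 2 3 U(1) V by (intro bexI[of _ "U \<union> V"]) auto
qed

text \<open>For each level \<open>1 / Suc j\<close> and each \<open>N\<close> the maximal inequality
  for the remainder after \<open>N\<close> terms leaves an exceptional set whose measure tends to
  zero with \<open>N\<close>; hence the intersection over \<open>N\<close> is null. At any other
  point some \<open>N\<close> makes the remainder small both along the radius and at the boundary,
  and the polynomial part is continuous.\<close>

theorem fatou_radial:
  assumes g: "\<And>n. n < 0 \<Longrightarrow> cf g n = 0"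
  shows "AE \<zeta> in arclength.
    ((\<lambda>r. \<Sum>n. cf g (int n) * (of_real r * \<zeta>) ^ n) \<longlongrightarrow> rep_circle_L2 g \<zeta>) (at_left (1::real))"
proof -
  define s where "s N = taylor_sum (\<lambda>n. cf g (int n)) N" for N
  define h where "h N = g - s N" for N
  have hN: "cf (h N) n = 0" if "n < 0" for N n
    using that g by (simp add: h_def s_def cf_simps cf_taylor_sum)
  have hlim: "(\<lambda>N. norm (h N)) \<longlonglongrightarrow> 0"
  proof -
    have "(\<lambda>N. norm (g - s N)) \<longlonglongrightarrow> norm (g - g)"
      unfolding s_def by (intro tendsto_intros taylor_sum_tendsto g)
    then show ?thesis by (simp add: h_def)
  qed
  define P where "P N j U \<longleftrightarrow> U \<in> sets arclength \<and> emeasure arclength U \<le> ennreal (16 * real (Suc j) * norm (h N)) \<and>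
    (\<forall>\<zeta>. cmod \<zeta> = 1 \<longrightarrow> \<zeta> \<notin> U \<longrightarrow> cmod (rep_circle_L2 (h N) \<zeta>) \<le> 1 / real (Suc j) \<and>
      (\<forall>r. 0 \<le> r \<longrightarrow> r < 1 \<longrightarrow> cmod (\<Sum>n. cf (h N) (int n) * (of_real r * \<zeta>) ^ n) \<le> 64 * (1 / real (Suc j))))" for N j U
  have "\<exists>U. P N j U" for N j
    using radial_maximal[OF hN[where N = N], of "1 / real (Suc j)"] unfolding P_def Bex_def by (simp del: of_nat_Suc)
  then obtain U where UP: "\<And>N j. P N j (U N j)" by metis
  have U: "U N j \<in> sets arclength" "emeasure arclength (U N j) \<le> ennreal (16 * real (Suc j) * norm (h N))"
    "cmod \<zeta> = 1 \<Longrightarrow> \<zeta> \<notin> U N j \<Longrightarrow> cmod (rep_circle_L2 (h N) \<zeta>) \<le> 1 / real (Suc j)"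
    "cmod \<zeta> = 1 \<Longrightarrow> \<zeta> \<notin> U N j \<Longrightarrow> 0 \<le> r \<Longrightarrow> r < 1 \<Longrightarrow>
      cmod (\<Sum>n. cf (h N) (int n) * (of_real r * \<zeta>) ^ n) \<le> 64 * (1 / real (Suc j))" for N j \<zeta> r
    using UP[of N j] unfolding P_def by blast+
  have null: "(\<Inter>N. U N j) \<in> null_sets arclength" for j
  proof (rule null_setsI)
    have "emeasure arclength (\<Inter>N. U N j) \<le> ennreal (16 * real (Suc j) * norm (h N))" for N
      by (rule order_trans[OF emeasure_mono U(2)]) (use U(1) in auto)
    moreover have "(\<lambda>N. ennreal (16 * real (Suc j) * norm (h N))) \<longlonglongrightarrow> ennreal (16 * real (Suc j) * 0)"
      by (intro tendsto_intros hlim)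
    ultimately have "emeasure arclength (\<Inter>N. U N j) \<le> ennreal (16 * real (Suc j) * 0)"
      by (intro LIMSEQ_le_const) auto
    then show "emeasure arclength (\<Inter>N. U N j) = 0" by simp
    show "(\<Inter>N. U N j) \<in> sets arclength" using U(1) by (intro sets.countable_INT) auto
  qed
  have ae1: "AE \<zeta> in arclength. \<forall>j. \<zeta> \<notin> (\<Inter>N. U N j)"
    unfolding AE_all_countable using AE_not_in[OF null] by blast
  have ae2: "AE \<zeta> in arclength. \<forall>N. rep_circle_L2 (h N) \<zeta> = rep_circle_L2 g \<zeta> - (\<Sum>n<N. cf g (int n) * \<zeta> ^ n)"
    unfolding AE_all_countable
  proof
    fix N
    have "AE \<zeta> in arclength. rep_circle_L2 (s N) \<zeta> = (\<Sum>n<N. cf g (int n) * \<zeta> ^ n)"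
    proof (induction N)
      case 0 then show ?case using rep_zero by (simp add: s_def taylor_sum_def)
    next
      case (Suc N)
      have "s (Suc N) = s N + cscale (cf g (int N)) (ee (int N))" by (simp add: s_def taylor_sum_def)
      then show ?case
        using Suc rep_plus[of "s N" "cscale (cf g (int N)) (ee (int N))"] rep_cscale[of "cf g (int N)" "ee (int N)"] rep_ee[of "int N"]
        by (auto elim!: eventually_elim2[OF eventually_conj eventually_conj])
    qed
    then show "AE \<zeta> in arclength. rep_circle_L2 (h N) \<zeta> = rep_circle_L2 g \<zeta> - (\<Sum>n<N. cf g (int n) * \<zeta> ^ n)"
      unfolding h_def using rep_minus[of g "s N"] by eventually_elim simp
  qed
  show ?thesis using ae1 ae2 AE_arclength_circle
  proof eventually_elim
    case (elim \<zeta>)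
    define F where "F r = (\<Sum>n. cf g (int n) * (of_real r * \<zeta>) ^ n)" for r :: real
    note rep_h = elim(2)
    have sm: "summable (\<lambda>n. cf g (int n) * (of_real r * \<zeta>) ^ n)" if "0 \<le> r" "r < 1" for r
      using cf_poisson_sums[OF g elim(3) that] by (simp add: sums_iff)
    show ?case
    proof (rule tendstoI)
      fix e :: real assume "e > 0"
      \<comment> \<open>Here 66 is 64 for the remainder along the radius, plus one for the
        polynomial part, plus one for the remainder at the boundary.\<close>
      obtain j where j: "66 / e < real (Suc j)" using reals_Archimedean2 less_trans[of _ "real _"] by (metis lessI of_nat_less_iff)
      then have je: "66 / real (Suc j) < e" using \<open>e > 0\<close> by (simp add: field_simps)
      obtain N where N: "\<zeta> \<notin> U N j" using elim(1) by auto
      define p where "p r = (\<Sum>n<N. cf g (int n) * (of_real r * \<zeta>) ^ n)" for r :: real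
      have p1: "p 1 = (\<Sum>n<N. cf g (int n) * \<zeta> ^ n)" by (simp add: p_def)
      have "(p \<longlongrightarrow> p 1) (at_left 1)"
        unfolding p_def by (intro tendsto_intros)
      then have "\<forall>\<^sub>F r in at_left 1. dist (p r) (p 1) < 1 / real (Suc j)"
        by (rule tendstoD) simp
      moreover have "\<forall>\<^sub>F r in at_left (1::real). 0 \<le> r \<and> r < 1"
        using eventually_at_left_real[of 0 1] by (auto elim!: eventually_mono)
      ultimately show "\<forall>\<^sub>F r in at_left 1. dist (\<Sum>n. cf g (int n) * (of_real r * \<zeta>) ^ n) (rep_circle_L2 g \<zeta>) < e"
      proof eventually_elim
        case (elim r)
        then have r: "0 \<le> r" "r < 1" by auto
        have "(\<Sum>n. cf (h N) (int n) * (of_real r * \<zeta>) ^ n) = F r - p r"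
        proof -
          have "(\<lambda>n. (if n < N then cf g (int n) * (of_real r * \<zeta>) ^ n else 0)) sums p r"
            using sums_If_finite[of "\<lambda>n. n < N" "\<lambda>n. cf g (int n) * (of_real r * \<zeta>) ^ n"]
            by (simp add: p_def lessThan_def)
          then have "(\<lambda>n. cf g (int n) * (of_real r * \<zeta>) ^ n - (if n < N then cf g (int n) * (of_real r * \<zeta>) ^ n else 0)) sums (F r - p r)"
            using sm[OF r] unfolding F_def by (intro sums_diff summable_sums)
          moreover have "cf (h N) (int n) * (of_real r * \<zeta>) ^ n = cf g (int n) * (of_real r * \<zeta>) ^ n - (if n < N then cf g (int n) * (of_real r * \<zeta>) ^ n else 0)" for n
            by (simp add: h_def s_def cf_simps cf_taylor_sum)
          ultimately show ?thesis by (simp add: sums_iff)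
        qed
        then have a: "cmod (F r - p r) \<le> 64 * (1 / real (Suc j))"
          using U(4)[OF \<open>cmod \<zeta> = 1\<close> N r] by simp
        have b: "cmod (rep_circle_L2 g \<zeta> - p 1) \<le> 1 / real (Suc j)"
          using U(3)[OF \<open>cmod \<zeta> = 1\<close> N] rep_h p1 by simp
        have c: "cmod (p r - p 1) \<le> 1 / real (Suc j)" using elim by (simp add: dist_norm)
        have "F r - rep_circle_L2 g \<zeta> = (F r - p r) + (p r - p 1) - (rep_circle_L2 g \<zeta> - p 1)" by simp
        also have "cmod \<dots> \<le> cmod (F r - p r) + cmod (p r - p 1) + cmod (rep_circle_L2 g \<zeta> - p 1)"
          by (intro norm_triangle_le_diff norm_triangle_le add_mono order_refl)
        also have "\<dots> \<le> 66 * (1 / real (Suc j))" using a b c by simp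
        also have "\<dots> < e" using je by simp
        finally show ?case by (simp add: dist_norm F_def)
      qed
    qed
  qed
qed

section \<open>The Hardy space\<close>

lemma measurable_continuous_circle:
  "continuous_on unit_circle f \<Longrightarrow> (f :: complex \<Rightarrow> complex) \<in> borel_measurable arclength"
  using borel_measurable_continuous_on_restrict[of unit_circle f] by (simp cong: measurable_cong_sets)

lemma bounded_symbol_continuous:
  assumes "continuous_on unit_circle f" shows "bounded_symbol f"
proof -
  obtain M where "\<And>\<zeta>. \<zeta> \<in> unit_circle \<Longrightarrow> cmod (f \<zeta>) \<le> M"
    using compact_continuous_image[OF assms compact_sphere] compact_imp_bounded bounded_iff by (metis imageI)
  then show ?thesis unfolding bounded_symbol_def
    using measurable_continuous_circle[OF assms] by (auto intro!: AE_arclengthI exI[of _ M])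
qed

lemma powi_times_powi_circle: "cmod \<zeta> = 1 \<Longrightarrow> \<zeta> ^ m * \<zeta> powi n = \<zeta> powi (int m + n)"
  using power_int_mult_circle[of \<zeta> "int m" n] by simp

lemma of_real_mult_circle_in_disc:
  assumes "cmod \<zeta> = 1" "0 \<le> r" "r < 1" shows "of_real r * \<zeta> \<in> unit_disc"
  using assms by (simp add: norm_mult)

text \<open>On a circle inside the disc the power series converges absolutely and uniformly, so it
  may be integrated term by term against \<open>\<eta> powi (-n)\<close>, and orthogonality leaves
  one term.\<close>

lemma cf_circle_restriction:
  assumes F: "\<And>z. z \<in> unit_disc \<Longrightarrow> (\<lambda>n. a n * z ^ n) sums F z" and r: "0 \<le> r" "r < 1"
  shows "bounded_symbol (\<lambda>\<zeta>. F (of_real r * \<zeta>))"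
    and "cf (abs_circle_L2 (\<lambda>\<zeta>. F (of_real r * \<zeta>))) n = (if n < 0 then 0 else a (nat n) * of_real r ^ nat n)"
proof -
  have "F holomorphic_on unit_disc" using F by (intro power_series_holomorphic[of 0 1 a]) auto
  then have cF: "continuous_on unit_disc F" by (rule holomorphic_on_imp_continuous_on)
  have "continuous_on unit_circle (\<lambda>\<zeta>. F (of_real r * \<zeta>))"
    by (rule continuous_on_compose2[OF cF]) (use r in \<open>auto intro!: continuous_intros simp: norm_mult\<close>)
  then show b: "bounded_symbol (\<lambda>\<zeta>. F (of_real r * \<zeta>))" by (rule bounded_symbol_continuous)
  note sq = bounded_symbol_square_integrable[OF b]
  define t where "t m \<eta> = a m * of_real r ^ m * (\<eta> ^ m * \<eta> powi (-n))" for m \<eta>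
  have tm: "t m \<in> borel_measurable arclength" for m
    unfolding t_def[abs_def] by (intro measurable_arclengthI) measurable
  have nt: "cmod (t m \<eta>) = cmod (a m) * r ^ m" if "cmod \<eta> = 1" for m \<eta>
    using that r by (simp add: t_def norm_mult norm_power norm_power_int)
  have ti: "integrable arclength (t m)" for m
    by (rule Bochner_Integration.integrable_bound[OF arclength.integrable_const[of "cmod (a m) * r ^ m"] tm])
      (use nt r in \<open>auto intro!: AE_arclengthI\<close>)
  have sm: "summable (\<lambda>m. cmod (a m) * r ^ m)"
  proof -
    \<comment> \<open>Convergence at a point strictly between \<open>r\<close> and \<open>1\<close>
      yields absolute convergence at radius \<open>r\<close>.\<close>
    have "summable (\<lambda>m. a m * complex_of_real ((1 + r) / 2) ^ m)"
      using F[of "of_real ((1 + r) / 2)"] r by (auto simp: sums_iff simp del: of_real_divide of_real_add)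
    then have "summable (\<lambda>m. norm (a m * complex_of_real r ^ m))"
      by (rule powser_insidea) (use r in \<open>simp del: of_real_divide of_real_add\<close>)
    then show ?thesis using r by (simp add: norm_mult norm_power)
  qed
  have "cf (abs_circle_L2 (\<lambda>\<zeta>. F (of_real r * \<zeta>))) n = (\<integral>\<eta>. F (of_real r * \<eta>) * \<eta> powi (-n) \<partial>arclength)"
    unfolding cf_integral
  proof (rule integral_cong_AE)
    show "AE \<eta> in arclength. rep_circle_L2 (abs_circle_L2 (\<lambda>\<zeta>. F (of_real r * \<zeta>))) \<eta> * \<eta> powi (-n) = F (of_real r * \<eta>) * \<eta> powi (-n)"
      using rep_abs_circle_L2[OF sq] by eventually_elim simp
    show "(\<lambda>\<eta>. F (of_real r * \<eta>) * \<eta> powi (-n)) \<in> borel_measurable arclength"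
      by (intro borel_measurable_times square_integrable_measurable[OF sq] measurable_arclengthI measurable_powi)
  qed (intro borel_measurable_times measurable_rep measurable_arclengthI measurable_powi)
  also have "\<dots> = (\<integral>\<eta>. (\<Sum>m. t m \<eta>) \<partial>arclength)"
  proof (rule Bochner_Integration.integral_cong)
    fix \<eta> assume "\<eta> \<in> space arclength"
    then have "of_real r * \<eta> \<in> unit_disc" using r by (intro of_real_mult_circle_in_disc) auto
    then have "(\<lambda>m. a m * (of_real r * \<eta>) ^ m * \<eta> powi (-n)) sums (F (of_real r * \<eta>) * \<eta> powi (-n))"
      by (intro sums_mult2 F)
    moreover have "a m * (of_real r * \<eta>) ^ m * \<eta> powi (-n) = t m \<eta>" for m
      by (simp add: t_def power_mult_distrib mult_ac)
    ultimately show "F (of_real r * \<eta>) * \<eta> powi (-n) = (\<Sum>m. t m \<eta>)" by (simp add: sums_iff)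
  qed simp
  finally have 1: "cf (abs_circle_L2 (\<lambda>\<zeta>. F (of_real r * \<zeta>))) n = (\<integral>\<eta>. (\<Sum>m. t m \<eta>) \<partial>arclength)" .
  have "(\<lambda>m. \<integral>\<eta>. t m \<eta> \<partial>arclength) sums (\<integral>\<eta>. (\<Sum>m. t m \<eta>) \<partial>arclength)"
  proof (rule sums_integral[OF ti])
    show "AE \<eta> in arclength. summable (\<lambda>m. norm (t m \<eta>))"
      using sm by (intro AE_arclengthI) (simp add: nt)
    have "(\<integral>\<eta>. norm (t m \<eta>) \<partial>arclength) = (\<integral>\<eta>. cmod (a m) * r ^ m \<partial>arclength)" for m
      by (intro Bochner_Integration.integral_cong) (simp_all add: nt)
    then show "summable (\<lambda>m. \<integral>\<eta>. norm (t m \<eta>) \<partial>arclength)" using sm by simp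
  qed
  moreover have "(\<integral>\<eta>. t m \<eta> \<partial>arclength) = (if int m = n then a m * of_real r ^ m else 0)" for m
  proof -
    have "(\<integral>\<eta>. t m \<eta> \<partial>arclength) = (\<integral>\<eta>. a m * of_real r ^ m * \<eta> powi (int m - n) \<partial>arclength)"
      by (intro Bochner_Integration.integral_cong) (simp_all add: t_def powi_times_powi_circle)
    then show ?thesis by (simp add: integral_powi)
  qed
  ultimately have 2: "(\<lambda>m. if int m = n then a m * of_real r ^ m else 0) sums (\<integral>\<eta>. (\<Sum>m. t m \<eta>) \<partial>arclength)" by simp
  have 3: "(\<lambda>m. if int m = n then a m * of_real r ^ m else 0) sums (if n < 0 then 0 else a (nat n) * of_real r ^ nat n)"
  proof (cases "n < 0")
    case True
    then have "int m \<noteq> n" for m by auto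
    with True show ?thesis by simp
  next
    case False
    then have "(\<lambda>m. if int m = n then a m * complex_of_real r ^ m else 0) = (\<lambda>m. if m = nat n then a m * of_real r ^ m else 0)"
      by (auto simp: fun_eq_iff)
    then show ?thesis using False sums_single[of "nat n" "\<lambda>m. a m * complex_of_real r ^ m"] by simp
  qed
  show "cf (abs_circle_L2 (\<lambda>\<zeta>. F (of_real r * \<zeta>))) n = (if n < 0 then 0 else a (nat n) * of_real r ^ nat n)"
    unfolding 1 using sums_unique2[OF 2 3] .
qed

text \<open>Bessel's inequality on the circle of radius \<open>r\<close> bounds the sum of
  \<open>(cmod (a n * r ^ n))\<^sup>2\<close> by the Hardy bound; letting \<open>r\<close> tend to
  one makes the Taylor coefficients square summable. They are then the coefficients of an element of
  L^2, which the radial theorem identifies as the boundary function.\<close>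

lemma hardy_disc_boundary:
  assumes "f \<in> hardy_disc"
  obtains g where "\<And>n. n < 0 \<Longrightarrow> cf g n = 0"
    "\<And>z. z \<in> unit_disc \<Longrightarrow> (\<lambda>n. cf g (int n) * z ^ n) sums f z"
    "AE \<zeta> in arclength. ((\<lambda>r. f (of_real r * \<zeta>)) \<longlongrightarrow> rep_circle_L2 g \<zeta>) (at_left (1::real))"
proof -
  have hol: "f holomorphic_on unit_disc" using assms by (simp add: hardy_disc_def)
  obtain B where "\<forall>r\<in>{0..<1::real}. (\<integral>\<zeta>. (cmod (f (of_real r * \<zeta>)))\<^sup>2 \<partial>arclength) \<le> B"
    using assms unfolding hardy_disc_def by blast
  then have B: "(\<integral>\<zeta>. (cmod (f (of_real r * \<zeta>)))\<^sup>2 \<partial>arclength) \<le> B" if "0 \<le> r" "r < 1" for r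
    using that by simp
  define a where "a n = (deriv ^^ n) f 0 / fact n" for n
  have f: "(\<lambda>n. a n * z ^ n) sums f z" if "z \<in> unit_disc" for z
    using holomorphic_power_series[OF hol that] by (simp add: a_def)
  have le: "(\<Sum>n<N. (cmod (a n))\<^sup>2) \<le> B" for N
  proof -
    have "(\<Sum>n<N. (cmod (a n * of_real r ^ n))\<^sup>2) \<le> B" if r: "0 \<le> r" "r < 1" for r :: real
    proof -
      let ?F = "abs_circle_L2 (\<lambda>\<zeta>. f (of_real r * \<zeta>))"
      have "cf ?F n = (if n < 0 then 0 else a (nat n) * of_real r ^ nat n)" for n
        by (rule cf_circle_restriction(2)[OF f r])
      then have "(\<Sum>n<N. (cmod (a n * of_real r ^ n))\<^sup>2) = (\<Sum>n<N. (cmod (cf ?F (int n)))\<^sup>2)"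
        by simp
      also have "\<dots> \<le> (norm ?F)\<^sup>2" by (rule bessel_taylor)
      also have "\<dots> = (\<integral>\<zeta>. (cmod (f (of_real r * \<zeta>)))\<^sup>2 \<partial>arclength)"
        by (intro norm_abs_sq bounded_symbol_square_integrable cf_circle_restriction(1)[OF f r])
      finally show ?thesis using B[OF r] by simp
    qed
    then have ev: "\<forall>\<^sub>F r in at_left (1::real). (\<Sum>n<N. (cmod (a n * of_real r ^ n))\<^sup>2) \<le> B"
      using eventually_at_left_real[of 0 1] by (auto elim!: eventually_mono)
    have "((\<lambda>r::real. \<Sum>n<N. (cmod (a n * of_real r ^ n))\<^sup>2) \<longlongrightarrow> (\<Sum>n<N. (cmod (a n * of_real 1 ^ n))\<^sup>2)) (at_left 1)"
      by (intro tendsto_intros)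
    then have "(\<Sum>n<N. (cmod (a n * of_real 1 ^ n))\<^sup>2) \<le> B"
      by (rule tendsto_upperbound[OF _ ev]) simp
    then show ?thesis by simp
  qed
  have "summable (\<lambda>n. (cmod (a n))\<^sup>2)" by (rule summableI_nonneg_bounded[of _ B]) (auto simp: le)
  then obtain g where "taylor_sum a \<longlonglongrightarrow> g" and g: "\<And>n. cf g (int n) = a n" "\<And>n. n < 0 \<Longrightarrow> cf g n = 0"
    using riesz_fischer by blast
  have fr: "AE \<zeta> in arclength. ((\<lambda>r. \<Sum>n. cf g (int n) * (of_real r * \<zeta>) ^ n) \<longlongrightarrow> rep_circle_L2 g \<zeta>) (at_left (1::real))"
    by (rule fatou_radial) (rule g(2))
  have "AE \<zeta> in arclength. ((\<lambda>r. f (of_real r * \<zeta>)) \<longlongrightarrow> rep_circle_L2 g \<zeta>) (at_left (1::real))"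
    using fr AE_arclength_circle
  proof eventually_elim
    case (elim \<zeta>)
    have "\<forall>\<^sub>F r in at_left (1::real). (\<Sum>n. cf g (int n) * (of_real r * \<zeta>) ^ n) = f (of_real r * \<zeta>)"
      using eventually_at_left_real[of 0 1, OF zero_less_one]
    proof eventually_elim
      case (elim r)
      then show ?case using f[OF of_real_mult_circle_in_disc[OF \<open>cmod \<zeta> = 1\<close>, of r]] by (simp add: g sums_iff)
    qed
    then show ?case using elim(1) by (rule Lim_transform_eventually[rotated])
  qed
  then show thesis using that[of g] g f by auto
qed

text \<open>Bridge from the definition by radial limits to the spectral description, the form in
  which membership in \<open>H2\<close> is used from here on.\<close>

lemma H2_iff: "g \<in> H2 \<longleftrightarrow> (\<forall>n<0. cf g n = 0)"
proof
  assume "g \<in> H2"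
  then obtain f where f: "f \<in> hardy_disc"
    "AE \<zeta> in arclength. ((\<lambda>r. f (of_real r * \<zeta>)) \<longlongrightarrow> rep_circle_L2 g \<zeta>) (at_left (1::real))"
    unfolding H2_def by auto
  obtain h where h: "\<And>n. n < 0 \<Longrightarrow> cf h n = 0"
    "AE \<zeta> in arclength. ((\<lambda>r. f (of_real r * \<zeta>)) \<longlongrightarrow> rep_circle_L2 h \<zeta>) (at_left (1::real))"
    using hardy_disc_boundary[OF f(1)] by metis
  have "g = h" unfolding circle_L2_eq_iff
    using f(2) h(2) by eventually_elim (auto intro: tendsto_unique[OF trivial_limit_at_left_real])
  then show "\<forall>n<0. cf g n = 0" using h(1) by simp
next
  assume g: "\<forall>n<0. cf g n = 0"
  define F where "F z = (\<Sum>n. cf g (int n) * z ^ n)" for z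
  have F: "(\<lambda>n. cf g (int n) * z ^ n) sums F z" if z: "z \<in> unit_disc" for z
  proof -
    have "summable (\<lambda>n. cf g (int n) * z ^ n)"
    proof (rule summable_comparison_test'[of "\<lambda>n. norm g * cmod z ^ n" 0])
      show "summable (\<lambda>n. norm g * cmod z ^ n)" using z by (intro summable_mult summable_geometric) auto
      show "norm (cf g (int n) * z ^ n) \<le> norm g * cmod z ^ n" for n
        by (simp add: norm_mult norm_power mult_right_mono cmod_cf_le)
    qed
    then show ?thesis unfolding F_def by (rule summable_sums)
  qed
  have "F \<in> hardy_disc" unfolding hardy_disc_def
  proof (intro CollectI conjI exI[of _ "(norm g)\<^sup>2"] ballI)
    show "F holomorphic_on unit_disc" using F by (intro power_series_holomorphic[of 0 1 "\<lambda>n. cf g (int n)"]) auto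
    fix r :: real assume "r \<in> {0..<1}"
    then have r: "0 \<le> r" "r < 1" by auto
    let ?F = "abs_circle_L2 (\<lambda>\<zeta>. F (of_real r * \<zeta>))"
    have cfF: "cf ?F n = (if n < 0 then 0 else cf g (int (nat n)) * of_real r ^ nat n)" for n
      by (rule cf_circle_restriction(2)[OF F r])
    have "taylor_sum (\<lambda>n. cf ?F (int n)) \<longlonglongrightarrow> ?F" by (rule taylor_sum_tendsto) (simp add: cfF)
    then have lim: "(\<lambda>N. (norm (taylor_sum (\<lambda>n. cf ?F (int n)) N))\<^sup>2) \<longlonglongrightarrow> (norm ?F)\<^sup>2" by (intro tendsto_intros)
    have "(norm (taylor_sum (\<lambda>n. cf ?F (int n)) N))\<^sup>2 \<le> (norm g)\<^sup>2" for N
    proof -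
      have "(norm (taylor_sum (\<lambda>n. cf ?F (int n)) N))\<^sup>2 = (\<Sum>n<N. (cmod (cf ?F (int n)))\<^sup>2)"
        unfolding taylor_sum_def by (rule norm_sq_sum_ee) simp
      also have "\<dots> \<le> (\<Sum>n<N. (cmod (cf g (int n)))\<^sup>2)"
      proof (intro sum_mono power_mono)
        fix n
        have "cmod (cf g (int n)) * r ^ n \<le> cmod (cf g (int n)) * 1"
          using r by (intro mult_left_mono power_le_one) auto
        then show "cmod (cf ?F (int n)) \<le> cmod (cf g (int n))"
          using r by (simp add: cfF norm_mult norm_power)
      qed simp
      also have "\<dots> \<le> (norm g)\<^sup>2" by (rule bessel_taylor)
      finally show ?thesis .
    qed
    then have "(norm ?F)\<^sup>2 \<le> (norm g)\<^sup>2" by (intro LIMSEQ_le_const2[OF lim]) auto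
    then show "(\<integral>\<zeta>. (cmod (F (of_real r * \<zeta>)))\<^sup>2 \<partial>arclength) \<le> (norm g)\<^sup>2"
      by (subst norm_abs_sq[symmetric]) (auto intro!: bounded_symbol_square_integrable cf_circle_restriction(1)[OF F r])
  qed
  moreover have "AE \<zeta> in arclength. ((\<lambda>r. F (of_real r * \<zeta>)) \<longlongrightarrow> rep_circle_L2 g \<zeta>) (at_left (1::real))"
    unfolding F_def using g by (intro fatou_radial) auto
  ultimately show "g \<in> H2" unfolding H2_def by auto
qed

lemma H2_zshift: "f \<in> H2 \<Longrightarrow> 0 \<le> k \<Longrightarrow> zshift k f \<in> H2"
  by (simp add: H2_iff cf_zshift)

lemma ee_in_H2 [simp]: "0 \<le> n \<Longrightarrow> ee n \<in> H2"
  by (simp add: H2_iff cf_ee)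

lemma closed_csubspace_H2: "closed_csubspace H2"
proof -
  have "H2 = {f. \<forall>w\<in>ee ` {..<0}. cinner f w = 0}" by (auto simp: H2_iff cf_def)
  then show ?thesis using closed_csubspace_annihilator[of "ee ` {..<0}"] by (simp only:)
qed

section \<open>Boundary values of singular inner functions\<close>

lemma tendsto_imp_radial_limit:
  "((\<lambda>r. u (of_real r * \<zeta>)) \<longlongrightarrow> l) (at_left (1::real)) \<Longrightarrow> radial_limit u \<zeta> = l"
  unfolding radial_limit_def by (rule tendsto_Lim) simp

definition radius :: "nat \<Rightarrow> real" where "radius n = 1 - 1 / real (n + 2)"

lemma radius: "0 \<le> radius n" "radius n < 1" by (simp_all add: radius_def)

lemma radius_tendsto: "radius \<longlonglongrightarrow> 1"
proof -
  have "(\<lambda>n. 1 - 1 / real (n + 2)) \<longlonglongrightarrow> 1 - 0"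
    by (intro tendsto_intros LIMSEQ_ignore_initial_segment lim_1_over_n)
  then show ?thesis by (simp add: radius_def[abs_def])
qed

text \<open>The oscillation of \<open>u\<close> on radii near the circle is a supremum of continuous functions, so
  the set where the radial limit exists is Borel.\<close>

lemma radial_limit_measurable:
  assumes u: "continuous_on unit_disc u"
  shows "radial_limit u \<in> borel_measurable arclength"
proof -
  define S where "S n k = (\<Inter>p\<in>{radius n<..<1}. \<Inter>q\<in>{radius n<..<1}.
    {\<zeta>\<in>unit_circle. cmod (u (of_real p * \<zeta>) - u (of_real q * \<zeta>)) \<le> 1 / real (Suc k)})" for n k
  have cont: "continuous_on unit_circle (\<lambda>\<zeta>. u (of_real p * \<zeta>))" if "0 \<le> p" "p < 1" for p :: real
    by (rule continuous_on_compose2[OF u]) (use that in \<open>auto intro!: continuous_intros simp: norm_mult\<close>)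
  \<comment> \<open>All real radii are quantified over; an intersection of closed sets is closed
    whatever its cardinality.\<close>
  have "closed (S n k)" for n k unfolding S_def
  proof (intro closed_INT ballI)
    fix p q assume "p \<in> {radius n<..<1}" "q \<in> {radius n<..<1}"
    then have "0 \<le> p" "p < 1" "0 \<le> q" "q < 1" using radius(1)[of n] by auto
    then show "closed {\<zeta>\<in>unit_circle. cmod (u (of_real p * \<zeta>) - u (of_real q * \<zeta>)) \<le> 1 / real (Suc k)}"
      by (intro continuous_on_closed_Collect_le continuous_intros cont) auto
  qed
  then have Sb: "S n k \<in> sets borel" for n k by (rule borel_closed)
  define C where "C = (\<Inter>k. \<Union>n. S n k) \<inter> unit_circle"
  have C: "C \<in> sets arclength" unfolding C_def by (intro sets_arclength_Int sets.countable_INT sets.countable_UN) (use Sb in auto)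
  have conv: "((\<lambda>r. u (of_real r * \<zeta>)) \<longlongrightarrow> lim (\<lambda>n. u (of_real (radius n) * \<zeta>))) (at_left 1)" if "\<zeta> \<in> C" for \<zeta>
  proof -
    have osc: "\<exists>n. \<forall>p q. radius n < p \<longrightarrow> p < 1 \<longrightarrow> radius n < q \<longrightarrow> q < 1 \<longrightarrow> cmod (u (of_real p * \<zeta>) - u (of_real q * \<zeta>)) \<le> 1 / real (Suc k)" for k
      using that unfolding C_def S_def by fastforce
    have ev: "\<forall>\<^sub>F m in sequentially. radius n < radius m" for n
      using eventually_gt_at_top[of n] by eventually_elim (simp add: radius_def frac_less2)
    have small: "\<exists>k. 1 / real (Suc k) < e" if "e > 0" for e
      using nat_approx_posE[OF that] by metis
    have "Cauchy (\<lambda>n. u (of_real (radius n) * \<zeta>))"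
    proof (rule CauchyI)
      fix e :: real assume "e > 0"
      then obtain k where k: "1 / real (Suc k) < e" using small by blast
      obtain n where n: "\<And>p q. radius n < p \<Longrightarrow> p < 1 \<Longrightarrow> radius n < q \<Longrightarrow> q < 1 \<Longrightarrow> cmod (u (of_real p * \<zeta>) - u (of_real q * \<zeta>)) \<le> 1 / real (Suc k)"
        using osc by blast
      obtain M where M: "\<And>m. m \<ge> M \<Longrightarrow> radius n < radius m" using ev[of n] unfolding eventually_sequentially by blast
      show "\<exists>M. \<forall>m\<ge>M. \<forall>n\<ge>M. norm (u (of_real (radius m) * \<zeta>) - u (of_real (radius n) * \<zeta>)) < e"
        using n M radius(2) k by (meson le_less_trans)
    qed
    then have lim: "(\<lambda>n. u (of_real (radius n) * \<zeta>)) \<longlonglongrightarrow> lim (\<lambda>n. u (of_real (radius n) * \<zeta>))"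
      using Cauchy_convergent_iff convergent_LIMSEQ_iff by blast
    show ?thesis
    proof (rule tendstoI)
      fix e :: real assume "e > 0"
      then obtain k where k: "1 / real (Suc k) < e" using small by blast
      obtain n where n: "\<And>p q. radius n < p \<Longrightarrow> p < 1 \<Longrightarrow> radius n < q \<Longrightarrow> q < 1 \<Longrightarrow> cmod (u (of_real p * \<zeta>) - u (of_real q * \<zeta>)) \<le> 1 / real (Suc k)"
        using osc by blast
      have "\<forall>\<^sub>F r in at_left 1. r \<in> {radius n<..<1}" by (rule eventually_at_left_real) (simp add: radius)
      then show "\<forall>\<^sub>F r in at_left 1. dist (u (of_real r * \<zeta>)) (lim (\<lambda>n. u (of_real (radius n) * \<zeta>))) < e"
      proof eventually_elim
        case (elim r)
        have "(\<lambda>m. cmod (u (of_real r * \<zeta>) - u (of_real (radius m) * \<zeta>))) \<longlonglongrightarrow> cmod (u (of_real r * \<zeta>) - lim (\<lambda>n. u (of_real (radius n) * \<zeta>)))"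
          by (intro tendsto_intros lim)
        moreover have "\<forall>\<^sub>F m in sequentially. cmod (u (of_real r * \<zeta>) - u (of_real (radius m) * \<zeta>)) \<le> 1 / real (Suc k)"
          using ev[of n] by eventually_elim (use n elim radius(2) in auto)
        ultimately have "cmod (u (of_real r * \<zeta>) - lim (\<lambda>n. u (of_real (radius n) * \<zeta>))) \<le> 1 / real (Suc k)"
          by (rule tendsto_upperbound) simp
        then show ?case using k by (simp add: dist_norm)
      qed
    qed
  qed
  have nconv: "\<not> ((\<lambda>r. u (of_real r * \<zeta>)) \<longlongrightarrow> l) (at_left 1)" if z: "\<zeta> \<in> unit_circle" "\<zeta> \<notin> C" for \<zeta> l
  proof
    assume l: "((\<lambda>r. u (of_real r * \<zeta>)) \<longlongrightarrow> l) (at_left 1)"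
    have "\<exists>n. \<zeta> \<in> S n k" for k
    proof -
      have "\<forall>\<^sub>F r in at_left 1. dist (u (of_real r * \<zeta>)) l < 1 / real (Suc k) / 2"
        by (rule tendstoD[OF l]) simp
      then obtain b where b: "b < 1" "\<And>r. b < r \<Longrightarrow> r < 1 \<Longrightarrow> dist (u (of_real r * \<zeta>)) l < 1 / real (Suc k) / 2"
        unfolding eventually_at_left_field by blast
      have "\<forall>\<^sub>F n in sequentially. b < radius n"
        by (rule order_tendstoD(1)[OF radius_tendsto b(1)])
      then obtain n where "b < radius n" using eventually_happens' sequentially_bot by metis
      then have osc: "cmod (u (of_real p * \<zeta>) - u (of_real q * \<zeta>)) \<le> 1 / real (Suc k)"
        if "radius n < p" "p < 1" "radius n < q" "q < 1" for p q
        using dist_triangle_half_l[OF b(2)[of p], of "u (of_real q * \<zeta>)"] b(2)[of q] that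
        by (force simp: dist_norm norm_minus_commute)
      have "\<zeta> \<in> S n k" unfolding S_def
      proof (intro INT_I CollectI conjI z(1))
        fix p q assume "p \<in> {radius n<..<1}" "q \<in> {radius n<..<1}"
        then show "cmod (u (of_real p * \<zeta>) - u (of_real q * \<zeta>)) \<le> 1 / real (Suc k)" by (intro osc) auto
      qed
      then show ?thesis ..
    qed
    then show False using z by (auto simp: C_def)
  qed
  \<comment> \<open>Where no limit exists, \<open>Lim\<close> unfolds to \<open>The\<close> of the
    empty predicate, one fixed though unknown value. The function is thus measurable on the whole
    circle and not merely equal almost everywhere to a measurable one.\<close>
  have eq: "radial_limit u \<zeta> = (if \<zeta> \<in> C then lim (\<lambda>n. u (of_real (radius n) * \<zeta>)) else The (\<lambda>_. False))"
    if "\<zeta> \<in> space arclength" for \<zeta>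
  proof (cases "\<zeta> \<in> C")
    case True
    then show ?thesis using tendsto_imp_radial_limit[OF conv] by simp
  next
    case False
    then have "(\<lambda>l. ((\<lambda>r. u (of_real r * \<zeta>)) \<longlongrightarrow> l) (at_left 1)) = (\<lambda>_. False)"
      using nconv that by (auto simp: fun_eq_iff)
    then show ?thesis using False by (simp add: radial_limit_def t2_space_class.Lim_def)
  qed
  have [measurable]: "(\<lambda>\<zeta>. u (of_real (radius n) * \<zeta>)) \<in> borel_measurable arclength" for n
    by (intro measurable_continuous_circle cont radius)
  note [measurable] = C
  have "(\<lambda>\<zeta>. if \<zeta> \<in> C then lim (\<lambda>n. u (of_real (radius n) * \<zeta>)) else The (\<lambda>_. False)) \<in> borel_measurable arclength"
    by measurable
  then show ?thesis using eq by (subst measurable_cong) auto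
qed

text \<open>The bound by one puts \<open>u\<close> into the Hardy class. The coefficients of index
  \<open>0\<close> and \<open>1\<close> are singled out because the estimate for a concentrated
  singular factor depends on nothing else about it apart from its modulus on the circle.\<close>

lemma bounded_holomorphic_boundary:
  assumes hol: "u holomorphic_on unit_disc" and le: "\<And>z. z \<in> unit_disc \<Longrightarrow> cmod (u z) \<le> 1"
  shows "bounded_symbol (radial_limit u)"
    and "AE \<zeta> in arclength. cmod (radial_limit u \<zeta>) \<le> 1"
    and "AE \<zeta> in arclength. ((\<lambda>r. u (of_real r * \<zeta>)) \<longlongrightarrow> radial_limit u \<zeta>) (at_left (1::real))"
    and "abs_circle_L2 (radial_limit u) \<in> H2"
    and "cf (abs_circle_L2 (radial_limit u)) 0 = u 0"
    and "cf (abs_circle_L2 (radial_limit u)) 1 = deriv u 0"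
proof -
  have cont: "continuous_on unit_disc u" using hol by (rule holomorphic_on_imp_continuous_on)
  have "u \<in> hardy_disc" unfolding hardy_disc_def
  proof (intro CollectI conjI hol exI[of _ 1] ballI)
    fix r :: real assume r: "r \<in> {0..<1}"
    have le': "(cmod (u (of_real r * \<zeta>)))\<^sup>2 \<le> 1" if "cmod \<zeta> = 1" for \<zeta>
      using le[OF of_real_mult_circle_in_disc[OF that]] r by (simp add: power_le_one)
    have c: "continuous_on unit_circle (\<lambda>\<zeta>. u (of_real r * \<zeta>))"
      by (rule continuous_on_compose2[OF cont]) (use r in \<open>auto intro!: continuous_intros simp: norm_mult\<close>)
    have "(\<integral>\<zeta>. (cmod (u (of_real r * \<zeta>)))\<^sup>2 \<partial>arclength) \<le> (\<integral>\<zeta>. 1 \<partial>arclength)"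
      using bounded_symbol_square_integrable[OF bounded_symbol_continuous[OF c]] le'
      by (intro integral_mono_AE) (auto simp: square_integrable_def intro: AE_arclengthI)
    then show "(\<integral>\<zeta>. (cmod (u (of_real r * \<zeta>)))\<^sup>2 \<partial>arclength) \<le> 1" by simp
  qed
  then obtain g where g: "\<And>n. n < 0 \<Longrightarrow> cf g n = 0"
    "\<And>z. z \<in> unit_disc \<Longrightarrow> (\<lambda>n. cf g (int n) * z ^ n) sums u z"
    "AE \<zeta> in arclength. ((\<lambda>r. u (of_real r * \<zeta>)) \<longlongrightarrow> rep_circle_L2 g \<zeta>) (at_left (1::real))"
    using hardy_disc_boundary by blast
  have rl: "AE \<zeta> in arclength. radial_limit u \<zeta> = rep_circle_L2 g \<zeta>"
    using g(3) by eventually_elim (rule tendsto_imp_radial_limit)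
  show t: "AE \<zeta> in arclength. ((\<lambda>r. u (of_real r * \<zeta>)) \<longlongrightarrow> radial_limit u \<zeta>) (at_left (1::real))"
    using g(3) rl by eventually_elim simp
  show b: "AE \<zeta> in arclength. cmod (radial_limit u \<zeta>) \<le> 1"
    using t AE_arclength_circle
  proof eventually_elim
    case (elim \<zeta>)
    have "\<forall>\<^sub>F r in at_left (1::real). cmod (u (of_real r * \<zeta>)) \<le> 1"
      using eventually_at_left_real[of 0 1, OF zero_less_one]
      by eventually_elim (use elim(2) in \<open>auto intro!: le simp: norm_mult\<close>)
    with tendsto_norm[OF elim(1)] show ?case by (rule tendsto_upperbound) simp
  qed
  show bs: "bounded_symbol (radial_limit u)"
    using b radial_limit_measurable[OF cont] by (auto simp: bounded_symbol_def)
  have eq: "abs_circle_L2 (radial_limit u) = g"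
    using abs_circle_L2_eqI[OF bounded_symbol_square_integrable[OF bs] square_integrable_rep rl] by simp
  show "abs_circle_L2 (radial_limit u) \<in> H2" using g(1) by (simp add: eq H2_iff)
  show "cf (abs_circle_L2 (radial_limit u)) 0 = u 0"
    using sums_unique2[OF g(2)[of 0] powser_sums_zero[of "\<lambda>n. cf g (int n)"]] by (simp add: eq)
  have "(u has_field_derivative diffs (\<lambda>n. cf g (int n)) 0) (at 0)"
  proof -
    have "((\<lambda>z. \<Sum>n. cf g (int n) * z ^ n) has_field_derivative (\<Sum>n. diffs (\<lambda>n. cf g (int n)) n * 0 ^ n)) (at 0)"
      by (rule termdiffs_strong'[of 1]) (use g(2) in \<open>auto simp: sums_iff\<close>)
    also have "(\<Sum>n. diffs (\<lambda>n. cf g (int n)) n * 0 ^ n) = diffs (\<lambda>n. cf g (int n)) 0" by simp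
    finally show ?thesis
      by (rule DERIV_cong_ev[THEN iffD1, rotated 3])
        (use g(2) in \<open>auto simp: sums_iff intro!: eventually_nhds_in_open[of "unit_disc", THEN eventually_mono]\<close>)
  qed
  then show "cf (abs_circle_L2 (radial_limit u)) 1 = deriv u 0"
    by (simp add: eq diffs_def DERIV_imp_deriv)
qed

section \<open>Herglotz transforms of measures on the circle\<close>

definition herglotz :: "complex measure \<Rightarrow> complex \<Rightarrow> complex"
  where "herglotz M z = (\<integral>\<zeta>. (\<zeta> + z) / (\<zeta> - z) \<partial>M)"

lemma singular_inner_herglotz: "singular_inner M z = exp (- herglotz M z)"
  by (simp add: singular_inner_def herglotz_def)

definition circle_measure :: "complex measure \<Rightarrow> bool"
  where "circle_measure M \<longleftrightarrow> sets M = sets borel_circle \<and> finite_measure M"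

lemma space_circle_measure: "circle_measure M \<Longrightarrow> space M = unit_circle"
  using sets_eq_imp_space_eq[of M borel_circle] by (simp add: circle_measure_def space_restrict_space)

lemma measurable_circle_measureI:
  "circle_measure M \<Longrightarrow> f \<in> borel_measurable borel \<Longrightarrow> f \<in> borel_measurable M"
  by (simp cong: measurable_cong_sets add: measurable_restrict_space1 circle_measure_def)

lemma herglotz_kernel_bound:
  assumes "cmod \<zeta> = 1" "cmod z < 1"
  shows "cmod ((\<zeta> + z) / (\<zeta> - z)) \<le> 2 / (1 - cmod z)"
  unfolding norm_divide
proof (rule frac_le)
  show "cmod (\<zeta> + z) \<le> 2" using norm_triangle_ineq[of \<zeta> z] assms by simp
  show "1 - cmod z \<le> cmod (\<zeta> - z)" using norm_triangle_ineq2[of \<zeta> z] assms by simp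
qed (use assms in auto)

lemma Re_herglotz_kernel:
  assumes "cmod \<zeta> = 1" "cmod z < 1"
  shows "Re ((\<zeta> + z) / (\<zeta> - z)) = (1 - (cmod z)\<^sup>2) / (cmod (\<zeta> - z))\<^sup>2"
proof -
  have "Re ((\<zeta> + z) * cnj (\<zeta> - z)) = (cmod \<zeta>)\<^sup>2 - (cmod z)\<^sup>2"
    unfolding cmod_power2 by (simp add: power2_eq_square algebra_simps)
  then show ?thesis using assms
    by (simp add: complex_div_cnj[of "\<zeta> + z"] flip: of_real_power)
qed

lemma integrable_herglotz_kernel:
  assumes M: "circle_measure M" and z: "cmod z < 1"
  shows "integrable M (\<lambda>\<zeta>. (\<zeta> + z) / (\<zeta> - z))"
proof -
  interpret finite_measure M using M by (simp add: circle_measure_def)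
  show ?thesis
  proof (rule integrable_const_bound[where B = "2 / (1 - cmod z)"])
    show "AE \<zeta> in M. norm ((\<zeta> + z) / (\<zeta> - z)) \<le> 2 / (1 - cmod z)"
      using herglotz_kernel_bound z by (intro AE_I2) (simp add: space_circle_measure[OF M])
    show "(\<lambda>\<zeta>. (\<zeta> + z) / (\<zeta> - z)) \<in> borel_measurable M"
      by (rule measurable_circle_measureI[OF M]) measurable
  qed
qed

text \<open>With \<open>x = z * cnj \<zeta>\<close> the kernel is
  \<open>(1 + x) / (1 - x) = 1 + 2 x + 2 x^2 + ...\<close>, integrated term by term. The series
  yields holomorphy, the value at the origin and the derivative there.\<close>

lemma herglotz_sums:
  assumes M: "circle_measure M" and z: "cmod z < 1"
  shows "(\<lambda>n. (if n = 0 then 1 else 2) * (\<integral>\<zeta>. cnj \<zeta> ^ n \<partial>M) * z ^ n) sums herglotz M z"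
proof -
  interpret finite_measure M using M by (simp add: circle_measure_def)
  define t where "t n \<zeta> = (if n = 0 then 1 else 2) * cnj \<zeta> ^ n * z ^ n" for n :: nat and \<zeta>
  have nt: "cmod (t n \<zeta>) \<le> 2 * cmod z ^ n" if "cmod \<zeta> = 1" for n \<zeta>
    using that by (simp add: t_def norm_mult norm_power)
  have ti: "integrable M (t n)" for n
  proof (rule integrable_const_bound[where B = "2 * cmod z ^ n"])
    show "AE \<zeta> in M. norm (t n \<zeta>) \<le> 2 * cmod z ^ n" using nt by (intro AE_I2) (simp add: space_circle_measure[OF M])
    show "t n \<in> borel_measurable M" unfolding t_def[abs_def] by (rule measurable_circle_measureI[OF M]) measurable
  qed
  have sm: "summable (\<lambda>n. 2 * cmod z ^ n)" using z by (intro summable_mult summable_geometric) auto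
  have "(\<lambda>n. \<integral>\<zeta>. t n \<zeta> \<partial>M) sums (\<integral>\<zeta>. (\<Sum>n. t n \<zeta>) \<partial>M)"
  proof (rule sums_integral[OF ti])
    show "AE \<zeta> in M. summable (\<lambda>n. norm (t n \<zeta>))"
      using nt by (intro AE_I2 summable_comparison_test'[OF sm, of 0]) (simp add: space_circle_measure[OF M])
    show "summable (\<lambda>n. \<integral>\<zeta>. norm (t n \<zeta>) \<partial>M)"
    proof (rule summable_comparison_test'[OF summable_mult[OF sm, of "measure M (space M)"], of 0])
      fix n
      have "(\<integral>\<zeta>. norm (t n \<zeta>) \<partial>M) \<le> (\<integral>\<zeta>. 2 * cmod z ^ n \<partial>M)"
        using nt by (intro integral_mono_AE integrable_norm ti AE_I2) (auto simp: space_circle_measure[OF M])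
      then show "norm (\<integral>\<zeta>. norm (t n \<zeta>) \<partial>M) \<le> measure M (space M) * (2 * cmod z ^ n)" by simp
    qed
  qed
  also have "(\<integral>\<zeta>. (\<Sum>n. t n \<zeta>) \<partial>M) = herglotz M z"
    unfolding herglotz_def
  proof (rule Bochner_Integration.integral_cong)
    fix \<zeta> assume "\<zeta> \<in> space M"
    then have e: "cmod \<zeta> = 1" by (simp add: space_circle_measure[OF M])
    define x where "x = z * cnj \<zeta>"
    have x: "cmod x < 1" using e z by (simp add: x_def norm_mult)
    then have "x \<noteq> 1" by auto
    \<comment> \<open>Twice the geometric series counts the constant term once too often.\<close>
    have "(\<lambda>n. 2 * x ^ n - (if n = 0 then 1 else 0)) sums (2 * (1 / (1 - x)) - 1)"
      using sums_single[of 0 "\<lambda>_. 1::complex"] x by (intro sums_diff sums_mult geometric_sums) auto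
    moreover have "2 * x ^ n - (if n = 0 then 1 else 0) = t n \<zeta>" for n
      by (simp add: t_def x_def power_mult_distrib)
    moreover have "2 * (1 / (1 - x)) - 1 = (\<zeta> + z) / (\<zeta> - z)"
    proof -
      have "\<zeta> * x = z" using mult_cnj_self(1)[of \<zeta>] e by (simp add: x_def mult.left_commute)
      then have "(\<zeta> + z) / (\<zeta> - z) = (\<zeta> * (1 + x)) / (\<zeta> * (1 - x))" by (simp add: algebra_simps)
      also have "\<dots> = (1 + x) / (1 - x)" using e by auto
      finally show ?thesis using \<open>x \<noteq> 1\<close> by (simp add: field_simps)
    qed
    ultimately show "(\<Sum>n. t n \<zeta>) = (\<zeta> + z) / (\<zeta> - z)" by (simp add: sums_iff)
  qed simp
  finally show ?thesis by (simp add: t_def[abs_def] mult_ac)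
qed

lemma herglotz_holomorphic: "circle_measure M \<Longrightarrow> herglotz M holomorphic_on unit_disc"
  by (intro power_series_holomorphic[of 0 1 "\<lambda>n. (if n = 0 then 1 else 2) * (\<integral>\<zeta>. cnj \<zeta> ^ n \<partial>M)"])
    (use herglotz_sums in auto)

lemma herglotz_0:
  assumes "circle_measure M" shows "herglotz M 0 = of_real (measure M (space M))"
proof -
  interpret finite_measure M using assms by (simp add: circle_measure_def)
  show ?thesis
    using sums_unique2[OF herglotz_sums[OF assms, of 0] powser_sums_zero] by (simp add: scaleR_conv_of_real)
qed

lemma deriv_herglotz_0:
  assumes "circle_measure M"
  shows "(herglotz M has_field_derivative 2 * (\<integral>\<zeta>. cnj \<zeta> \<partial>M)) (at 0)"
proof -
  let ?c = "\<lambda>n::nat. (if n = 0 then 1 else 2) * (\<integral>\<zeta>. cnj \<zeta> ^ n \<partial>M)"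
  have "((\<lambda>z. \<Sum>n. ?c n * z ^ n) has_field_derivative (\<Sum>n. diffs ?c n * 0 ^ n)) (at 0)"
    by (rule termdiffs_strong'[of 1]) (use herglotz_sums[OF assms] in \<open>auto simp: sums_iff\<close>)
  then have "(herglotz M has_field_derivative (\<Sum>n. diffs ?c n * 0 ^ n)) (at 0)"
    by (rule DERIV_cong_ev[THEN iffD1, rotated 3])
      (use herglotz_sums[OF assms] in \<open>auto simp: sums_iff intro!: eventually_nhds_in_open[of "unit_disc", THEN eventually_mono]\<close>)
  then show ?thesis by (simp add: diffs_def)
qed

lemma Re_herglotz:
  assumes "circle_measure M" "cmod z < 1"
  shows "Re (herglotz M z) = (\<integral>\<zeta>. (1 - (cmod z)\<^sup>2) / (cmod (\<zeta> - z))\<^sup>2 \<partial>M)"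
proof -
  have "Re (herglotz M z) = (\<integral>\<zeta>. Re ((\<zeta> + z) / (\<zeta> - z)) \<partial>M)"
    unfolding herglotz_def by (rule integral_Re[symmetric, OF integrable_herglotz_kernel[OF assms]])
  also have "\<dots> = (\<integral>\<zeta>. (1 - (cmod z)\<^sup>2) / (cmod (\<zeta> - z))\<^sup>2 \<partial>M)"
    by (intro Bochner_Integration.integral_cong refl Re_herglotz_kernel) (use assms in \<open>simp_all add: space_circle_measure\<close>)
  finally show ?thesis .
qed

lemma cmod_singular_inner: "cmod (singular_inner M z) = exp (- Re (herglotz M z))"
  by (simp add: singular_inner_herglotz)

lemma cmod_singular_inner_le_1:
  assumes "circle_measure M" "z \<in> unit_disc" shows "cmod (singular_inner M z) \<le> 1"
proof -
  have "cmod z < 1" using assms by simp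
  moreover have "(cmod z)\<^sup>2 \<le> 1" using \<open>cmod z < 1\<close> by (simp add: power_le_one)
  ultimately have "0 \<le> Re (herglotz M z)" using Re_herglotz[OF assms(1)] by simp
  then show ?thesis by (simp add: cmod_singular_inner)
qed

lemma singular_inner_holomorphic: "circle_measure M \<Longrightarrow> singular_inner M holomorphic_on unit_disc"
  unfolding singular_inner_herglotz[abs_def] by (intro holomorphic_intros herglotz_holomorphic)

lemma singular_inner_0: "circle_measure M \<Longrightarrow> singular_inner M 0 = of_real (exp (- measure M (space M)))"
  by (simp add: singular_inner_herglotz herglotz_0 exp_of_real flip: of_real_minus)

lemma deriv_singular_inner_0:
  assumes "circle_measure M"
  shows "deriv (singular_inner M) 0 = - 2 * (\<integral>\<zeta>. cnj \<zeta> \<partial>M) * of_real (exp (- measure M (space M)))"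
proof -
  have "((\<lambda>z. exp (- herglotz M z)) has_field_derivative exp (- herglotz M 0) * - (2 * (\<integral>\<zeta>. cnj \<zeta> \<partial>M))) (at 0)"
    by (intro DERIV_fun_exp DERIV_minus deriv_herglotz_0[OF assms])
  then have "deriv (singular_inner M) 0 = singular_inner M 0 * - (2 * (\<integral>\<zeta>. cnj \<zeta> \<partial>M))"
    unfolding singular_inner_herglotz[abs_def] by (rule DERIV_imp_deriv)
  then show ?thesis by (simp add: singular_inner_0[OF assms])
qed

text \<open>Minorants are given by densities and not by restriction to sets, since an atom has to be
  divisible for a prescribed small mass to be available.\<close>

definition submeasure :: "complex measure \<Rightarrow> (complex \<Rightarrow> real) \<Rightarrow> complex measure"
  where "submeasure M \<theta> = density M (\<lambda>\<zeta>. ennreal (\<theta> \<zeta>))"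

definition weight :: "(complex \<Rightarrow> real) \<Rightarrow> bool"
  where "weight \<theta> \<longleftrightarrow> \<theta> \<in> borel_measurable borel \<and> (\<forall>\<zeta>. 0 \<le> \<theta> \<zeta> \<and> \<theta> \<zeta> \<le> 1)"

lemma submeasure_le:
  assumes M: "circle_measure M" and th: "weight \<theta>" and A: "A \<in> sets M"
  shows "emeasure (submeasure M \<theta>) A \<le> emeasure M A"
proof -
  have [measurable]: "\<theta> \<in> borel_measurable M"
    by (rule measurable_circle_measureI[OF M]) (use th in \<open>simp add: weight_def\<close>)
  have "emeasure (submeasure M \<theta>) A = (\<integral>\<^sup>+\<zeta>. ennreal (\<theta> \<zeta>) * indicator A \<zeta> \<partial>M)"
    unfolding submeasure_def using A by (intro emeasure_density) auto
  also have "\<dots> \<le> (\<integral>\<^sup>+\<zeta>. indicator A \<zeta> \<partial>M)"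
    using th by (intro nn_integral_mono) (auto simp: weight_def indicator_def)
  finally show ?thesis using A by simp
qed

lemma sets_submeasure [simp]: "sets (submeasure M \<theta>) = sets M" by (simp add: submeasure_def)

lemma space_submeasure [simp]: "space (submeasure M \<theta>) = space M" by (simp add: submeasure_def)

lemma circle_measure_submeasure:
  assumes "circle_measure M" "weight \<theta>" shows "circle_measure (submeasure M \<theta>)"
proof -
  interpret finite_measure M using assms by (simp add: circle_measure_def)
  have "finite_measure (submeasure M \<theta>)"
    using submeasure_le[OF assms, of "space M"] emeasure_finite
    by (intro finite_measureI) (auto simp: top_unique)
  then show ?thesis using assms by (simp add: circle_measure_def)
qed

lemma integral_submeasure:
  fixes f :: "complex \<Rightarrow> 'b :: {banach, second_countable_topology}"
  assumes M: "circle_measure M" and w: "weight \<theta>" and f: "f \<in> borel_measurable M"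
  shows "(\<integral>\<zeta>. f \<zeta> \<partial>submeasure M \<theta>) = (\<integral>\<zeta>. \<theta> \<zeta> *\<^sub>R f \<zeta> \<partial>M)"
  unfolding submeasure_def
proof (rule integral_density[OF f])
  show "\<theta> \<in> borel_measurable M"
    by (rule measurable_circle_measureI[OF M]) (use w in \<open>simp add: weight_def\<close>)
qed (use w in \<open>simp add: weight_def\<close>)

lemma mutually_singular_submeasure:
  assumes "circle_measure M" "weight \<theta>" "mutually_singular M arclength"
  shows "mutually_singular (submeasure M \<theta>) arclength"
proof -
  obtain E where E: "E \<in> sets M \<inter> sets arclength" "emeasure M E = 0" "emeasure arclength (space arclength - E) = 0"
    using assms(3) unfolding mutually_singular_def by blast
  then have "emeasure (submeasure M \<theta>) E = 0" using submeasure_le[OF assms(1,2), of E] by simp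
  then show ?thesis using E unfolding mutually_singular_def by auto
qed

lemma singular_inner_submeasure_add:
  assumes M: "circle_measure M" and w: "weight \<theta>" "weight \<theta>'" "weight (\<lambda>\<zeta>. \<theta> \<zeta> + \<theta>' \<zeta>)" and z: "z \<in> unit_disc"
  shows "singular_inner (submeasure M (\<lambda>\<zeta>. \<theta> \<zeta> + \<theta>' \<zeta>)) z =
    singular_inner (submeasure M \<theta>) z * singular_inner (submeasure M \<theta>') z"
proof -
  let ?k = "\<lambda>\<zeta>. (\<zeta> + z) / (\<zeta> - z)"
  have km: "?k \<in> borel_measurable M" by (rule measurable_circle_measureI[OF M]) measurable
  have i: "integrable M (\<lambda>\<zeta>. \<theta> \<zeta> *\<^sub>R ?k \<zeta>)" if "weight \<theta>" for \<theta>
  proof (rule Bochner_Integration.integrable_bound[OF integrable_herglotz_kernel[OF M]])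
    show "(\<lambda>\<zeta>. \<theta> \<zeta> *\<^sub>R ?k \<zeta>) \<in> borel_measurable M"
      using that by (intro borel_measurable_scaleR km measurable_circle_measureI[OF M]) (simp add: weight_def)
    show "AE \<zeta> in M. norm (\<theta> \<zeta> *\<^sub>R ?k \<zeta>) \<le> norm (?k \<zeta>)"
      using that by (intro AE_I2) (simp add: weight_def mult_left_le_one_le)
  qed (use z in simp)
  have "herglotz (submeasure M (\<lambda>\<zeta>. \<theta> \<zeta> + \<theta>' \<zeta>)) z = herglotz (submeasure M \<theta>) z + herglotz (submeasure M \<theta>') z"
    unfolding herglotz_def integral_submeasure[OF M w(1) km] integral_submeasure[OF M w(2) km] integral_submeasure[OF M w(3) km]
    by (simp add: scaleR_add_left Bochner_Integration.integral_add[OF i[OF w(1)] i[OF w(2)]])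
  then show ?thesis by (simp add: singular_inner_herglotz flip: exp_add)
qed

section \<open>Unimodularity of the boundary values of singular inner functions\<close>

lemma radial_limit_mult:
  assumes "AE \<zeta> in arclength. ((\<lambda>r. f (of_real r * \<zeta>)) \<longlongrightarrow> radial_limit f \<zeta>) (at_left (1::real))"
    "AE \<zeta> in arclength. ((\<lambda>r. g (of_real r * \<zeta>)) \<longlongrightarrow> radial_limit g \<zeta>) (at_left (1::real))"
    and fg: "\<And>z. z \<in> unit_disc \<Longrightarrow> h z = f z * g z"
  shows "AE \<zeta> in arclength. radial_limit h \<zeta> = radial_limit f \<zeta> * radial_limit g \<zeta>"
  using assms(1,2) AE_arclength_circle
proof eventually_elim
  case (elim \<zeta>)
  have "\<forall>\<^sub>F r in at_left (1::real). f (of_real r * \<zeta>) * g (of_real r * \<zeta>) = h (of_real r * \<zeta>)"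
    using eventually_at_left_real[of 0 1, OF zero_less_one]
    by eventually_elim (use elim(3) in \<open>simp add: fg norm_mult\<close>)
  with tendsto_mult[OF elim(1,2)] show ?case
    by (intro tendsto_imp_radial_limit) (rule Lim_transform_eventually)
qed

lemma singular_inner_boundary:
  assumes M: "circle_measure M"
  defines "u \<equiv> singular_inner M"
  shows "bounded_symbol (radial_limit u)"
    and "AE \<zeta> in arclength. cmod (radial_limit u \<zeta>) \<le> 1"
    and "AE \<zeta> in arclength. ((\<lambda>r. u (of_real r * \<zeta>)) \<longlongrightarrow> radial_limit u \<zeta>) (at_left (1::real))"
    and "abs_circle_L2 (radial_limit u) \<in> H2"
    and "cf (abs_circle_L2 (radial_limit u)) 0 = u 0"
    and "cf (abs_circle_L2 (radial_limit u)) 1 = deriv u 0"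
  unfolding u_def
  by (rule bounded_holomorphic_boundary[OF singular_inner_holomorphic[OF M] cmod_singular_inner_le_1[OF M]]; assumption)+

lemma singular_inner_decomp:
  assumes M: "circle_measure M" and A: "A \<in> sets borel" and z: "z \<in> unit_disc"
  shows "singular_inner M z = singular_inner (submeasure M (indicator A)) z * singular_inner (submeasure M (indicator (- A))) z"
proof -
  have e: "(\<lambda>\<zeta>. indicator A \<zeta> + indicator (- A) \<zeta> :: real) = (\<lambda>_. 1)"
    by (auto simp: fun_eq_iff indicator_def)
  have w: "weight (indicator A)" "weight (indicator (- A))" using A by (auto simp: weight_def borel_comp)
  have one: "weight (\<lambda>\<zeta>. indicator A \<zeta> + indicator (- A) \<zeta>)" unfolding e by (simp add: weight_def)
  have "submeasure M (\<lambda>\<zeta>. indicator A \<zeta> + indicator (- A) \<zeta>) = M"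
    unfolding e by (simp add: submeasure_def density_1)
  then show ?thesis using singular_inner_submeasure_add[OF M w one z] by simp
qed

lemma emeasure_submeasure_indicator:
  assumes M: "circle_measure M" and A: "A \<in> sets borel"
  shows "emeasure (submeasure M (indicator A)) (space M) = emeasure M (A \<inter> unit_circle)"
proof -
  have AM: "A \<inter> unit_circle \<in> sets M" using sets_arclength_Int[OF A] M by (simp add: circle_measure_def)
  have "emeasure (submeasure M (indicator A)) (space M) = (\<integral>\<^sup>+\<zeta>. ennreal (indicator A \<zeta>) * indicator (space M) \<zeta> \<partial>M)"
    unfolding submeasure_def
  proof (rule emeasure_density)
    have [measurable]: "indicator A \<in> borel_measurable M"
      by (rule measurable_circle_measureI[OF M]) (use A in simp)
    show "(\<lambda>\<zeta>. ennreal (indicator A \<zeta>)) \<in> borel_measurable M" by measurable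
  qed simp
  also have "\<dots> = (\<integral>\<^sup>+\<zeta>. indicator (A \<inter> unit_circle) \<zeta> \<partial>M)"
    by (intro nn_integral_cong) (auto simp: indicator_def space_circle_measure[OF M])
  finally show ?thesis using AM by simp
qed

text \<open>If the mass keeps distance \<open>d\<close> from \<zeta>, then it keeps distance
  \<open>d / 2\<close> from every point of the radius to \<zeta>, because that point is no closer to
  \<eta> than to \<zeta>. The kernel is then at most \<open>(1 - r\<^sup>2) * 4 / d\<^sup>2\<close>,
  which vanishes at the boundary.\<close>

lemma Re_herglotz_away_from_support:
  assumes M: "circle_measure M" and A: "A \<in> sets borel" and d: "0 < d"
    and dist: "\<And>\<eta>. cmod \<eta> = 1 \<Longrightarrow> \<eta> \<in> A \<Longrightarrow> d \<le> cmod (\<eta> - \<zeta>)"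
    and z: "cmod \<zeta> = 1" and r: "0 \<le> r" "r < 1"
  shows "Re (herglotz (submeasure M (indicator A)) (of_real r * \<zeta>)) \<le> (1 - r\<^sup>2) * (4 / d\<^sup>2 * measure M (space M))"
    "0 \<le> Re (herglotz (submeasure M (indicator A)) (of_real r * \<zeta>))"
proof -
  interpret finite_measure M using M by (simp add: circle_measure_def)
  have w: "weight (indicator A)" using A by (auto simp: weight_def)
  define k where "k \<eta> = (1 - r\<^sup>2) / (cmod (\<eta> - of_real r * \<zeta>))\<^sup>2" for \<eta>
  have rz: "cmod (of_real r * \<zeta>) = r" using z r by (simp add: norm_mult)
  have r2: "0 \<le> 1 - r\<^sup>2" using r by (simp add: power_le_one)
  have km: "k \<in> borel_measurable M" unfolding k_def[abs_def] by (rule measurable_circle_measureI[OF M]) measurable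
  have "Re (herglotz (submeasure M (indicator A)) (of_real r * \<zeta>)) = (\<integral>\<eta>. k \<eta> \<partial>submeasure M (indicator A))"
    unfolding k_def by (subst Re_herglotz[OF circle_measure_submeasure[OF M w]]) (use rz r in auto)
  also have "\<dots> = (\<integral>\<eta>. indicator A \<eta> *\<^sub>R k \<eta> \<partial>M)" by (rule integral_submeasure[OF M w km])
  finally have eq: "Re (herglotz (submeasure M (indicator A)) (of_real r * \<zeta>)) = (\<integral>\<eta>. indicator A \<eta> *\<^sub>R k \<eta> \<partial>M)" .
  have k0: "0 \<le> k \<eta>" for \<eta> using r2 by (simp add: k_def)
  then show "0 \<le> Re (herglotz (submeasure M (indicator A)) (of_real r * \<zeta>))" unfolding eq by simp
  have kle: "indicator A \<eta> *\<^sub>R k \<eta> \<le> (1 - r\<^sup>2) * (4 / d\<^sup>2)" if e: "cmod \<eta> = 1" for \<eta>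
  proof (cases "\<eta> \<in> A")
    case True
    have "cmod (\<eta> - \<zeta>) \<le> cmod (\<eta> - of_real r * \<zeta>) + cmod (of_real r * \<zeta> - \<zeta>)"
      using norm_triangle_ineq[of "\<eta> - of_real r * \<zeta>" "of_real r * \<zeta> - \<zeta>"] by simp
    moreover have "of_real r * \<zeta> - \<zeta> = of_real (r - 1) * \<zeta>" by (simp add: algebra_simps)
    moreover have "cmod (of_real (r - 1) * \<zeta>) = 1 - r" using z r by (simp add: norm_mult del: of_real_diff)
    moreover have "1 - r \<le> cmod (\<eta> - of_real r * \<zeta>)" using norm_triangle_ineq2[of \<eta> "of_real r * \<zeta>"] e rz by simp
    ultimately have "d / 2 \<le> cmod (\<eta> - of_real r * \<zeta>)" using dist[OF e True] by simp
    then have "k \<eta> \<le> (1 - r\<^sup>2) / (d / 2)\<^sup>2"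
      unfolding k_def using r2 d by (intro divide_left_mono power_mono mult_pos_pos) (auto intro: order_less_le_trans[of 0 "d/2"])
    then show ?thesis using True by (simp add: power_divide)
  qed (use r2 d in simp)
  have "(\<integral>\<eta>. indicator A \<eta> *\<^sub>R k \<eta> \<partial>M) \<le> (\<integral>\<eta>. (1 - r\<^sup>2) * (4 / d\<^sup>2) \<partial>M)"
  proof (rule integral_mono_AE)
    show "integrable M (\<lambda>\<eta>. indicator A \<eta> *\<^sub>R k \<eta>)"
    proof (rule integrable_const_bound[where B = "(1 - r\<^sup>2) * (4 / d\<^sup>2)"])
      show "AE \<eta> in M. norm (indicator A \<eta> *\<^sub>R k \<eta>) \<le> (1 - r\<^sup>2) * (4 / d\<^sup>2)"
        using kle k0 by (intro AE_I2) (simp add: space_circle_measure[OF M])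
      show "(\<lambda>\<eta>. indicator A \<eta> *\<^sub>R k \<eta>) \<in> borel_measurable M"
        using A by (intro borel_measurable_scaleR km measurable_circle_measureI[OF M]) auto
    qed
    show "AE \<eta> in M. indicator A \<eta> *\<^sub>R k \<eta> \<le> (1 - r\<^sup>2) * (4 / d\<^sup>2)"
      using kle by (intro AE_I2) (simp add: space_circle_measure[OF M])
  qed simp
  then show "Re (herglotz (submeasure M (indicator A)) (of_real r * \<zeta>)) \<le> (1 - r\<^sup>2) * (4 / d\<^sup>2 * measure M (space M))"
  proof -
    have "(\<integral>\<eta>. c \<partial>M) = measure M (space M) * c" for c :: real by simp
    then have "(1 - r\<^sup>2) * (4 / d\<^sup>2 * measure M (space M)) = (\<integral>\<eta>. (1 - r\<^sup>2) * (4 / d\<^sup>2) \<partial>M)"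
      by (simp only: mult_ac)
    then show ?thesis using \<open>(\<integral>\<eta>. indicator A \<eta> *\<^sub>R k \<eta> \<partial>M) \<le> _\<close> unfolding eq by (simp only:)
  qed
qed

text \<open>Splitting off the mass near the null set \<open>K\<close> changes the modulus of the boundary values on \<open>K\<close>
  by nothing, while the remaining factor has mean value close to \<open>1\<close>.\<close>

lemma singular_inner_modulus_on_null_compact:
  assumes M: "circle_measure M" and K: "compact K" "K \<subseteq> unit_circle" "emeasure M K = 0"
  shows "AE \<zeta> in arclength. \<zeta> \<in> K \<longrightarrow> cmod (radial_limit (singular_inner M) \<zeta>) = 1"
proof (cases "K = {}")
  case False
  interpret finite_measure M using M by (simp add: circle_measure_def)
  define u where "u = singular_inner M"
  define U where "U j = {\<zeta>. infdist \<zeta> K < 1 / real (Suc j)}" for j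
  have "open (U j)" for j unfolding U_def by (intro open_Collect_less continuous_intros)
  then have Ub: "U j \<in> sets borel" for j by (rule borel_open)
  have Um: "U j \<inter> unit_circle \<in> sets M" for j using sets_arclength_Int[OF Ub] M by (simp add: circle_measure_def)
  have Kc: "closed K" using K(1) by (rule compact_imp_closed)
  have "(\<lambda>j. measure M (U j \<inter> unit_circle)) \<longlonglongrightarrow> measure M (\<Inter>j. U j \<inter> unit_circle)"
  proof (rule finite_Lim_measure_decseq)
    show "decseq (\<lambda>j. U j \<inter> unit_circle)"
    proof (rule decseq_SucI)
      fix j
      have "1 / real (Suc (Suc j)) \<le> 1 / real (Suc j)" by (simp add: frac_le)
      then show "U (Suc j) \<inter> unit_circle \<subseteq> U j \<inter> unit_circle" unfolding U_def by (auto simp del: of_nat_Suc)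
    qed
  qed (use Um in auto)
  also have "(\<Inter>j. U j \<inter> unit_circle) = K"
  proof
    show "(\<Inter>j. U j \<inter> unit_circle) \<subseteq> K"
    proof
      fix \<zeta> assume z: "\<zeta> \<in> (\<Inter>j. U j \<inter> unit_circle)"
      have "infdist \<zeta> K \<le> 0"
      proof (rule ccontr)
        assume "\<not> infdist \<zeta> K \<le> 0"
        then obtain j where "1 / real (Suc j) < infdist \<zeta> K" using nat_approx_posE[of "infdist \<zeta> K"] by auto
        moreover have "infdist \<zeta> K < 1 / real (Suc j)" using z by (simp add: U_def del: of_nat_Suc)
        ultimately show False by simp
      qed
      then show "\<zeta> \<in> K" using in_closed_iff_infdist_zero[OF Kc False] infdist_nonneg[of \<zeta> K] by simp
    qed
    show "K \<subseteq> (\<Inter>j. U j \<inter> unit_circle)" using K(2) by (auto simp: U_def)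
  qed
  finally have mlim: "(\<lambda>j. measure M (U j \<inter> unit_circle)) \<longlonglongrightarrow> 0" using K(3) by (simp add: measure_def)
  note bu = singular_inner_boundary[OF M, folded u_def]
  have Km: "K \<in> sets arclength" using sets_arclength_Int[of K] Kc K(2) by (simp add: Int_absorb2 borel_closed)
  \<comment> \<open>The integrated defect of the modulus on \<open>K\<close>. It is bounded by the
    mass of every \<open>U j\<close>, and these masses tend to the mass of \<open>K\<close>, which
    is zero.\<close>
  define I where "I = (\<integral>\<zeta>. indicator K \<zeta> * (1 - cmod (radial_limit u \<zeta>)) \<partial>arclength)"
  have um: "radial_limit u \<in> borel_measurable arclength" using bu(1) by (simp add: bounded_symbol_def)
  have im: "(\<lambda>\<zeta>. indicator K \<zeta> * (1 - cmod (radial_limit u \<zeta>))) \<in> borel_measurable arclength"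
    using um Km by measurable
  have ii: "integrable arclength (\<lambda>\<zeta>. indicator K \<zeta> * (1 - cmod (radial_limit u \<zeta>)))"
  proof (rule arclength.integrable_const_bound[where B = 1])
    show "AE \<zeta> in arclength. norm (indicator K \<zeta> * (1 - cmod (radial_limit u \<zeta>))) \<le> 1"
      using bu(2) by eventually_elim (auto simp: indicator_def)
  qed (rule im)
  have Ile: "I \<le> measure M (U j \<inter> unit_circle)" for j
  proof -
    define v where "v = singular_inner (submeasure M (indicator (U j)))"
    define w where "w = singular_inner (submeasure M (indicator (- U j)))"
    have wt: "weight (indicator (U j))" "weight (indicator (- U j))" using Ub by (auto simp: weight_def)
    have Mv: "circle_measure (submeasure M (indicator (U j)))" by (rule circle_measure_submeasure[OF M wt(1)])
    note bv = singular_inner_boundary[OF Mv, folded v_def]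
    have vm: "radial_limit v \<in> borel_measurable arclength" using bv(1) by (simp add: bounded_symbol_def)
    have vi: "integrable arclength (\<lambda>\<zeta>. cmod (radial_limit v \<zeta>))" "integrable arclength (radial_limit v)"
      using arclength.integrable_const_bound[OF bv(2) vm] integrable_norm by auto
    \<comment> \<open>The measure behind \<open>w\<close> lives outside \<open>U j\<close>, hence at
      distance at least \<open>1 / Suc j\<close> from each point of \<open>K\<close>.\<close>
    have wlim: "((\<lambda>r. cmod (w (of_real r * \<zeta>))) \<longlongrightarrow> 1) (at_left (1::real))" if z: "\<zeta> \<in> K" for \<zeta>
    proof -
      have z1: "cmod \<zeta> = 1" using z K(2) by auto
      let ?R = "\<lambda>r. Re (herglotz (submeasure M (indicator (- U j))) (of_real r * \<zeta>))"
      have d: "1 / real (Suc j) \<le> cmod (\<eta> - \<zeta>)" if "\<eta> \<in> - U j" for \<eta>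
        using that infdist_le[OF z, of \<eta>] by (simp add: U_def dist_norm)
      have Ub': "- U j \<in> sets borel" using Ub by (simp add: borel_comp)
      have pos: "0 < 1 / real (Suc j)" by simp
      note R = Re_herglotz_away_from_support[OF M Ub' pos d z1]
      have ev: "\<forall>\<^sub>F r in at_left (1::real). r \<in> {0<..<1}" by (rule eventually_at_left_real) simp
      have "(?R \<longlongrightarrow> 0) (at_left (1::real))"
      proof (rule tendsto_sandwich[where f = "\<lambda>_. 0"])
        show "\<forall>\<^sub>F r in at_left 1. 0 \<le> ?R r" using ev by eventually_elim (rule R(2), auto)
        show "\<forall>\<^sub>F r in at_left 1. ?R r \<le> (1 - r\<^sup>2) * (4 / (1 / real (Suc j))\<^sup>2 * measure M (space M))"
          using ev by eventually_elim (rule R(1), auto)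
        have "((\<lambda>r::real. (1 - r\<^sup>2) * (4 / (1 / real (Suc j))\<^sup>2 * measure M (space M))) \<longlongrightarrow>
            (1 - 1\<^sup>2) * (4 / (1 / real (Suc j))\<^sup>2 * measure M (space M))) (at_left 1)"
          by (intro tendsto_intros)
        then show "((\<lambda>r::real. (1 - r\<^sup>2) * (4 / (1 / real (Suc j))\<^sup>2 * measure M (space M))) \<longlongrightarrow> 0) (at_left 1)" by simp
      qed simp
      then have "((\<lambda>r. exp (- ?R r)) \<longlongrightarrow> exp (- 0)) (at_left (1::real))" by (intro tendsto_intros)
      then show ?thesis by (simp add: w_def cmod_singular_inner)
    qed
    have mod_eq: "AE \<zeta> in arclength. \<zeta> \<in> K \<longrightarrow> cmod (radial_limit u \<zeta>) = cmod (radial_limit v \<zeta>)"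
      using bu(3) bv(3) AE_arclength_circle
    proof eventually_elim
      case (elim \<zeta>)
      show ?case
      proof
        assume z: "\<zeta> \<in> K"
        have "((\<lambda>r. cmod (v (of_real r * \<zeta>)) * cmod (w (of_real r * \<zeta>))) \<longlongrightarrow> cmod (radial_limit v \<zeta>) * 1) (at_left (1::real))"
          by (intro tendsto_intros elim wlim z)
        moreover have "\<forall>\<^sub>F r in at_left (1::real). cmod (v (of_real r * \<zeta>)) * cmod (w (of_real r * \<zeta>)) = cmod (u (of_real r * \<zeta>))"
          using eventually_at_left_real[of 0 1, OF zero_less_one]
        proof eventually_elim
          case (elim r)
          then have "of_real r * \<zeta> \<in> unit_disc" using \<open>cmod \<zeta> = 1\<close> by (intro of_real_mult_circle_in_disc) auto
          then show ?case using singular_inner_decomp[OF M Ub, of _ j] by (simp add: u_def v_def w_def norm_mult)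
        qed
        ultimately have "((\<lambda>r. cmod (u (of_real r * \<zeta>))) \<longlongrightarrow> cmod (radial_limit v \<zeta>) * 1) (at_left (1::real))"
          by (rule Lim_transform_eventually)
        with tendsto_norm[OF elim(1)] show "cmod (radial_limit u \<zeta>) = cmod (radial_limit v \<zeta>)"
          by (auto dest: tendsto_unique[OF trivial_limit_at_left_real])
      qed
    qed
    have mass: "measure (submeasure M (indicator (U j))) (space (submeasure M (indicator (U j)))) = measure M (U j \<inter> unit_circle)"
      using emeasure_submeasure_indicator[OF M Ub] by (simp add: measure_def)
    have "I \<le> (\<integral>\<zeta>. 1 - cmod (radial_limit v \<zeta>) \<partial>arclength)"
      unfolding I_def
    proof (rule integral_mono_AE[OF ii])
      show "integrable arclength (\<lambda>\<zeta>. 1 - cmod (radial_limit v \<zeta>))" using vi by auto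
      show "AE \<zeta> in arclength. indicator K \<zeta> * (1 - cmod (radial_limit u \<zeta>)) \<le> 1 - cmod (radial_limit v \<zeta>)"
        using mod_eq bv(2) by eventually_elim (auto simp: indicator_def)
    qed
    also have "\<dots> = 1 - (\<integral>\<zeta>. cmod (radial_limit v \<zeta>) \<partial>arclength)" using vi by simp
    finally have 1: "I \<le> 1 - (\<integral>\<zeta>. cmod (radial_limit v \<zeta>) \<partial>arclength)" .
    \<comment> \<open>The mean over the circle is the value of \<open>v\<close> at the origin, the
      exponential of minus the mass of \<open>U j\<close>; the mean modulus is at least that, and
      \<open>1 - exp (- x) \<le> x\<close> finishes the estimate.\<close>
    have "(\<integral>\<zeta>. radial_limit v \<zeta> \<partial>arclength) = cf (abs_circle_L2 (radial_limit v)) 0"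
      unfolding cf_integral
      by (intro integral_cong_AE) (use vm rep_abs_circle_L2[OF bounded_symbol_square_integrable[OF bv(1)]] in \<open>auto elim: eventually_mono\<close>)
    also have "\<dots> = of_real (exp (- measure M (U j \<inter> unit_circle)))"
      using bv(5) singular_inner_0[OF Mv] by (simp add: v_def mass del: space_submeasure)
    finally have "exp (- measure M (U j \<inter> unit_circle)) = cmod (\<integral>\<zeta>. radial_limit v \<zeta> \<partial>arclength)" by simp
    also have "\<dots> \<le> (\<integral>\<zeta>. cmod (radial_limit v \<zeta>) \<partial>arclength)"
      by (rule integral_norm_bound)
    finally have "I \<le> 1 - exp (- measure M (U j \<inter> unit_circle))" using 1 by simp
    also have "\<dots> \<le> measure M (U j \<inter> unit_circle)" using exp_ge_add_one_self[of "- measure M (U j \<inter> unit_circle)"] by simp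
    finally show ?thesis .
  qed
  have "I \<le> 0" by (rule LIMSEQ_le_const[OF mlim]) (use Ile in auto)
  moreover have nn: "AE \<zeta> in arclength. 0 \<le> indicator K \<zeta> * (1 - cmod (radial_limit u \<zeta>))"
    using bu(2) by eventually_elim (auto simp: indicator_def)
  ultimately have "I = 0" using integral_nonneg_AE[OF nn] unfolding I_def by simp
  then have "AE \<zeta> in arclength. indicator K \<zeta> * (1 - cmod (radial_limit u \<zeta>)) = 0"
    unfolding I_def using integral_nonneg_eq_0_iff_AE[OF ii nn] by simp
  then show ?thesis by eventually_elim (auto simp: u_def indicator_def)
qed simp

text \<open>A set \<open>E\<close> of full arclength that is null for \<open>M\<close> is exhausted
  from inside by compact sets up to an arclength null set. Each compact set is null for
  \<open>M\<close>, so the modulus is one almost everywhere on it.\<close>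

lemma singular_inner_unimodular:
  assumes M: "circle_measure M" and sing: "mutually_singular M arclength"
  shows "unimodular (radial_limit (singular_inner M))"
proof -
  obtain E where E: "E \<in> sets M" "E \<in> sets arclength" "emeasure M E = 0" "emeasure arclength (space arclength - E) = 0"
    using sing unfolding mutually_singular_def by blast
  have Eb: "E \<in> sets borel" using E(2) by (rule sets_arclength_borel)
  have Ec: "E \<subseteq> unit_circle" using sets.sets_into_space[OF E(2)] by simp
  \<comment> \<open>Inner regularity is a statement about Borel measures on the whole plane, while
    \<open>arclength\<close> lives on the circle as its space.\<close>
  define N where "N = distr arclength borel (\<lambda>\<zeta>. \<zeta>)"
  have idm: "(\<lambda>\<zeta>. \<zeta>) \<in> arclength \<rightarrow>\<^sub>M borel" by (rule measurable_arclengthI) simp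
  have N: "emeasure N A = emeasure arclength (A \<inter> unit_circle)" if "A \<in> sets borel" for A
    unfolding N_def using that by (simp add: emeasure_distr[OF idm] Int_commute)
  have E1: "emeasure arclength E = 1"
  proof -
    have "emeasure arclength E + emeasure arclength (space arclength - E) = emeasure arclength (E \<union> (space arclength - E))"
      by (rule plus_emeasure[OF E(2) sets.compl_sets[OF E(2)]]) auto
    moreover have "E \<union> (space arclength - E) = unit_circle" using Ec by auto
    ultimately show ?thesis using E(4) by (simp add: emeasure_arclength_circle)
  qed
  have reg: "emeasure N E = (SUP K\<in>{K. K \<subseteq> E \<and> compact K}. emeasure N K)"
  proof (rule inner_regular)
    show "sets N = sets borel" by (simp add: N_def)
    have "emeasure N (space N) = 1" using N[of UNIV] by (simp add: N_def emeasure_arclength_circle)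
    then show "emeasure N (space N) \<noteq> \<infinity>" by simp
  qed (rule Eb)
  have "\<exists>K. K \<subseteq> E \<and> compact K \<and> ennreal (1 - 1 / real (Suc n)) < emeasure arclength K" for n
  proof -
    have "ennreal (1 - 1 / real (Suc n)) < 1" unfolding ennreal_1[symmetric] by (rule ennreal_lessI) auto
    also have "1 = emeasure N E" using N[OF Eb] E1 Ec by (simp add: Int_absorb2)
    finally obtain K where K: "K \<subseteq> E" "compact K" "ennreal (1 - 1 / real (Suc n)) < emeasure N K"
      unfolding reg less_SUP_iff by auto
    then show ?thesis using N[of K] Ec by (auto simp: Int_absorb2 borel_compact intro!: exI[of _ K])
  qed
  then obtain K where K: "\<And>n. K n \<subseteq> E" "\<And>n. compact (K n)" "\<And>n. ennreal (1 - 1 / real (Suc n)) < emeasure arclength (K n)" by metis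
  have Km: "K n \<in> sets arclength" for n
    using sets_arclength_Int[OF borel_compact[OF K(2)]] K(1)[of n] Ec by (metis Int_absorb2 order_trans)
  have on: "AE \<zeta> in arclength. \<zeta> \<in> K n \<longrightarrow> cmod (radial_limit (singular_inner M) \<zeta>) = 1" for n
  proof (rule singular_inner_modulus_on_null_compact[OF M K(2)])
    show "K n \<subseteq> unit_circle" using K(1) Ec by blast
    show "emeasure M (K n) = 0" using emeasure_mono[OF K(1) E(1), of n] E(3) by simp
  qed
  have null: "space arclength - (\<Union>n. K n) \<in> null_sets arclength"
  proof (rule null_setsI)
    have "measure arclength (space arclength - (\<Union>n. K n)) \<le> 1 / real (Suc n)" for n
    proof -
      have "1 - 1 / real (Suc n) < measure arclength (K n)"
        using K(3)[of n] unfolding arclength.emeasure_eq_measure by (subst (asm) ennreal_less_iff) auto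
      moreover have "measure arclength (K n) \<le> measure arclength (\<Union>n. K n)"
        by (rule arclength.finite_measure_mono) (use Km in auto)
      moreover have "measure arclength (space arclength - (\<Union>n. K n)) = measure arclength (space arclength) - measure arclength (\<Union>n. K n)"
        by (rule arclength.finite_measure_compl) (use Km in auto)
      ultimately show ?thesis by simp
    qed
    then have "\<not> 1 / real (Suc n) < measure arclength (space arclength - (\<Union>n. K n))" for n by (simp add: not_less)
    then have "measure arclength (space arclength - (\<Union>n. K n)) \<le> 0"
      by (meson nat_approx_posE not_less)
    then show "emeasure arclength (space arclength - (\<Union>n. K n)) = 0"
      unfolding arclength.emeasure_eq_measure by (metis ennreal_0 measure_nonneg order_antisym)
    show "space arclength - (\<Union>n. K n) \<in> sets arclength"
      by (intro sets.compl_sets sets.countable_UN) (use Km in auto)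
  qed
  have "AE \<zeta> in arclength. \<forall>n. \<zeta> \<in> K n \<longrightarrow> cmod (radial_limit (singular_inner M) \<zeta>) = 1"
    unfolding AE_all_countable using on by blast
  then have "AE \<zeta> in arclength. cmod (radial_limit (singular_inner M) \<zeta>) = 1"
    using AE_not_in[OF null] AE_space by eventually_elim auto
  then show ?thesis
    unfolding unimodular_def using singular_inner_boundary(1)[OF M] by (simp add: bounded_symbol_def)
qed

section \<open>Model spaces and the shift\<close>

definition boundary :: "(complex \<Rightarrow> complex) \<Rightarrow> circle_L2"
  where "boundary u = abs_circle_L2 (radial_limit u)"

text \<open>Stated through boundary values alone: modulus one almost everywhere and no negative
  frequencies.\<close>

definition inner_function :: "(complex \<Rightarrow> complex) \<Rightarrow> bool"
  where "inner_function u \<longleftrightarrow> unimodular (radial_limit u) \<and> boundary u \<in> H2"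

definition mult_inner :: "(complex \<Rightarrow> complex) \<Rightarrow> circle_L2 \<Rightarrow> circle_L2"
  where "mult_inner u f = mult_L2 (radial_limit u) f"

definition mult_inner_adj :: "(complex \<Rightarrow> complex) \<Rightarrow> circle_L2 \<Rightarrow> circle_L2"
  where "mult_inner_adj u f = mult_L2 (\<lambda>\<zeta>. cnj (radial_limit u \<zeta>)) f"

context
  fixes u assumes u: "inner_function u"
begin

lemma inner_function_unimodular: "unimodular (radial_limit u)"
  using u by (simp add: inner_function_def)

lemma inner_function_bounded: "bounded_symbol (radial_limit u)"
  using inner_function_unimodular by (rule unimodular_bounded)

lemma mult_inner_zshift: "mult_inner u (zshift k f) = zshift k (mult_inner u f)"
  unfolding mult_inner_def using inner_function_bounded by (simp add: zshift_mult_L2)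

lemma mult_inner_adj_zshift: "mult_inner_adj u (zshift k f) = zshift k (mult_inner_adj u f)"
  unfolding mult_inner_adj_def using bounded_symbol_cnj[OF inner_function_bounded] by (simp add: zshift_mult_L2)

lemma mult_inner_linear:
  "mult_inner u (f + g) = mult_inner u f + mult_inner u g" "mult_inner u (f - g) = mult_inner u f - mult_inner u g"
  "mult_inner u (cscale c f) = cscale c (mult_inner u f)"
  unfolding mult_inner_def using inner_function_bounded
  by (simp_all add: mult_L2_add mult_L2_minus mult_L2_cscale)

lemma mult_inner_adj_linear:
  "mult_inner_adj u (f + g) = mult_inner_adj u f + mult_inner_adj u g"
  "mult_inner_adj u (f - g) = mult_inner_adj u f - mult_inner_adj u g"
  "mult_inner_adj u (cscale c f) = cscale c (mult_inner_adj u f)"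
  unfolding mult_inner_adj_def using bounded_symbol_cnj[OF inner_function_bounded]
  by (simp_all add: mult_L2_add mult_L2_minus mult_L2_cscale)

lemma mult_inner_adj_mult_inner [simp]: "mult_inner_adj u (mult_inner u f) = f" "mult_inner u (mult_inner_adj u f) = f"
  unfolding mult_inner_def mult_inner_adj_def
  by (rule mult_L2_unimodular_inverse[OF inner_function_unimodular])+

lemma cinner_mult_inner: "cinner (mult_inner u f) g = cinner f (mult_inner_adj u g)"
  unfolding mult_inner_def mult_inner_adj_def by (rule cinner_mult_L2_left[OF inner_function_bounded])

lemma cinner_mult_inner_right: "cinner f (mult_inner u g) = cinner (mult_inner_adj u f) g"
  using cinner_mult_inner[of g f] by (metis cinner_commute)

lemma cinner_mult_inner_both [simp]: "cinner (mult_inner u f) (mult_inner u g) = cinner f g"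
  by (simp add: cinner_mult_inner)

lemma norm_mult_inner [simp]: "norm (mult_inner u f) = norm f"
  unfolding mult_inner_def by (rule norm_mult_L2_unimodular[OF inner_function_unimodular])

lemma bounded_linear_mult_inner: "bounded_linear (mult_inner u)"
  unfolding mult_inner_def by (rule bounded_linear_mult_L2[OF inner_function_bounded])

lemma mult_inner_ee: "mult_inner u (ee n) = zshift n (boundary u)"
proof -
  have "mult_inner u (ee n) = abs_circle_L2 (\<lambda>\<zeta>. radial_limit u \<zeta> * \<zeta> powi n)"
    unfolding mult_inner_def ee_def by (rule mult_L2_abs[OF inner_function_bounded]) simp
  also have "\<dots> = zshift n (boundary u)"
    unfolding zshift_def boundary_def
    by (subst mult_L2_abs) (auto simp: mult.commute bounded_symbol_square_integrable inner_function_bounded)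
  finally show ?thesis .
qed

lemma norm_boundary [simp]: "norm (boundary u) = 1"
  using norm_mult_inner[of "ee 0"] by (simp add: mult_inner_ee)

lemma cf_boundary_neg: "n < 0 \<Longrightarrow> cf (boundary u) n = 0"
  using u by (simp add: inner_function_def H2_iff)

lemma mult_inner_H2: assumes "f \<in> H2" shows "mult_inner u f \<in> H2"
proof -
  have f: "\<And>n. n < 0 \<Longrightarrow> cf f n = 0" using assms by (simp add: H2_iff)
  have "(\<lambda>N. mult_inner u (taylor_sum (\<lambda>n. cf f (int n)) N)) \<longlonglongrightarrow> mult_inner u f"
    by (intro bounded_linear.tendsto[OF bounded_linear_mult_inner] taylor_sum_tendsto f)
  moreover have "mult_inner u (taylor_sum a N) \<in> H2" for a N
  proof (induction N)
    case 0
    have "mult_inner u 0 = 0" using mult_inner_linear(3)[of 0 0] by simp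
    then show ?case by (simp add: taylor_sum_def closed_csubspaceD(1)[OF closed_csubspace_H2])
  next
    case (Suc N)
    have "taylor_sum a (Suc N) = taylor_sum a N + cscale (a N) (ee (int N))" by (simp add: taylor_sum_def)
    moreover have "zshift (int N) (boundary u) \<in> H2" using u by (intro H2_zshift) (auto simp: inner_function_def)
    ultimately show ?case using Suc
      by (simp add: mult_inner_linear mult_inner_ee closed_csubspaceD(2,3)[OF closed_csubspace_H2])
  qed
  ultimately show ?thesis by (rule closed_csubspaceD(5)[OF closed_csubspace_H2, rotated])
qed

text \<open>Orthogonality of \<open>f\<close> to \<open>u * H2\<close> says that
  \<open>cnj u * f\<close> has no nonnegative frequencies. So the model space consists of the
  \<open>f\<close> in \<open>H2\<close> for which \<open>u * cnj f\<close> is analytic and vanishes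
  at the origin.\<close>

lemma model_space_iff:
  "f \<in> model_space u \<longleftrightarrow> (\<forall>n<0. cf f n = 0) \<and> (\<forall>n\<ge>0. cf (mult_inner_adj u f) n = 0)"
proof -
  have eq: "cinner f (abs_circle_L2 (\<lambda>\<zeta>. radial_limit u \<zeta> * rep_circle_L2 h \<zeta>)) = cinner (mult_inner_adj u f) h" for h
    unfolding cinner_mult_inner_right[symmetric] mult_inner_def mult_L2_def ..
  show ?thesis
  proof
    assume f: "f \<in> model_space u"
    have "cinner (mult_inner_adj u f) (ee n) = 0" if "0 \<le> n" for n
      unfolding eq[symmetric] using f that by (simp add: model_space_def)
    then show "(\<forall>n<0. cf f n = 0) \<and> (\<forall>n\<ge>0. cf (mult_inner_adj u f) n = 0)"
      using f by (auto simp: model_space_def H2_iff cf_def)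
  next
    assume f: "(\<forall>n<0. cf f n = 0) \<and> (\<forall>n\<ge>0. cf (mult_inner_adj u f) n = 0)"
    have "cinner f (abs_circle_L2 (\<lambda>\<zeta>. radial_limit u \<zeta> * rep_circle_L2 h \<zeta>)) = 0" if "h \<in> H2" for h
      unfolding eq using f that by (intro cinner_eq_0_analytic) (auto simp: H2_iff)
    then show "f \<in> model_space u" using f by (simp add: model_space_def H2_iff)
  qed
qed

lemma model_spaceD:
  assumes "f \<in> model_space u"
  shows "n < 0 \<Longrightarrow> cf f n = 0" "0 \<le> n \<Longrightarrow> cf (mult_inner_adj u f) n = 0" "f \<in> H2"
  using assms unfolding model_space_iff H2_iff by auto

lemma model_space_annihilator:
  "model_space u = {f. \<forall>w\<in>ee ` {..<0} \<union> (\<lambda>n. zshift n (boundary u)) ` {0..}. cinner f w = 0}"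
  by (auto simp: model_space_iff cf_def cinner_mult_inner_right[symmetric] mult_inner_ee)

lemma closed_csubspace_model_space: "closed_csubspace (model_space u)"
  unfolding model_space_annihilator by (rule closed_csubspace_annihilator)

text \<open>On the circle the conjugate of \<chi> is its inverse, so the conjugation factors into
  the unitary operators of shift and multiplication and the plain complex conjugation.\<close>

lemma model_conj_eq: "model_conj u f = mult_inner u (zshift (-1) (cnj_L2 f))"
proof -
  have b: "bounded_symbol (\<lambda>\<zeta>. radial_limit u \<zeta> * \<zeta> powi (-1))"
    by (intro bounded_symbol_mult inner_function_bounded bounded_zpow)
  have "mult_inner u (zshift (-1) (cnj_L2 f)) = mult_L2 (\<lambda>\<zeta>. radial_limit u \<zeta> * \<zeta> powi (-1)) (cnj_L2 f)"
    unfolding mult_inner_def zshift_def by (rule mult_L2_mult_L2[OF inner_function_bounded bounded_zpow])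
  also have "\<dots> = abs_circle_L2 (\<lambda>\<zeta>. radial_limit u \<zeta> * \<zeta> powi (-1) * cnj (rep_circle_L2 f \<zeta>))"
    unfolding cnj_L2_def by (rule mult_L2_abs[OF b square_integrable_cnj[OF square_integrable_rep]])
  also have "\<dots> = model_conj u f"
    unfolding model_conj_def
  proof (rule abs_circle_L2_eqI)
    show sq: "square_integrable (\<lambda>\<zeta>. radial_limit u \<zeta> * \<zeta> powi (-1) * cnj (rep_circle_L2 f \<zeta>))"
      by (intro square_integrable_symbol_mult b square_integrable_cnj square_integrable_rep)
    have "bounded_symbol (\<lambda>\<zeta>. radial_limit u \<zeta> * cnj (\<zeta> powi 1))"
      by (intro bounded_symbol_mult inner_function_bounded bounded_symbol_cnj bounded_zpow)
    from square_integrable_symbol_mult[OF this square_integrable_cnj[OF square_integrable_rep[of f]]]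
    show "square_integrable (\<lambda>\<zeta>. radial_limit u \<zeta> * cnj (\<zeta> * rep_circle_L2 f \<zeta>))" by (simp add: mult_ac)
  qed (auto intro!: AE_arclengthI simp: power_int_minus cnj_circle)
  finally show ?thesis ..
qed

lemma cinner_model_conj: "cinner (model_conj u f) (model_conj u g) = cinner g f"
  unfolding model_conj_eq using cinner_commute[of g f] by (simp add: cinner_cnj_L2)

lemma cnj_L2_zshift: "cnj_L2 (zshift k f) = zshift (-k) (cnj_L2 f)"
  unfolding zshift_def[of k] by (subst cnj_L2_mult_L2) (auto simp: mult_cnj_zpow)

lemma cnj_L2_mult_inner: "cnj_L2 (mult_inner u f) = mult_inner_adj u (cnj_L2 f)"
  unfolding mult_inner_def mult_inner_adj_def by (rule cnj_L2_mult_L2[OF inner_function_bounded])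

lemma cnj_L2_mult_inner_adj: "cnj_L2 (mult_inner_adj u f) = mult_inner u (cnj_L2 f)"
  using cnj_L2_mult_inner[of "cnj_L2 f"] by (metis cnj_L2_cnj_L2)

lemma model_conj_model_conj [simp]: "model_conj u (model_conj u f) = f"
  unfolding model_conj_eq by (simp add: cnj_L2_mult_inner cnj_L2_zshift mult_inner_adj_zshift mult_inner_zshift)

lemma cf_cnj_L2: "cf (cnj_L2 f) n = cnj (cf f (-n))"
proof -
  have "ee (-n) = cnj_L2 (ee n)"
    using cnj_L2_zshift[of n "ee 0"] unfolding circle_L2_eq_iff
    using rep_ee[of n] rep_ee[of "-n"] rep_cnj_L2[of "ee n"] AE_arclength_circle
    by (auto simp: cnj_zpow elim!: eventually_elim2[OF eventually_conj eventually_conj])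
  then show ?thesis unfolding cf_def by (metis cinner_cnj_L2 cnj_L2_cnj_L2)
qed

text \<open>The conjugation exchanges the two frequency conditions: index \<open>n\<close> of one
  turns into index \<open>- n - 1\<close> of the other, and this map interchanges the negative and
  the nonnegative integers.\<close>

lemma model_conj_in_model_space:
  assumes f: "f \<in> model_space u" shows "model_conj u f \<in> model_space u"
  unfolding model_space_iff
proof (intro conjI allI impI)
  fix n :: int assume "n < 0"
  have "cf (model_conj u f) n = cf (cnj_L2 (mult_inner_adj u (zshift 1 f))) n"
    unfolding model_conj_eq by (simp add: cnj_L2_mult_inner_adj cnj_L2_zshift)
  also have "\<dots> = cnj (cf (mult_inner_adj u f) (-n - 1))"
    by (simp add: cf_cnj_L2 mult_inner_adj_zshift cf_zshift)
  also have "\<dots> = 0" using model_spaceD(2)[OF f] \<open>n < 0\<close> by simp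
  finally show "cf (model_conj u f) n = 0" .
next
  fix n :: int assume "0 \<le> n"
  have "cf (mult_inner_adj u (model_conj u f)) n = cnj (cf f (-n - 1))"
    unfolding model_conj_eq by (simp add: cf_zshift cf_cnj_L2)
  then show "cf (mult_inner_adj u (model_conj u f)) n = 0" using model_spaceD(1)[OF f] \<open>0 \<le> n\<close> by simp
qed

end

section \<open>The backward shift and its action on model spaces\<close>

definition bshift :: "nat \<Rightarrow> circle_L2 \<Rightarrow> circle_L2"
  where "bshift n f = zshift (- int n) (f - taylor_sum (\<lambda>k. cf f (int k)) n)"

lemma cf_bshift: "(\<And>k. k < 0 \<Longrightarrow> cf f k = 0) \<Longrightarrow> cf (bshift n f) k = (if k < 0 then 0 else cf f (k + int n))"
  by (auto simp: bshift_def cf_zshift cf_simps cf_taylor_sum)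

lemma bshift_H2: "f \<in> H2 \<Longrightarrow> bshift n f \<in> H2"
  by (simp add: H2_iff cf_bshift)

text \<open>The removed Taylor polynomial has degree below \<open>n\<close> and is orthogonal to
  \<open>z^n H2\<close>. On \<open>H2\<close> this identifies \<open>bshift n\<close> as the
  \<open>n\<close>-th power of the adjoint \<open>S*\<close> of the shift.\<close>

lemma cinner_bshift:
  assumes "g \<in> H2" shows "cinner g (bshift n f) = cinner (zshift (int n) g) f"
proof -
  have "cinner (zshift (int n) g) (taylor_sum a n) = 0" for a
    unfolding taylor_sum_def using assms
    by (auto simp: cinner_simps H2_iff cf_zshift intro!: sum.neutral simp flip: cf_def)
  then show ?thesis by (simp add: bshift_def cinner_zshift_left zshift_simps cinner_minus_right)
qed

lemma bshift_0 [simp]: "bshift 0 f = f"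
  by (simp add: bshift_def taylor_sum_def)

lemma bshift_bshift:
  assumes "f \<in> H2" shows "bshift m (bshift n f) = bshift (m + n) f"
proof (rule cf_eqI)
  fix k
  have 1: "\<And>k. k < 0 \<Longrightarrow> cf f k = 0" using assms by (simp add: H2_iff)
  have 2: "\<And>k. k < 0 \<Longrightarrow> cf (bshift n f) k = 0" using bshift_H2[OF assms] by (simp add: H2_iff)
  show "cf (bshift m (bshift n f)) k = cf (bshift (m + n) f) k"
    by (simp add: cf_bshift[OF 1] cf_bshift[OF 2] algebra_simps)
qed

lemma zshift_bshift_1: "zshift 1 (bshift 1 f) = f - cscale (cf f 0) (ee 0)"
  by (simp add: bshift_def taylor_sum_def zshift_simps)

lemma bshift_tendsto_0:
  assumes "f \<in> H2" shows "(\<lambda>n. bshift n f) \<longlonglongrightarrow> 0"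
proof (rule tendsto_norm_zero_cancel)
  have "(\<lambda>n. norm (f - taylor_sum (\<lambda>k. cf f (int k)) n)) \<longlonglongrightarrow> norm (f - f)"
    using assms by (intro tendsto_intros taylor_sum_tendsto) (simp add: H2_iff)
  then show "(\<lambda>n. norm (bshift n f)) \<longlonglongrightarrow> 0" by (simp add: bshift_def)
qed

lemma tendsto_bshift:
  assumes "(X \<longlongrightarrow> f) F" shows "((\<lambda>n. bshift k (X n)) \<longlongrightarrow> bshift k f) F"
  unfolding bshift_def taylor_sum_def
  by (intro bounded_linear.tendsto[OF bounded_linear_zshift] tendsto_intros assms tendsto_cf)

context
  fixes u assumes u: "inner_function u"
begin

text \<open>Multiplying a polynomial of degree below \<open>n\<close> by \<open>cnj u\<close>
  creates no frequencies from \<open>n\<close> on, so removing the polynomial does not touch the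
  coefficients of \<open>cnj u * f\<close> that land at nonnegative indices after the shift by
  \<open>- n\<close>.\<close>

lemma bshift_model_space:
  assumes f: "f \<in> model_space u" shows "bshift n f \<in> model_space u"
  unfolding model_space_iff[OF u]
proof (intro conjI allI impI)
  fix k :: int assume "k < 0"
  then show "cf (bshift n f) k = 0" using model_spaceD(1)[OF u f] by (simp add: cf_bshift)
next
  fix k :: int assume k: "0 \<le> k"
  \<comment> \<open>The coefficient is the conjugate of coefficient \<open>i - j\<close> of
    \<open>u\<close>, which vanishes by analyticity.\<close>
  have z: "cf (mult_inner_adj u (ee i)) j = 0" if "i < j" for i j
  proof -
    have "cf (mult_inner_adj u (ee i)) j = cinner (ee i) (zshift j (boundary u))"
      unfolding cf_def by (simp add: cinner_mult_inner_right[OF u, symmetric] mult_inner_ee[OF u])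
    also have "\<dots> = cnj (cf (zshift j (boundary u)) i)" unfolding cf_def by (rule cinner_commute)
    also have "\<dots> = 0" using cf_boundary_neg[OF u] that by (simp add: cf_zshift)
    finally show ?thesis .
  qed
  have "cf (mult_inner_adj u (bshift n f)) k = cf (mult_inner_adj u f) (k + int n) - cf (mult_inner_adj u (taylor_sum (\<lambda>k. cf f (int k)) n)) (k + int n)"
    by (simp add: bshift_def mult_inner_adj_zshift[OF u] mult_inner_adj_linear[OF u] cf_zshift cf_simps)
  moreover have "cf (mult_inner_adj u (taylor_sum a m)) (k + int n) = 0" if "m \<le> n" for a m
    using that
  proof (induction m)
    case 0
    have "mult_inner_adj u 0 = 0" using mult_inner_adj_linear(3)[OF u, of 0 0] by simp
    then show ?case by (simp add: taylor_sum_def cf_simps)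
  next
    case (Suc m)
    have "taylor_sum a (Suc m) = taylor_sum a m + cscale (a m) (ee (int m))" by (simp add: taylor_sum_def)
    then show ?case using Suc k by (simp add: mult_inner_adj_linear[OF u] cf_simps z)
  qed
  ultimately show "cf (mult_inner_adj u (bshift n f)) k = 0" using model_spaceD(2)[OF u f] k by simp
qed

text \<open>\<open>S* u\<close> is orthogonal to \<open>z^k u\<close>, as pairing the two gives the
  conjugate of \<open><z^(k+1) u, u>\<close>, and multiplication by \<open>u\<close> preserves the
  orthogonality of exponentials. The higher powers stay in the model space by invariance. These
  vectors are bounded, which is why they are used as test vectors.\<close>

lemma bshift_boundary_model_space: assumes "1 \<le> n" shows "bshift n (boundary u) \<in> model_space u"
proof -
  have H: "boundary u \<in> H2" using u by (simp add: inner_function_def)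
  have "bshift 1 (boundary u) \<in> model_space u"
    unfolding model_space_iff[OF u]
  proof (intro conjI allI impI)
    fix k :: int assume "k < 0"
    then show "cf (bshift 1 (boundary u)) k = 0" using bshift_H2[OF H] by (simp add: H2_iff)
  next
    fix k :: int assume k: "0 \<le> k"
    have "cf (mult_inner_adj u (bshift 1 (boundary u))) k = cinner (bshift 1 (boundary u)) (zshift k (boundary u))"
      unfolding cf_def by (simp add: cinner_mult_inner_right[OF u, symmetric] mult_inner_ee[OF u])
    also have "\<dots> = cnj (cinner (zshift k (boundary u)) (bshift 1 (boundary u)))" by (rule cinner_commute)
    also have "cinner (zshift k (boundary u)) (bshift 1 (boundary u)) = cinner (zshift (k + 1) (boundary u)) (boundary u)"
      using cinner_bshift[OF H2_zshift[OF H k], of 1] by (simp add: add.commute)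
    also have "\<dots> = cinner (mult_inner u (ee (k + 1))) (mult_inner u (ee 0))" by (simp add: mult_inner_ee[OF u])
    also have "\<dots> = 0" using k by (simp add: cinner_mult_inner_both[OF u] cinner_ee)
    finally show "cf (mult_inner_adj u (bshift 1 (boundary u))) k = 0" by simp
  qed
  then have "bshift (n - 1) (bshift 1 (boundary u)) \<in> model_space u" by (rule bshift_model_space)
  then show ?thesis using assms by (simp add: bshift_bshift[OF H])
qed

text \<open>Pairing \<open>f\<close> with \<open>bshift n\<close> of the boundary function yields
  the coefficient of index \<open>- n\<close> of \<open>cnj u * f\<close>, and the coefficients of
  index at least \<open>0\<close> vanish already. So the backward shifts of \<open>u\<close> are
  total in the model space.\<close>

lemma model_space_orthogonal_bshift_boundary:
  assumes f: "f \<in> model_space u" and o: "\<And>n. 1 \<le> n \<Longrightarrow> cinner f (bshift n (boundary u)) = 0"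
  shows "f = 0"
proof -
  have "cf (mult_inner_adj u f) k = 0" for k
  proof (cases "0 \<le> k")
    case True then show ?thesis using model_spaceD(2)[OF u f] by simp
  next
    case False
    have "cf (mult_inner_adj u f) k = cinner f (zshift k (boundary u))"
      unfolding cf_def by (simp add: cinner_mult_inner_right[OF u, symmetric] mult_inner_ee[OF u])
    also have "\<dots> = cinner (zshift (int (nat (-k))) f) (boundary u)" using False by (simp add: cinner_zshift_left)
    also have "\<dots> = cinner f (bshift (nat (-k)) (boundary u))" by (rule cinner_bshift[symmetric, OF model_spaceD(3)[OF u f]])
    also have "\<dots> = 0" using False by (intro o) auto
    finally show ?thesis .
  qed
  then have "mult_inner_adj u f = 0" by (rule cf_eq_0_imp_eq_0)
  then have "mult_inner u (mult_inner_adj u f) = mult_inner u 0" by simp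
  moreover have "mult_inner u 0 = 0" using mult_inner_linear(3)[OF u, of 0 0] by simp
  ultimately show ?thesis by (simp add: mult_inner_adj_mult_inner[OF u])
qed

text \<open>The vectors of the model space whose product with \<open>z\<close> stays there, encoded
  as the orthogonal complement of \<open>S* u\<close> so that closedness and projections are at
  hand.\<close>

definition shift_domain :: "circle_L2 set"
  where "shift_domain = {f \<in> model_space u. cinner f (bshift 1 (boundary u)) = 0}"

lemma closed_csubspace_shift_domain: "closed_csubspace shift_domain"
proof -
  have "shift_domain = model_space u \<inter> {f. \<forall>w\<in>{bshift 1 (boundary u)}. cinner f w = 0}"
    by (auto simp: shift_domain_def)
  then show ?thesis
    using closed_csubspace_Int[OF closed_csubspace_model_space[OF u] closed_csubspace_annihilator] by (simp only:)
qed

text \<open>Multiplication by \<open>z\<close> moves the coefficients of \<open>cnj u * f\<close> up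
  by one. The only one that can become an obstruction is that of index \<open>-1\<close>, and it
  equals \<open><f, S* u>\<close>.\<close>

lemma shift_domain_iff: "f \<in> shift_domain \<longleftrightarrow> f \<in> model_space u \<and> zshift 1 f \<in> model_space u"
proof -
  have "zshift 1 f \<in> model_space u \<longleftrightarrow> cinner f (bshift 1 (boundary u)) = 0" if f: "f \<in> model_space u"
  proof -
    have eq: "cinner f (bshift 1 (boundary u)) = cf (mult_inner_adj u f) (-1)"
      using cinner_bshift[OF model_spaceD(3)[OF u f], of 1]
      unfolding cf_def by (simp add: cinner_mult_inner_right[OF u, symmetric] mult_inner_ee[OF u] cinner_zshift_left)
    have "zshift 1 f \<in> model_space u \<longleftrightarrow> (\<forall>n\<ge>0. cf (mult_inner_adj u f) (n - 1) = 0)"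
      unfolding model_space_iff[OF u] using model_spaceD(1)[OF u f] by (simp add: cf_zshift mult_inner_adj_zshift[OF u])
    also have "\<dots> \<longleftrightarrow> cf (mult_inner_adj u f) (-1) = 0"
    proof
      assume m1: "cf (mult_inner_adj u f) (-1) = 0"
      show "\<forall>n\<ge>0. cf (mult_inner_adj u f) (n - 1) = 0"
      proof (intro allI impI)
        fix n :: int assume "0 \<le> n"
        then show "cf (mult_inner_adj u f) (n - 1) = 0"
          using m1 model_spaceD(2)[OF u f, of "n - 1"] by (cases "n = 0") auto
      qed
    qed (drule spec[of _ 0], simp)
    finally show ?thesis by (simp only: eq)
  qed
  then show ?thesis by (auto simp: shift_domain_def)
qed

text \<open>The component of \<open>S*^n u\<close> orthogonal to \<open>S* u\<close>, multiplied by
  the squared norm of \<open>S* u\<close>. Without a denominator the vector depends continuously on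
  \<open>u\<close>, also where \<open>S* u\<close> vanishes.\<close>

definition shift_vec :: "nat \<Rightarrow> circle_L2"
  where "shift_vec n = cscale (of_real ((norm (bshift 1 (boundary u)))\<^sup>2)) (bshift n (boundary u))
    - cscale (cinner (bshift n (boundary u)) (bshift 1 (boundary u))) (bshift 1 (boundary u))"

lemma shift_vec_in: assumes "1 \<le> n" shows "shift_vec n \<in> shift_domain"
  unfolding shift_domain_def
proof
  have "shift_vec n \<in> model_space u"
    unfolding shift_vec_def using bshift_boundary_model_space assms
    by (intro closed_csubspaceD(3,4)[OF closed_csubspace_model_space[OF u]]) auto
  moreover have "cinner (shift_vec n) (bshift 1 (boundary u)) = 0"
    unfolding shift_vec_def by (simp add: cinner_simps cinner_self_norm)
  ultimately show "shift_vec n \<in> model_space u \<and> cinner (shift_vec n) (bshift 1 (boundary u)) = 0" by simp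
qed

text \<open>A vector orthogonal to \<open>S* u\<close> and to all \<open>shift_vec n\<close> is
  orthogonal to every \<open>S*^n u\<close>, and these are total. The statement with a closed
  subspace \<open>S\<close> is the form used for sesquilinear identities that hold on the
  \<open>shift_vec n\<close>.\<close>

lemma shift_domain_density:
  assumes S: "closed_csubspace S" "S \<subseteq> shift_domain" "\<And>n. 1 \<le> n \<Longrightarrow> shift_vec n \<in> S"
  shows "S = shift_domain"
proof (rule subspace_eqI[OF S(1) closed_csubspace_shift_domain S(2)])
  fix f assume f: "f \<in> shift_domain" and o: "\<And>s. s \<in> S \<Longrightarrow> cinner f s = 0"
  let ?q = "bshift 1 (boundary u)"
  have fm: "f \<in> model_space u" and fq: "cinner f ?q = 0" using f by (auto simp: shift_domain_def)
  show "f = 0"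
  proof (cases "?q = 0")
    \<comment> \<open>Every \<open>shift_vec n\<close> is then zero and carries no information, but
      all further backward shifts of \<open>u\<close> vanish too and the model space is
      trivial.\<close>
    case True
    have "?q \<in> model_space u" by (rule bshift_boundary_model_space) simp
    have "bshift n (boundary u) = 0" if "1 \<le> n" for n
    proof -
      have "bshift n (boundary u) = bshift (n - 1) ?q"
        using u that by (subst bshift_bshift) (auto simp: inner_function_def)
      also have "\<dots> = 0" unfolding True by (simp add: bshift_def taylor_sum_def cf_simps zshift_simps)
      finally show ?thesis .
    qed
    then show ?thesis by (intro model_space_orthogonal_bshift_boundary[OF fm]) simp
  next
    case False
    show ?thesis
    proof (rule model_space_orthogonal_bshift_boundary[OF fm])
      fix n :: nat assume "1 \<le> n"
      then have "cinner f (shift_vec n) = 0" by (intro o S)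
      then show "cinner f (bshift n (boundary u)) = 0"
        using fq False by (simp add: shift_vec_def cinner_simps)
    qed
  qed
qed

end

section \<open>Division by a concentrated singular factor\<close>

definition factorization :: "(complex \<Rightarrow> complex) \<Rightarrow> (complex \<Rightarrow> complex) \<Rightarrow> (complex \<Rightarrow> complex) \<Rightarrow> bool"
  where "factorization u v w \<longleftrightarrow> inner_function u \<and> inner_function v \<and> inner_function w \<and>
    (AE \<zeta> in arclength. radial_limit u \<zeta> = radial_limit v \<zeta> * radial_limit w \<zeta>)"

text \<open>\<open>A* = C A C\<close> combined with \<open><C f, C g> = <g, f>\<close>: the operator
  stays in the first slot while the two vectors change places.\<close>

lemma model_conj_symmetric:
  assumes u: "inner_function u" and sym: "C_symmetric_on (model_space u) (model_conj u) A"
    and f: "f \<in> model_space u" and g: "g \<in> model_space u"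
  shows "cinner (A f) g = cinner (A (model_conj u g)) (model_conj u f)"
proof -
  have "cinner (A f) g = cinner f (model_conj u (A (model_conj u g)))"
    using sym f g by (simp add: C_symmetric_on_def adjoint_on_def)
  also have "\<dots> = cinner (model_conj u (model_conj u f)) (model_conj u (A (model_conj u g)))"
    by (simp add: model_conj_model_conj[OF u])
  also have "\<dots> = cinner (A (model_conj u g)) (model_conj u f)" by (rule cinner_model_conj[OF u])
  finally show ?thesis .
qed

context
  fixes u v w assumes fac: "factorization u v w"
begin

lemma factorization_inner: "inner_function u" "inner_function v" "inner_function w"
  using fac by (auto simp: factorization_def)

lemma mult_inner_factorization: "mult_inner u f = mult_inner w (mult_inner v f)"
proof -
  have "mult_inner w (mult_inner v f) = mult_L2 (\<lambda>\<zeta>. radial_limit w \<zeta> * radial_limit v \<zeta>) f"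
    unfolding mult_inner_def by (intro mult_L2_mult_L2 inner_function_bounded factorization_inner)
  also have "\<dots> = mult_L2 (radial_limit u) f"
    using fac by (intro mult_L2_cong bounded_symbol_mult inner_function_bounded factorization_inner)
      (auto simp: factorization_def mult.commute)
  finally show ?thesis by (simp add: mult_inner_def)
qed

lemma mult_inner_adj_factorization: "mult_inner_adj u f = mult_inner_adj w (mult_inner_adj v f)"
proof -
  have "cinner (mult_inner_adj u f) h = cinner (mult_inner_adj v f) (mult_inner w h)" for h
  proof -
    have "mult_inner u h = mult_inner v (mult_inner w h)"
      using mult_inner_factorization[of h]
        inner_function_bounded[OF factorization_inner(2)] inner_function_bounded[OF factorization_inner(3)]
      by (simp add: mult_inner_def mult.commute)
    then show ?thesis
      by (simp add: cinner_mult_inner_right[OF factorization_inner(1), symmetric] cinner_mult_inner_right[OF factorization_inner(2), symmetric])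
  qed
  then show ?thesis
    by (intro cinner_eqI) (simp add: cinner_mult_inner_right[OF factorization_inner(3)])
qed

text \<open>\<open>cnj u * (w * f) = cnj v * f\<close>, so the frequency condition for
  \<open>u\<close> is the one for \<open>v\<close>.\<close>

lemma model_space_mult_inner:
  assumes f: "f \<in> model_space v" shows "mult_inner w f \<in> model_space u"
proof -
  note i = factorization_inner
  have "mult_inner_adj u (mult_inner w f) = mult_inner_adj v f"
  proof (rule cinner_eqI)
    fix h
    show "cinner (mult_inner_adj u (mult_inner w f)) h = cinner (mult_inner_adj v f) h"
      unfolding cinner_mult_inner_right[OF i(1), symmetric] cinner_mult_inner_right[OF i(2), symmetric]
        mult_inner_factorization cinner_mult_inner_both[OF i(3)] ..
  qed
  then show ?thesis
    using mult_inner_H2[OF i(3) model_spaceD(3)[OF i(2) f]] model_spaceD(2)[OF i(2) f]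
    by (simp add: model_space_iff[OF i(1)] H2_iff)
qed

text \<open>\<open>cnj u * f = cnj w * (cnj v * f)\<close>, where \<open>cnj v * f\<close> is
  orthogonal to \<open>H2\<close> and multiplication by \<open>w\<close> maps \<open>H2\<close> into
  itself.\<close>

lemma model_space_subset: assumes f: "f \<in> model_space v" shows "f \<in> model_space u"
proof -
  note i = factorization_inner
  have "cf (mult_inner_adj u f) n = 0" if n: "0 \<le> n" for n
  proof -
    have "cf (mult_inner_adj u f) n = cinner (mult_inner_adj v f) (mult_inner w (ee n))"
      unfolding cf_def mult_inner_adj_factorization cinner_mult_inner_right[OF i(3)] ..
    also have "\<dots> = 0"
      using model_spaceD(2)[OF i(2) f] mult_inner_H2[OF i(3) ee_in_H2[OF n]]
      by (intro cinner_eq_0_analytic) (auto simp: H2_iff)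
    finally show ?thesis .
  qed
  then show ?thesis using model_spaceD(1)[OF i(2) f] by (simp add: model_space_iff[OF i(1)])
qed

lemma model_conj_factorization: "model_conj u f = mult_inner w (model_conj v f)"
  unfolding model_conj_eq[OF factorization_inner(1)] model_conj_eq[OF factorization_inner(2)] mult_inner_factorization ..

text \<open>Composing the symmetries on \<open>K\<^sub>u\<close> and on \<open>K\<^sub>v\<close> turns the two conjugations into multiplication by
  \<open>w = u / v\<close>.\<close>

lemma symmetric_imp_invariant:
  assumes su: "C_symmetric_on (model_space u) (model_conj u) A"
    and sv: "C_symmetric_on (model_space v) (model_conj v) (\<lambda>f. proj (model_space v) (A f))"
    and f: "f \<in> model_space v" and h: "h \<in> model_space v"
  shows "cinner (A (mult_inner w f)) (mult_inner w h) = cinner (A f) h"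
proof -
  note i = factorization_inner
  define f1 where "f1 = model_conj v f"
  define h1 where "h1 = model_conj v h"
  have fh: "f1 \<in> model_space v" "h1 \<in> model_space v"
    using f h model_conj_in_model_space[OF i(2)] by (auto simp: f1_def h1_def)
  have wf: "mult_inner w f = model_conj u f1" "mult_inner w h = model_conj u h1"
    by (simp_all add: f1_def h1_def model_conj_factorization model_conj_model_conj[OF i(2)])
  have "cinner (A (mult_inner w f)) (mult_inner w h) = cinner (A h1) f1"
    unfolding wf using model_conj_symmetric[OF i(1) su, of h1 f1] fh model_space_subset by simp
  also have "\<dots> = cinner (proj (model_space v) (A h1)) f1"
    by (rule cinner_proj_left[symmetric, OF closed_csubspace_model_space[OF i(2)] fh(1)])
  also have "\<dots> = cinner (proj (model_space v) (A f)) h"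
    using model_conj_symmetric[OF i(2) sv fh(2) fh(1)] by (simp add: f1_def h1_def model_conj_model_conj[OF i(2)])
  also have "\<dots> = cinner (A f) h" by (rule cinner_proj_left[OF closed_csubspace_model_space[OF i(2)] h])
  finally show ?thesis .
qed

end

section \<open>Essentially bounded vectors with explicit bounds\<close>

definition L2_bounded_by :: "circle_L2 \<Rightarrow> real \<Rightarrow> bool"
  where "L2_bounded_by f M \<longleftrightarrow> 0 \<le> M \<and> (AE \<zeta> in arclength. cmod (rep_circle_L2 f \<zeta>) \<le> M)"

lemma L2_bounded_by_mono: "L2_bounded_by f M \<Longrightarrow> M \<le> N \<Longrightarrow> L2_bounded_by f N"
  unfolding L2_bounded_by_def by (auto elim: eventually_mono)

lemma L2_bounded_by_symbol: "L2_bounded_by f M \<Longrightarrow> bounded_symbol (rep_circle_L2 f)"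
  unfolding L2_bounded_by_def bounded_symbol_def by auto

lemma L2_bounded_by_add:
  assumes "L2_bounded_by f M" "L2_bounded_by g N" shows "L2_bounded_by (f + g) (M + N)"
proof -
  have "AE \<zeta> in arclength. cmod (rep_circle_L2 f \<zeta>) \<le> M" "AE \<zeta> in arclength. cmod (rep_circle_L2 g \<zeta>) \<le> N"
    using assms by (auto simp: L2_bounded_by_def)
  then have "AE \<zeta> in arclength. cmod (rep_circle_L2 (f + g) \<zeta>) \<le> M + N"
    using rep_plus[of f g] by eventually_elim (auto intro: norm_triangle_mono)
  then show ?thesis using assms by (simp add: L2_bounded_by_def)
qed

lemma L2_bounded_by_cscale:
  assumes "L2_bounded_by f M" shows "L2_bounded_by (cscale c f) (cmod c * M)"
proof -
  have "AE \<zeta> in arclength. cmod (rep_circle_L2 f \<zeta>) \<le> M" using assms by (simp add: L2_bounded_by_def)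
  then have "AE \<zeta> in arclength. cmod (rep_circle_L2 (cscale c f) \<zeta>) \<le> cmod c * M"
    using rep_cscale[of c f] by eventually_elim (simp add: norm_mult mult_left_mono)
  then show ?thesis using assms by (simp add: L2_bounded_by_def)
qed

lemma L2_bounded_by_minus:
  assumes "L2_bounded_by f M" "L2_bounded_by g N" shows "L2_bounded_by (f - g) (M + N)"
  using L2_bounded_by_add[OF assms(1) L2_bounded_by_cscale[OF assms(2), of "-1"]]
  by (simp add: minus_circle_L2_def uminus_eq_cscale)

lemma L2_bounded_by_zshift:
  assumes "L2_bounded_by f M" shows "L2_bounded_by (zshift k f) M"
proof -
  have "AE \<zeta> in arclength. cmod (rep_circle_L2 f \<zeta>) \<le> M" using assms by (simp add: L2_bounded_by_def)
  then have "AE \<zeta> in arclength. cmod (rep_circle_L2 (zshift k f) \<zeta>) \<le> M"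
    using rep_mult_L2[OF bounded_zpow, of k f] AE_arclength_circle
    by eventually_elim (simp add: zshift_def norm_mult norm_power_int)
  then show ?thesis using assms by (simp add: L2_bounded_by_def)
qed

lemma L2_bounded_by_ee: "L2_bounded_by (ee n) 1"
proof -
  have "AE \<zeta> in arclength. cmod (rep_circle_L2 (ee n) \<zeta>) \<le> 1"
    using rep_ee[of n] AE_arclength_circle by eventually_elim (simp add: norm_power_int)
  then show ?thesis by (simp add: L2_bounded_by_def)
qed

text \<open>Each of the \<open>n\<close> removed Taylor terms is bounded by a Fourier coefficient,
  hence by the norm of \<open>f\<close> and by \<open>M\<close>. The bound therefore depends on
  \<open>n\<close> and \<open>M\<close> alone.\<close>

lemma L2_bounded_by_bshift:
  assumes "L2_bounded_by f M" "norm f \<le> M" shows "L2_bounded_by (bshift n f) (real (Suc n) * M)"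
proof -
  have "L2_bounded_by (taylor_sum (\<lambda>k. cf f (int k)) n) (real n * M)"
  proof (induction n)
    case 0
    have "L2_bounded_by (cscale 0 f) (cmod 0 * M)" by (rule L2_bounded_by_cscale[OF assms(1)])
    then show ?case by (simp add: taylor_sum_def)
  next
    case (Suc n)
    have "L2_bounded_by (cscale (cf f (int n)) (ee (int n))) M"
      by (rule L2_bounded_by_mono[OF L2_bounded_by_cscale[OF L2_bounded_by_ee]]) (use cmod_cf_le[of f "int n"] assms(2) in simp)
    from L2_bounded_by_add[OF Suc this] show ?case by (simp add: taylor_sum_def algebra_simps)
  qed
  from L2_bounded_by_zshift[OF L2_bounded_by_minus[OF assms(1) this], of "- int n"]
  show ?thesis by (simp add: bshift_def algebra_simps)
qed

lemma mult_L2_rep_ee: "bounded_symbol (rep_circle_L2 f) \<Longrightarrow> mult_L2 (rep_circle_L2 f) (ee n) = zshift n f"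
  unfolding ee_def zshift_def mult_L2_def[of "zpow n"] by (subst mult_L2_abs) (auto simp: mult.commute)

lemma norm_mult_L2_rep_le: "L2_bounded_by f M \<Longrightarrow> norm (mult_L2 (rep_circle_L2 f) g) \<le> M * norm g"
  unfolding L2_bounded_by_def by (intro norm_mult_L2_le) auto

lemma norm_le_L2_bounded_by: assumes "L2_bounded_by f M" shows "norm f \<le> M"
  using norm_mult_L2_rep_le[OF assms, of "ee 0"] by (simp add: mult_L2_rep_ee[OF L2_bounded_by_symbol[OF assms]])

lemma mult_L2_rep_boundary:
  assumes w: "inner_function w" and f: "bounded_symbol (rep_circle_L2 f)"
  shows "mult_L2 (rep_circle_L2 f) (boundary w) = mult_inner w f"
  unfolding boundary_def mult_inner_def mult_L2_def[of "radial_limit w"]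
  by (subst mult_L2_abs[OF f bounded_symbol_square_integrable[OF inner_function_bounded[OF w]]]) (simp add: mult.commute)

section \<open>First-order expansion at a factor of small mass\<close>

definition shift_defect :: "(circle_L2 \<Rightarrow> circle_L2) \<Rightarrow> circle_L2 \<Rightarrow> circle_L2 \<Rightarrow> complex"
  where "shift_defect A F H = cinner (A F) H - cinner (A (zshift 1 F)) (zshift 1 H)"

text \<open>This is \<open>(\<zeta>\<^sub>0 - z) * (1 - w) / \<delta> - (\<zeta>\<^sub>0 +
  z)\<close>, expanded into exponentials and shifts of the boundary function.\<close>

definition generator_error :: "complex \<Rightarrow> real \<Rightarrow> (complex \<Rightarrow> complex) \<Rightarrow> circle_L2"
  where "generator_error \<zeta>\<^sub>0 \<delta> w =
    cscale (of_real (1 / \<delta>)) (cscale \<zeta>\<^sub>0 (ee 0) - ee 1 - (cscale \<zeta>\<^sub>0 (boundary w) - zshift 1 (boundary w)))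
    - (cscale \<zeta>\<^sub>0 (ee 0) + ee 1)"

lemma bounded_operator_onD:
  assumes "bounded_operator_on K A"
  shows "f \<in> K \<Longrightarrow> A f \<in> K" "f \<in> K \<Longrightarrow> g \<in> K \<Longrightarrow> A (f + g) = A f + A g" "f \<in> K \<Longrightarrow> A (cscale c f) = cscale c (A f)"
  using assms unfolding bounded_operator_on_def by blast+

lemma bounded_operator_on_minus:
  assumes "bounded_operator_on K A" "closed_csubspace K" "f \<in> K" "g \<in> K"
  shows "A (f - g) = A f - A g"
  unfolding minus_circle_L2_def uminus_eq_cscale
  using bounded_operator_onD(2,3)[OF assms(1)] closed_csubspaceD(3)[OF assms(2)] assms(3,4) by simp

text \<open>Here \<open>\<zeta>\<^sub>0\<close> is the approximate location of the mass \<open>\<delta>\<close> of the singular measure of \<open>w\<close>, so that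
  \<open>(1 - w) / \<delta>\<close> is close to \<open>(\<zeta>\<^sub>0 + z) / (\<zeta>\<^sub>0 - z)\<close>; multiplying by \<open>\<zeta>\<^sub>0 - z\<close> clears the denominator.\<close>

lemma shift_defect_bound:
  assumes fac: "factorization u v w" and A: "bounded_operator_on (model_space u) A"
    and B: "0 \<le> B" "\<And>f. f \<in> model_space u \<Longrightarrow> norm (A f) \<le> B * norm f"
    and inv: "\<And>f h. f \<in> model_space v \<Longrightarrow> h \<in> model_space v \<Longrightarrow>
      cinner (A (mult_inner w f)) (mult_inner w h) = cinner (A f) h"
    and F: "F \<in> shift_domain v" "L2_bounded_by F M" and H: "H \<in> shift_domain v" "L2_bounded_by H M"
    and z0: "cmod \<zeta>\<^sub>0 = 1" and d: "0 < \<delta>" and e: "norm (generator_error \<zeta>\<^sub>0 \<delta> w) \<le> \<epsilon>"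
  shows "2 * cmod (shift_defect A F H) \<le> B * M\<^sup>2 * (\<delta> * (2 + \<epsilon>)\<^sup>2 + 4 * \<epsilon>)"
proof -
  note i = factorization_inner[OF fac]
  note Kv = closed_csubspaceD[OF closed_csubspace_model_space[OF i(2)]]
  note Ku = closed_csubspaceD[OF closed_csubspace_model_space[OF i(1)]]
  \<comment> \<open>In terms of multiplication, \<open>q\<close> is by
    \<open>\<zeta>\<^sub>0 - z\<close>, \<open>p0\<close> by \<open>\<zeta>\<^sub>0 + z\<close>,
    \<open>p\<close> by \<open>(\<zeta>\<^sub>0 - z) * (1 - w) / \<delta>\<close>, and
    \<open>r\<close> is the error \<open>p - p0\<close>.\<close>
  define q where "q G = cscale \<zeta>\<^sub>0 G - zshift 1 G" for G
  define p0 where "p0 G = cscale \<zeta>\<^sub>0 G + zshift 1 G" for G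
  define p where "p G = cscale (of_real (1 / \<delta>)) (q G - mult_inner w (q G))" for G
  define r where "r G = p G - p0 G" for G
  have M: "0 \<le> M" using F(2) by (simp add: L2_bounded_by_def)
  have \<epsilon>: "0 \<le> \<epsilon>" using e norm_ge_zero order_trans by blast
  have in_v: "G \<in> model_space v" "zshift 1 G \<in> model_space v" if "G \<in> shift_domain v" for G
    using that by (auto simp: shift_domain_iff[OF i(2)])
  have q: "q G \<in> model_space v" if "G \<in> shift_domain v" for G
    unfolding q_def by (intro Kv(3,4) in_v that)
  have qu: "q G \<in> model_space u" if "G \<in> shift_domain v" for G by (rule model_space_subset[OF fac q[OF that]])
  have p0: "p0 G \<in> model_space u" if "G \<in> shift_domain v" for G
    unfolding p0_def by (intro model_space_subset[OF fac] Kv(2,3) in_v that)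
  have p: "p G \<in> model_space u" if "G \<in> shift_domain v" for G
    unfolding p_def by (intro Ku(3,4) qu model_space_mult_inner[OF fac] q that)
  have r: "r G \<in> model_space u" if "G \<in> shift_domain v" for G
    unfolding r_def by (intro Ku(4) p p0 that)
  have nG: "norm G \<le> M" if "L2_bounded_by G M" for G using that by (rule norm_le_L2_bounded_by)
  have nq: "norm (q G) \<le> 2 * M" if "L2_bounded_by G M" for G
  proof -
    have "norm (q G) \<le> norm (cscale \<zeta>\<^sub>0 G) + norm (zshift 1 G)" unfolding q_def by (rule norm_triangle_ineq4)
    then show ?thesis using nG[OF that] z0 by (simp add: norm_cscale)
  qed
  have np0: "norm (p0 G) \<le> 2 * M" if "L2_bounded_by G M" for G
  proof -
    have "norm (p0 G) \<le> norm (cscale \<zeta>\<^sub>0 G) + norm (zshift 1 G)" unfolding p0_def by (rule norm_triangle_ineq)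
    then show ?thesis using nG[OF that] z0 by (simp add: norm_cscale)
  qed
  \<comment> \<open>The generator error is small in L^2 only; the pointwise bound on
    \<open>G\<close> is what makes its product with \<open>G\<close> small.\<close>
  have nr: "norm (r G) \<le> M * \<epsilon>" if G: "L2_bounded_by G M" for G
  proof -
    note b = L2_bounded_by_symbol[OF G]
    have "mult_L2 (rep_circle_L2 G) (generator_error \<zeta>\<^sub>0 \<delta> w) = r G"
      unfolding generator_error_def r_def p_def p0_def q_def
      by (simp add: mult_L2_add[OF b] mult_L2_minus[OF b] mult_L2_cscale[OF b] mult_L2_rep_ee[OF b]
          mult_L2_rep_boundary[OF i(3) b] zshift_mult_L2[OF b, symmetric] mult_inner_linear[OF i(3)] mult_inner_zshift[OF i(3)])
    then have "norm (r G) \<le> M * norm (generator_error \<zeta>\<^sub>0 \<delta> w)" using norm_mult_L2_rep_le[OF G] by metis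
    also have "\<dots> \<le> M * \<epsilon>" using e M by (rule mult_left_mono)
    finally show ?thesis .
  qed
  have np: "norm (p G) \<le> M * (2 + \<epsilon>)" if "L2_bounded_by G M" for G
  proof -
    have "p G = p0 G + r G" by (simp add: r_def)
    then have "norm (p G) \<le> norm (p0 G) + norm (r G)" using norm_triangle_ineq by metis
    then show ?thesis using np0[OF that] nr[OF that] by (simp add: algebra_simps)
  qed
  have wq: "mult_inner w (q G) = q G - cscale (of_real \<delta>) (p G)" for G
    using d by (simp add: p_def)
  \<comment> \<open>Since \<open>w * q = q - \<delta> * p\<close>, the invariance is an identity
    quadratic in \<delta>. Its constant terms agree, so one factor \<delta> can be divided out,
    leaving a right side of first order in \<delta>.\<close>
  have "cinner (A (q F - cscale (of_real \<delta>) (p F))) (q H - cscale (of_real \<delta>) (p H)) = cinner (A (q F)) (q H)"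
    using inv[OF q[OF F(1)] q[OF H(1)]] by (simp add: wq)
  then have "cinner (A (q F) - cscale (of_real \<delta>) (A (p F))) (q H - cscale (of_real \<delta>) (p H)) = cinner (A (q F)) (q H)"
    using bounded_operator_on_minus[OF A closed_csubspace_model_space[OF i(1)] qu[OF F(1)] Ku(3)[OF p[OF F(1)]]]
      bounded_operator_onD(3)[OF A p[OF F(1)]] by simp
  then have "of_real \<delta> * (cinner (A (q F)) (p H) + cinner (A (p F)) (q H)) = of_real \<delta> * (of_real \<delta> * cinner (A (p F)) (p H))"
    by (simp add: cinner_simps algebra_simps)
  then have 1: "cinner (A (q F)) (p H) + cinner (A (p F)) (q H) = of_real \<delta> * cinner (A (p F)) (p H)"
    using d by simp
  have "A (p F) = A (p0 F) + A (r F)"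
    using bounded_operator_onD(2)[OF A p0[OF F(1)] r[OF F(1)]] by (simp add: r_def)
  moreover have "cinner g (p H) = cinner g (p0 H) + cinner g (r H)" for g
    by (simp add: r_def cinner_simps)
  ultimately have 2: "cinner (A (q F)) (p0 H) + cinner (A (p0 F)) (q H) =
      of_real \<delta> * cinner (A (p F)) (p H) - cinner (A (q F)) (r H) - cinner (A (r F)) (q H)"
    using 1 by (simp add: cinner_simps algebra_simps)
  have AF: "A (cscale \<zeta>\<^sub>0 F) = cscale \<zeta>\<^sub>0 (A F)" "A (q F) = cscale \<zeta>\<^sub>0 (A F) - A (zshift 1 F)"
      "A (p0 F) = cscale \<zeta>\<^sub>0 (A F) + A (zshift 1 F)"
    unfolding q_def p0_def
    using bounded_operator_onD[OF A] bounded_operator_on_minus[OF A closed_csubspace_model_space[OF i(1)]]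
      model_space_subset[OF fac] in_v[OF F(1)] Ku(3) by auto
  have zz: "\<zeta>\<^sub>0 * (cnj \<zeta>\<^sub>0 * c) = c" for c using mult_cnj_self(1)[of \<zeta>\<^sub>0] z0 by (simp flip: mult.assoc)
  \<comment> \<open>The terms pairing \<open>F\<close> with \<open>z H\<close> and
    \<open>z F\<close> with \<open>H\<close> cancel, and
    \<open>cnj \<zeta>\<^sub>0 * \<zeta>\<^sub>0 = 1\<close> removes the dependence on
    \<open>\<zeta>\<^sub>0\<close>.\<close>
  have 3: "cinner (A (q F)) (p0 H) + cinner (A (p0 F)) (q H) = 2 * shift_defect A F H"
    unfolding AF shift_defect_def unfolding p0_def q_def
    by (simp add: cinner_simps algebra_simps zz)
  have nA: "cmod (cinner (A f) g) \<le> B * (norm f * norm g)" if "f \<in> model_space u" for f g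
  proof -
    have "cmod (cinner (A f) g) \<le> norm (A f) * norm g" by (rule cmod_cinner_le)
    also have "\<dots> \<le> B * norm f * norm g" using B(2)[OF that] by (rule mult_right_mono) simp
    finally show ?thesis by simp
  qed
  have b1: "cmod (of_real \<delta> * cinner (A (p F)) (p H)) \<le> \<delta> * (B * ((M * (2 + \<epsilon>)) * (M * (2 + \<epsilon>))))"
  proof -
    have "cmod (cinner (A (p F)) (p H)) \<le> B * (norm (p F) * norm (p H))" by (rule nA[OF p[OF F(1)]])
    also have "\<dots> \<le> B * ((M * (2 + \<epsilon>)) * (M * (2 + \<epsilon>)))"
      using B(1) M \<epsilon> by (intro mult_left_mono mult_mono np F H) auto
    finally show ?thesis using d by (simp add: norm_mult)
  qed
  have b2: "cmod (cinner (A (q F)) (r H)) \<le> B * ((2 * M) * (M * \<epsilon>))"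
    by (rule order_trans[OF nA[OF qu[OF F(1)]]]) (use B(1) M \<epsilon> in \<open>intro mult_left_mono mult_mono nq nr F H; simp\<close>)
  have b3: "cmod (cinner (A (r F)) (q H)) \<le> B * ((M * \<epsilon>) * (2 * M))"
    by (rule order_trans[OF nA[OF r[OF F(1)]]]) (use B(1) M \<epsilon> in \<open>intro mult_left_mono mult_mono nq nr F H; simp\<close>)
  have "2 * cmod (shift_defect A F H) = cmod (of_real \<delta> * cinner (A (p F)) (p H) - cinner (A (q F)) (r H) - cinner (A (r F)) (q H))"
    using 2 3 by (metis norm_mult norm_numeral)
  also have "\<dots> \<le> cmod (of_real \<delta> * cinner (A (p F)) (p H)) + cmod (cinner (A (q F)) (r H)) + cmod (cinner (A (r F)) (q H))"
    by (intro norm_triangle_le_diff add_mono norm_triangle_ineq4 order_refl)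
  also have "\<dots> \<le> \<delta> * (B * ((M * (2 + \<epsilon>)) * (M * (2 + \<epsilon>)))) + B * ((2 * M) * (M * \<epsilon>)) + B * ((M * \<epsilon>) * (2 * M))"
    by (intro add_mono b1 b2 b3)
  also have "\<dots> = B * M\<^sup>2 * (\<delta> * (2 + \<epsilon>)\<^sup>2 + 4 * \<epsilon>)"
    by (simp add: power2_eq_square algebra_simps)
  finally show ?thesis .
qed


text \<open>Third-order accuracy is required because the terms up to second order cancel in the norm
  of the generator error. The factor \<open>1 / 2\<close> is \<open>3 / 6\<close>, from
  \<open>exp t \<le> exp 1 \<le> 3\<close>.\<close>

lemma exp_minus_ge:
  assumes "0 \<le> \<delta>" "\<delta> \<le> (1::real)" shows "1 - \<delta> + \<delta>\<^sup>2 / 2 - \<delta> ^ 3 / 2 \<le> exp (- \<delta>)"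
proof -
  obtain t where t: "\<bar>t\<bar> \<le> \<bar>- \<delta>\<bar>" "exp (- \<delta>) = (\<Sum>m<3. (- \<delta>) ^ m / fact m) + exp t / fact 3 * (- \<delta>) ^ 3"
    using Maclaurin_exp_le[of "- \<delta>" 3] by blast
  have "exp t \<le> exp 1" using t(1) assms by simp
  also have "\<dots> \<le> 3" using exp_le by simp
  finally have "exp t / 6 * \<delta> ^ 3 \<le> 3 / 6 * \<delta> ^ 3" using assms by (intro mult_right_mono) auto
  then show ?thesis using t(2) by (simp add: eval_nat_numeral)
qed

text \<open>Here \<kappa> is the relative loss in the first moment due to the spread of the mass.
  With exponential accuracy in the value at the origin, everything below third order in \<delta>
  cancels apart from the term with \<kappa>; dividing by \<open>\<delta>\<^sup>2\<close> leaves
  \<open>6 * \<delta>\<close> and \<open>4 * \<kappa> / \<delta>\<close>.\<close>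

lemma norm_generator_error:
  assumes w: "inner_function w" and z0: "cmod \<zeta>\<^sub>0 = 1" and d: "0 < \<delta>" "\<delta> \<le> 1" and k: "0 \<le> \<kappa>"
    and w0: "cf (boundary w) 0 = of_real (exp (- \<delta>))"
    and w1: "Re (\<zeta>\<^sub>0 * cf (boundary w) 1) \<le> - 2 * exp (- \<delta>) * \<delta> * (1 - \<kappa>)"
  shows "(norm (generator_error \<zeta>\<^sub>0 \<delta> w))\<^sup>2 \<le> 6 * \<delta> + 4 * \<kappa> / \<delta>"
proof -
  define W where "W = boundary w"
  define a where "a = exp (- \<delta>)"
  define b where "b = cf W 1"
  define g where "g = cscale \<zeta>\<^sub>0 (ee 0) - ee 1 - (cscale \<zeta>\<^sub>0 W - zshift 1 W) - cscale (of_real \<delta>) (cscale \<zeta>\<^sub>0 (ee 0) + ee 1)"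
  have g: "generator_error \<zeta>\<^sub>0 \<delta> w = cscale (of_real (1 / \<delta>)) g"
    using d(1) by (simp add: generator_error_def g_def W_def cscale_minus_right)
  have eW: "cinner W (ee 0) = of_real a" "cinner W (ee 1) = b" "cinner (zshift 1 W) (ee 0) = 0" "cinner (zshift 1 W) (ee 1) = of_real a"
    using w0 cf_boundary_neg[OF w, of "-1"] cf_zshift[of 1 W 0] cf_zshift[of 1 W 1] by (simp_all add: cf_def W_def a_def b_def)
  have We: "cinner (ee 0) W = of_real a" "cinner (ee 1) W = cnj b" "cinner (ee 0) (zshift 1 W) = 0" "cinner (ee 1) (zshift 1 W) = of_real a"
    using eW cinner_commute[of "ee 0" W] cinner_commute[of "ee 1" W] cinner_commute[of "ee 0" "zshift 1 W"] cinner_commute[of "ee 1" "zshift 1 W"] by simp_all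
  \<comment> \<open>\<open>W\<close> and \<open>zshift 1 W\<close> are the images of two orthonormal
    exponentials under the isometry of multiplication by \<open>w\<close>.\<close>
  have WW: "cinner W W = 1" "cinner W (zshift 1 W) = 0" "cinner (zshift 1 W) W = 0"
    using cinner_mult_inner_both[OF w, of "ee 0" "ee 0"] cinner_mult_inner_both[OF w, of "ee 0" "ee 1"] cinner_mult_inner_both[OF w, of "ee 1" "ee 0"]
    unfolding mult_inner_ee[OF w] W_def by (simp_all add: cinner_ee)
  have zz: "\<zeta>\<^sub>0 * (cnj \<zeta>\<^sub>0 * c) = c" "\<zeta>\<^sub>0 * cnj \<zeta>\<^sub>0 = 1" for c
    using mult_cnj_self(1)[of \<zeta>\<^sub>0] z0 by (simp_all flip: mult.assoc)
  have "cinner g g = of_real (4 - 4 * a + 2 * \<delta>\<^sup>2) + of_real (1 + \<delta>) * (\<zeta>\<^sub>0 * b + cnj (\<zeta>\<^sub>0 * b))"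
    unfolding g_def
    by (simp add: cinner_simps eW We WW cinner_ee algebra_simps zz power2_eq_square)
  then have "(norm g)\<^sup>2 = Re (of_real (4 - 4 * a + 2 * \<delta>\<^sup>2) + of_real (1 + \<delta>) * (\<zeta>\<^sub>0 * b + cnj (\<zeta>\<^sub>0 * b)))"
    using cinner_self_norm[of g] by (metis Re_complex_of_real)
  also have "\<dots> = 4 - 4 * a + 2 * \<delta>\<^sup>2 + 2 * (1 + \<delta>) * Re (\<zeta>\<^sub>0 * b)"
    by (simp add: algebra_simps)
  also have "\<dots> \<le> 4 - 4 * a + 2 * \<delta>\<^sup>2 + 2 * (1 + \<delta>) * (- 2 * a * \<delta> * (1 - \<kappa>))"
    using w1 d by (intro add_left_mono mult_left_mono) (simp_all add: a_def b_def W_def)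
  \<comment> \<open>Collected so that the cancellation shows:
    \<open>exp (- \<delta>) * (1 + \<delta> + \<delta>\<^sup>2)\<close> is
    \<open>1 + \<delta>\<^sup>2 / 2\<close> up to third order, which balances both \<open>4\<close>
    and \<open>2 * \<delta>\<^sup>2\<close>.\<close>
  also have "\<dots> = 4 - 4 * (a * (1 + \<delta> + \<delta>\<^sup>2)) + 2 * \<delta>\<^sup>2 + 4 * ((1 + \<delta>) * a) * (\<delta> * \<kappa>)"
    by (simp add: algebra_simps power2_eq_square)
  also have "\<dots> \<le> 6 * \<delta> ^ 3 + 4 * (\<delta> * \<kappa>)"
  proof -
    have "(1 - \<delta> + \<delta>\<^sup>2 / 2 - \<delta> ^ 3 / 2) * (1 + \<delta> + \<delta>\<^sup>2) \<le> a * (1 + \<delta> + \<delta>\<^sup>2)"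
      unfolding a_def using exp_minus_ge[of \<delta>] d by (intro mult_right_mono) auto
    moreover have "(1 - \<delta> + \<delta>\<^sup>2 / 2 - \<delta> ^ 3 / 2) * (1 + \<delta> + \<delta>\<^sup>2) = 1 + \<delta>\<^sup>2 / 2 - \<delta> ^ 3 - \<delta> ^ 5 / 2"
      by (simp add: eval_nat_numeral field_simps)
    moreover have "\<delta> ^ 5 \<le> \<delta> ^ 3" using d by (intro power_decreasing) auto
    ultimately have 1: "1 + \<delta>\<^sup>2 / 2 - 3 / 2 * \<delta> ^ 3 \<le> a * (1 + \<delta> + \<delta>\<^sup>2)" by linarith
    have "(1 + \<delta>) * a \<le> exp \<delta> * a"
      unfolding a_def using exp_ge_add_one_self[of \<delta>] by (intro mult_right_mono) auto
    also have "\<dots> = 1" unfolding a_def by (simp flip: exp_add)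
    finally have "((1 + \<delta>) * a) * (\<delta> * \<kappa>) \<le> 1 * (\<delta> * \<kappa>)" using d k by (intro mult_right_mono) auto
    with 1 show ?thesis by linarith
  qed
  finally have le: "(norm g)\<^sup>2 \<le> 6 * \<delta> ^ 3 + 4 * (\<delta> * \<kappa>)" .
  have "(norm (generator_error \<zeta>\<^sub>0 \<delta> w))\<^sup>2 = (norm g)\<^sup>2 / \<delta>\<^sup>2"
    unfolding g norm_cscale using d by (simp add: power_mult_distrib power_divide norm_divide)
  also have "\<dots> \<le> (6 * \<delta> ^ 3 + 4 * (\<delta> * \<kappa>)) / \<delta>\<^sup>2" using le by (rule divide_right_mono) simp
  also have "\<dots> = 6 * \<delta> + 4 * \<kappa> / \<delta>" using d by (simp add: field_simps eval_nat_numeral)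
  finally show ?thesis .
qed

lemma cmod_cis_diff_le: "cmod (cis s - cis t) \<le> \<bar>s - t\<bar>"
  unfolding cmod_cis_diff using abs_sin_x_le_abs_x[of "(s - t) / 2"] by simp

lemma Re_mult_cnj_circle:
  assumes "cmod a = 1" "cmod b = 1" shows "Re (a * cnj b) = 1 - (cmod (a - b))\<^sup>2 / 2"
proof -
  have "(Re a)\<^sup>2 + (Im a)\<^sup>2 = 1" "(Re b)\<^sup>2 + (Im b)\<^sup>2 = 1" using assms cmod_power2[of a] cmod_power2[of b] by simp_all
  moreover have "(Re a - Re b)\<^sup>2 = (Re a)\<^sup>2 - 2 * (Re a * Re b) + (Re b)\<^sup>2" "(Im a - Im b)\<^sup>2 = (Im a)\<^sup>2 - 2 * (Im a * Im b) + (Im b)\<^sup>2"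
    by (simp_all add: power2_diff)
  moreover have "Re (a * cnj b) = Re a * Re b + Im a * Im b" "(cmod (a - b))\<^sup>2 = (Re a - Re b)\<^sup>2 + (Im a - Im b)\<^sup>2"
    by (simp_all add: cmod_power2)
  ultimately show ?thesis by linarith
qed

text \<open>Pigeonhole: one of \<open>N\<close> equal arcs carries at least the \<open>N\<close>-th part of the mass.\<close>

lemma concentrated_weight:
  assumes M: "circle_measure M" and N: "0 < N"
  defines "c \<equiv> measure M (space M)"
  assumes c: "0 < c"
  shows "\<exists>\<theta> \<zeta>\<^sub>0. weight \<theta> \<and> cmod \<zeta>\<^sub>0 = 1 \<and> measure (submeasure M \<theta>) (space M) = c / real N \<and>
    c / real N * (1 - 2 * pi\<^sup>2 / (real N)\<^sup>2) \<le> Re (\<zeta>\<^sub>0 * (\<integral>\<zeta>. cnj \<zeta> \<partial>submeasure M \<theta>))"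
proof -
  interpret finite_measure M using M by (simp add: circle_measure_def)
  \<comment> \<open>Closed arcs, compact as images of intervals. Neighbouring arcs share an
    endpoint, which finite subadditivity tolerates.\<close>
  define J where "J k = cis ` {2 * pi * real k / real N .. 2 * pi * real (Suc k) / real N}" for k
  have "compact (J k)" for k unfolding J_def
    by (intro compact_continuous_image continuous_on_cis continuous_on_id compact_Icc)
  then have Jb: "J k \<in> sets borel" for k by (rule borel_compact)
  have Jc: "J k \<subseteq> unit_circle" for k by (auto simp: J_def)
  have Jm: "J k \<in> sets M" for k
    using sets_arclength_Int[OF Jb, of k] Jc[of k] M by (simp add: circle_measure_def Int_absorb2)
  have cover: "space M \<subseteq> (\<Union>k<N. J k)"
  proof
    fix \<zeta> assume "\<zeta> \<in> space M"
    then have z: "cmod \<zeta> = 1" by (simp add: space_circle_measure[OF M])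
    define a where "a = Arg2pi \<zeta>"
    have a: "\<zeta> = cis a" "0 \<le> a" "a < 2 * pi"
      using Arg2pi_eq[of \<zeta>] Arg2pi_ge_0[of \<zeta>] Arg2pi_lt_2pi[of \<zeta>] z by (auto simp: a_def cis_conv_exp)
    define x where "x = a * real N / (2 * pi)"
    have x: "0 \<le> x" "x < real N" using a N by (simp_all add: x_def divide_less_eq)
    define k where "k = nat \<lfloor>x\<rfloor>"
    have k: "real k \<le> x" "x < real (Suc k)" "k < N"
      using x by (simp_all add: k_def nat_less_iff floor_less_iff) linarith+
    have ax: "a = 2 * pi * x / real N" using N by (simp add: x_def)
    have "2 * pi * real k / real N \<le> a" "a \<le> 2 * pi * real (Suc k) / real N"
      unfolding ax using k by (intro divide_right_mono mult_left_mono; simp)+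
    then have "\<zeta> \<in> J k" unfolding J_def a(1) by (intro imageI) simp
    then show "\<zeta> \<in> (\<Union>k<N. J k)" using k by blast
  qed
  have "\<exists>k<N. c / real N \<le> measure M (J k)"
  proof (rule ccontr)
    assume "\<not> (\<exists>k<N. c / real N \<le> measure M (J k))"
    then have lt: "measure M (J k) < c / real N" if "k < N" for k using that by (meson not_le)
    have "c \<le> measure M (\<Union>k<N. J k)"
      unfolding c_def using cover Jm by (intro finite_measure_mono) auto
    also have "\<dots> \<le> (\<Sum>k<N. measure M (J k))"
      by (rule finite_measure_subadditive_finite) (use Jm in auto)
    also have "\<dots> < (\<Sum>k<N. c / real N)"
      using lt N by (intro sum_strict_mono) auto
    also have "\<dots> = c" using N by simp
    finally show False by simp
  qed
  then obtain k where k: "c / real N \<le> measure M (J k)" by blast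
  define m where "m = measure M (J k)"
  have cN: "0 < c / real N" using c N by simp
  then have m: "0 < m" "c / real N \<le> m" using k by (simp_all add: m_def)
  \<comment> \<open>The mass of the arc is scaled down to exactly \<open>c / N\<close>, so that
    \<delta> is prescribed in advance.\<close>
  define \<theta> where "\<theta> \<zeta> = (c / real N / m) * indicator (J k) \<zeta>" for \<zeta>
  define \<zeta>\<^sub>0 where "\<zeta>\<^sub>0 = cis (2 * pi * real k / real N)"
  have s: "0 \<le> c / real N / m" "c / real N / m \<le> 1"
    using m cN by (simp_all add: divide_le_eq_1_pos del: divide_divide_eq_left)
  have wt: "weight \<theta>" unfolding weight_def
  proof (intro conjI allI)
    show "\<theta> \<in> borel_measurable borel" unfolding \<theta>_def[abs_def] using Jb by measurable
    show "0 \<le> \<theta> \<zeta>" "\<theta> \<zeta> \<le> 1" for \<zeta>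
      unfolding \<theta>_def using s by (cases "\<zeta> \<in> J k"; simp del: divide_divide_eq_left)+
  qed
  have int_ind: "integrable M (\<lambda>\<zeta>. \<theta> \<zeta> * x)" for x
    unfolding \<theta>_def using Jm by (intro integrable_mult_left integrable_mult_right integrable_real_indicator) (auto simp: less_top[symmetric])
  have int_th: "(\<integral>\<zeta>. \<theta> \<zeta> \<partial>M) = c / real N"
    unfolding \<theta>_def using Jm[of k] m by (simp add: m_def)
  have mass: "measure (submeasure M \<theta>) (space M) = c / real N"
  proof -
    have "(\<integral>\<zeta>. (1::real) \<partial>submeasure M \<theta>) = (\<integral>\<zeta>. \<theta> \<zeta> *\<^sub>R 1 \<partial>M)"
      by (rule integral_submeasure[OF M wt]) simp
    then show ?thesis using int_th by simp
  qed
  have cm: "(\<lambda>\<zeta>. cnj \<zeta>) \<in> borel_measurable M" by (rule measurable_circle_measureI[OF M]) measurable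
  have thetam: "\<theta> \<in> borel_measurable M" by (rule measurable_circle_measureI[OF M]) (use wt in \<open>simp add: weight_def\<close>)
  have th0: "0 \<le> \<theta> \<zeta>" for \<zeta> using wt by (simp add: weight_def)
  have ci: "integrable M (\<lambda>\<zeta>. \<theta> \<zeta> *\<^sub>R (\<zeta>\<^sub>0 * cnj \<zeta>))"
  proof (rule integrable_const_bound[where B = 1])
    have "\<theta> \<zeta> \<le> 1" for \<zeta> using wt by (simp add: weight_def)
    then show "AE \<zeta> in M. norm (\<theta> \<zeta> *\<^sub>R (\<zeta>\<^sub>0 * cnj \<zeta>)) \<le> 1"
      using th0 by (intro AE_I2) (simp add: space_circle_measure[OF M] norm_mult \<zeta>\<^sub>0_def)
    show "(\<lambda>\<zeta>. \<theta> \<zeta> *\<^sub>R (\<zeta>\<^sub>0 * cnj \<zeta>)) \<in> borel_measurable M" using thetam cm by measurable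
  qed
  have "Re (\<zeta>\<^sub>0 * (\<integral>\<zeta>. cnj \<zeta> \<partial>submeasure M \<theta>)) = Re (\<integral>\<zeta>. \<theta> \<zeta> *\<^sub>R (\<zeta>\<^sub>0 * cnj \<zeta>) \<partial>M)"
  proof -
    have "\<zeta>\<^sub>0 * (\<integral>\<zeta>. cnj \<zeta> \<partial>submeasure M \<theta>) = (\<integral>\<zeta>. \<zeta>\<^sub>0 * cnj \<zeta> \<partial>submeasure M \<theta>)"
      by (rule integral_mult_right_zero[symmetric])
    also have "\<dots> = (\<integral>\<zeta>. \<theta> \<zeta> *\<^sub>R (\<zeta>\<^sub>0 * cnj \<zeta>) \<partial>M)"
      by (rule integral_submeasure[OF M wt]) (use cm in measurable)
    finally show ?thesis by simp
  qed
  also have "\<dots> = (\<integral>\<zeta>. Re (\<theta> \<zeta> *\<^sub>R (\<zeta>\<^sub>0 * cnj \<zeta>)) \<partial>M)" by (rule integral_Re[OF ci, symmetric])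
  also have "\<dots> \<ge> (\<integral>\<zeta>. \<theta> \<zeta> * (1 - 2 * pi\<^sup>2 / (real N)\<^sup>2) \<partial>M)"
  proof (rule integral_mono_AE[OF int_ind integrable_Re[OF ci]], rule AE_I2)
    fix \<zeta> assume "\<zeta> \<in> space M"
    then have z: "cmod \<zeta> = 1" by (simp add: space_circle_measure[OF M])
    show "\<theta> \<zeta> * (1 - 2 * pi\<^sup>2 / (real N)\<^sup>2) \<le> Re (\<theta> \<zeta> *\<^sub>R (\<zeta>\<^sub>0 * cnj \<zeta>))"
    proof (cases "\<zeta> \<in> J k")
      case True
      then obtain t where t: "2 * pi * real k / real N \<le> t" "t \<le> 2 * pi * real (Suc k) / real N" "\<zeta> = cis t"
        by (auto simp: J_def)
      have "cmod (\<zeta>\<^sub>0 - \<zeta>) \<le> \<bar>2 * pi * real k / real N - t\<bar>" unfolding \<zeta>\<^sub>0_def t(3) by (rule cmod_cis_diff_le)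
      also have "\<dots> \<le> 2 * pi / real N"
      proof -
        have "2 * pi * real (Suc k) / real N = 2 * pi * real k / real N + 2 * pi / real N"
          by (simp add: add_divide_distrib[symmetric] algebra_simps)
        then show ?thesis using t(1,2) by linarith
      qed
      \<comment> \<open>The loss in the real part is half the squared chord, and a chord of the arc
        is at most its length \<open>2 * pi / N\<close>; hence the constant
        \<open>2 * pi\<^sup>2 / N\<^sup>2\<close>.\<close>
      finally have "(cmod (\<zeta>\<^sub>0 - \<zeta>))\<^sup>2 \<le> (2 * pi / real N)\<^sup>2" by (rule power_mono) simp
      also have "\<dots> = 4 * pi\<^sup>2 / (real N)\<^sup>2" by (simp add: power_divide power_mult_distrib)
      finally have "1 - 2 * pi\<^sup>2 / (real N)\<^sup>2 \<le> Re (\<zeta>\<^sub>0 * cnj \<zeta>)"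
        using Re_mult_cnj_circle[of \<zeta>\<^sub>0 \<zeta>] z by (simp add: \<zeta>\<^sub>0_def)
      then have "\<theta> \<zeta> * (1 - 2 * pi\<^sup>2 / (real N)\<^sup>2) \<le> \<theta> \<zeta> * Re (\<zeta>\<^sub>0 * cnj \<zeta>)"
        using th0 by (rule mult_left_mono)
      then show ?thesis by (simp only: scaleR_complex.simps)
    qed (simp add: \<theta>_def)
  qed
  finally have "(\<integral>\<zeta>. \<theta> \<zeta> * (1 - 2 * pi\<^sup>2 / (real N)\<^sup>2) \<partial>M) \<le> Re (\<zeta>\<^sub>0 * (\<integral>\<zeta>. cnj \<zeta> \<partial>submeasure M \<theta>))" .
  moreover have "(\<integral>\<zeta>. \<theta> \<zeta> * (1 - 2 * pi\<^sup>2 / (real N)\<^sup>2) \<partial>M) = c / real N * (1 - 2 * pi\<^sup>2 / (real N)\<^sup>2)"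
    by (simp only: integral_mult_left_zero int_th)
  ultimately show ?thesis using wt mass by (intro exI[of _ \<theta>] exI[of _ \<zeta>\<^sub>0]) (simp add: \<zeta>\<^sub>0_def)
qed

section \<open>Shift invariance and the symbol\<close>

lemma singular_submeasure_inner:
  assumes M: "circle_measure M" and s: "mutually_singular M arclength" and w: "weight \<theta>"
  shows "inner_function (singular_inner (submeasure M \<theta>))"
  using singular_inner_unimodular[OF circle_measure_submeasure[OF M w] mutually_singular_submeasure[OF M w s]]
    singular_inner_boundary(4)[OF circle_measure_submeasure[OF M w]]
  by (simp add: inner_function_def boundary_def)

lemma submeasure_one: "submeasure M (\<lambda>_. 1) = M"
  by (simp add: submeasure_def density_1)

lemma weight_one: "weight (\<lambda>_. 1)"
  by (simp add: weight_def)

lemma weight_complement: "weight \<theta> \<Longrightarrow> weight (\<lambda>\<zeta>. 1 - \<theta> \<zeta>)"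
  by (auto simp: weight_def)

text \<open>The exponent is additive in the measure, so the complementary density
  \<open>1 - \<theta>\<close> belongs to the quotient of the two functions. It is this complement,
  carrying most of the mass, whose model space the symmetry of the compression is applied
  to.\<close>

lemma factorization_submeasure:
  assumes M: "circle_measure M" and s: "mutually_singular M arclength" and w: "weight \<theta>"
  shows "factorization (singular_inner M) (singular_inner (submeasure M (\<lambda>\<zeta>. 1 - \<theta> \<zeta>))) (singular_inner (submeasure M \<theta>))"
proof -
  note w' = weight_complement[OF w]
  have one: "weight (\<lambda>\<zeta>. (1 - \<theta> \<zeta>) + \<theta> \<zeta>)" by (simp add: weight_one)
  have "inner_function (singular_inner M)"
    using singular_submeasure_inner[OF M s weight_one] by (simp add: submeasure_one)
  moreover have "AE \<zeta> in arclength. radial_limit (singular_inner M) \<zeta> =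
      radial_limit (singular_inner (submeasure M (\<lambda>\<zeta>. 1 - \<theta> \<zeta>))) \<zeta> * radial_limit (singular_inner (submeasure M \<theta>)) \<zeta>"
  proof (rule radial_limit_mult)
    show "singular_inner M z = singular_inner (submeasure M (\<lambda>\<zeta>. 1 - \<theta> \<zeta>)) z * singular_inner (submeasure M \<theta>) z"
      if "z \<in> unit_disc" for z
      using singular_inner_submeasure_add[OF M w' w one that] by (simp add: submeasure_one)
  qed (rule singular_inner_boundary(3) circle_measure_submeasure M w w')+
  ultimately show ?thesis
    using singular_submeasure_inner[OF M s w] singular_submeasure_inner[OF M s w'] by (simp add: factorization_def)
qed

lemma factorization_commute: "factorization u v w \<Longrightarrow> factorization u w v"
  by (auto simp: factorization_def mult.commute)

lemma L2_bounded_by_boundary: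
  assumes u: "inner_function u" shows "L2_bounded_by (boundary u) 1"
proof -
  have "AE \<zeta> in arclength. cmod (radial_limit u \<zeta>) = 1"
    using inner_function_unimodular[OF u] by (simp add: unimodular_def)
  then have "AE \<zeta> in arclength. cmod (rep_circle_L2 (boundary u) \<zeta>) \<le> 1"
    unfolding boundary_def
    using rep_abs_circle_L2[OF bounded_symbol_square_integrable[OF inner_function_bounded[OF u]]]
    by eventually_elim simp
  then show ?thesis by (simp add: L2_bounded_by_def)
qed

text \<open>\<open>S* u\<close> is bounded by 2 and \<open>S*^n u\<close> by \<open>Suc n\<close>,
  both pointwise and in norm, so each of the two terms is at most \<open>4 * Suc n\<close>. The
  point is that the bound does not depend on \<open>u\<close>.\<close>

lemma L2_bounded_by_shift_vec:
  assumes u: "inner_function u" shows "L2_bounded_by (shift_vec u n) (8 * real (Suc n))"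
proof -
  note b = L2_bounded_by_bshift[OF L2_bounded_by_boundary[OF u] order_eq_refl[OF norm_boundary[OF u]]]
  let ?q = "bshift 1 (boundary u)" and ?a = "bshift n (boundary u)"
  have q: "L2_bounded_by ?q 2" using b[of 1] by simp
  have a: "L2_bounded_by ?a (real (Suc n))" using b[of n] by simp
  note nq = norm_le_L2_bounded_by[OF q] and na = norm_le_L2_bounded_by[OF a]
  have "(norm ?q)\<^sup>2 \<le> 2\<^sup>2" using nq by (rule power_mono) simp
  then have "(norm ?q)\<^sup>2 * real (Suc n) \<le> 2\<^sup>2 * real (Suc n)" by (rule mult_right_mono) simp
  then have 1: "L2_bounded_by (cscale (of_real ((norm ?q)\<^sup>2)) ?a) (4 * real (Suc n))"
    by (intro L2_bounded_by_mono[OF L2_bounded_by_cscale[OF a]]) (simp add: norm_power)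
  have "cmod (cinner ?a ?q) \<le> norm ?a * norm ?q" by (rule cmod_cinner_le)
  also have "\<dots> \<le> real (Suc n) * 2" by (intro mult_mono na nq) auto
  finally have 2: "L2_bounded_by (cscale (cinner ?a ?q) ?q) (4 * real (Suc n))"
    by (intro L2_bounded_by_mono[OF L2_bounded_by_cscale[OF q]]) simp
  show ?thesis unfolding shift_vec_def[OF u]
    by (rule L2_bounded_by_mono[OF L2_bounded_by_minus[OF 1 2]]) simp
qed

text \<open>All ingredients are continuous in the boundary function for fixed \<open>n\<close>, and
  no quotient occurs.\<close>

lemma tendsto_shift_vec:
  assumes u: "inner_function u" and v: "\<And>N. inner_function (v N)"
    and lim: "(\<lambda>N::nat. boundary (v N)) \<longlonglongrightarrow> boundary u"
  shows "(\<lambda>N. shift_vec (v N) n) \<longlonglongrightarrow> shift_vec u n"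
  unfolding shift_vec_def[OF u] shift_vec_def[OF v]
  by (intro tendsto_intros tendsto_bshift lim)

text \<open>\<open>u - v = v * (w - 1)\<close> and \<open>v\<close> is unimodular, so the distance
  is that of \<open>w\<close> from \<open>1\<close>, which the value of \<open>w\<close> at the
  origin determines.\<close>

lemma norm_boundary_diff:
  assumes fac: "factorization u v w"
  shows "(norm (boundary u - boundary v))\<^sup>2 = 2 - 2 * Re (cf (boundary w) 0)"
proof -
  note i = factorization_inner[OF fac]
  have "boundary u - boundary v = mult_inner v (boundary w - ee 0)"
    using mult_inner_factorization[OF factorization_commute[OF fac], of "ee 0"]
    by (simp add: mult_inner_ee[OF i(1)] mult_inner_ee[OF i(2)] mult_inner_ee[OF i(3)] mult_inner_linear[OF i(2)])
  then have "norm (boundary u - boundary v) = norm (boundary w - ee 0)" by (simp add: norm_mult_inner[OF i(2)])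
  moreover have "(norm (boundary w - ee 0))\<^sup>2 = 2 - 2 * Re (cf (boundary w) 0)"
  proof -
    have "cinner (boundary w - ee 0) (boundary w - ee 0) = 2 - (cf (boundary w) 0 + cnj (cf (boundary w) 0))"
      using cinner_commute[of "ee 0" "boundary w"] cinner_self_norm[of "boundary w"]
      by (simp add: cinner_simps cinner_ee cf_def norm_boundary[OF i(3)])
    then have "Re (of_real ((norm (boundary w - ee 0))\<^sup>2)) = Re (2 - (cf (boundary w) 0 + cnj (cf (boundary w) 0)))"
      unfolding cinner_self_norm by simp
    then show ?thesis by simp
  qed
  ultimately show ?thesis by simp
qed

lemma cf_boundary_submeasure:
  assumes M: "circle_measure M" and w: "weight \<theta>" and m: "measure (submeasure M \<theta>) (space M) = \<delta>"
  shows "cf (boundary (singular_inner (submeasure M \<theta>))) 0 = of_real (exp (- \<delta>))"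
    "cf (boundary (singular_inner (submeasure M \<theta>))) 1 = - 2 * (\<integral>\<zeta>. cnj \<zeta> \<partial>submeasure M \<theta>) * of_real (exp (- \<delta>))"
  using singular_inner_boundary(5,6)[OF circle_measure_submeasure[OF M w]]
    singular_inner_0[OF circle_measure_submeasure[OF M w]] deriv_singular_inner_0[OF circle_measure_submeasure[OF M w]] m
  by (simp_all add: boundary_def)

lemma tendsto_bounded_operator:
  assumes B: "\<And>f. f \<in> K \<Longrightarrow> norm (A f) \<le> B * norm f" and K: "closed_csubspace K" and A: "bounded_operator_on K A"
    and X: "\<And>n::nat. X n \<in> K" "f \<in> K" and lim: "X \<longlonglongrightarrow> f"
  shows "(\<lambda>n. A (X n)) \<longlonglongrightarrow> A f"
proof (rule Lim_null_comparison[THEN LIM_zero_cancel])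
  show "\<forall>\<^sub>F n in sequentially. norm (A (X n) - A f) \<le> B * norm (X n - f)"
    using B[OF closed_csubspaceD(4)[OF K X(1) X(2)]] bounded_operator_on_minus[OF A K X(1) X(2)] by simp
  have "(\<lambda>n. B * norm (X n - f)) \<longlonglongrightarrow> B * norm (f - f)" by (intro tendsto_intros lim)
  then show "(\<lambda>n. B * norm (X n - f)) \<longlonglongrightarrow> 0" by simp
qed

lemma bounded_operator_on_bound:
  assumes "bounded_operator_on K A" obtains B where "0 \<le> B" "\<And>f. f \<in> K \<Longrightarrow> norm (A f) \<le> B * norm f"
proof -
  obtain B where B: "\<forall>f\<in>K. norm (A f) \<le> B * norm f" using assms by (auto simp: bounded_operator_on_def)
  show thesis
  proof (rule that[of "max 0 B"])
    fix f assume "f \<in> K"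
    then have "norm (A f) \<le> B * norm f" using B by simp
    also have "\<dots> \<le> max 0 B * norm f" by (intro mult_right_mono) auto
    finally show "norm (A f) \<le> max 0 B * norm f" .
  qed simp
qed

text \<open>\<open>A\<close> is controlled on the model space only, so the approximants in the first
  slot and their shifts have to lie there; the second slot enters through the inner product
  alone.\<close>

lemma tendsto_shift_defect:
  assumes u: "inner_function u" and A: "bounded_operator_on (model_space u) A"
    and X: "\<And>n::nat. X n \<in> model_space u" "\<And>n. zshift 1 (X n) \<in> model_space u" "X \<longlonglongrightarrow> F" and Y: "Y \<longlonglongrightarrow> H"
  shows "(\<lambda>n. shift_defect A (X n) (Y n)) \<longlonglongrightarrow> shift_defect A F H"
proof -
  note K = closed_csubspace_model_space[OF u]
  obtain B where B: "0 \<le> B" "\<And>f. f \<in> model_space u \<Longrightarrow> norm (A f) \<le> B * norm f"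
    using bounded_operator_on_bound[OF A] by blast
  have zX: "(\<lambda>n. zshift 1 (X n)) \<longlonglongrightarrow> zshift 1 F" "(\<lambda>n. zshift 1 (Y n)) \<longlonglongrightarrow> zshift 1 H"
    by (rule bounded_linear.tendsto[OF bounded_linear_zshift], fact)+
  have F: "F \<in> model_space u" "zshift 1 F \<in> model_space u"
    by (rule closed_csubspaceD(5)[OF K X(1) X(3)], rule closed_csubspaceD(5)[OF K X(2) zX(1)])
  show ?thesis unfolding shift_defect_def
    by (intro tendsto_intros Y zX tendsto_bounded_operator[OF B(2) K A] X F)
qed

text \<open>For each \<open>N\<close> the vectors built from \<open>v N\<close> are legitimate test
  vectors for the first-order estimate, with a bound on them that is uniform in \<open>N\<close>.
  Since \<open>v N\<close> tends to \<open>u\<close>, they converge to the vectors built from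
  \<open>u\<close>, and the estimate passes to the limit zero.\<close>

lemma shift_defect_shift_vec:
  assumes M: "circle_measure M" and s: "mutually_singular M arclength"
    and A: "bounded_operator_on (model_space (singular_inner M)) A"
    and sym: "\<And>\<theta>. weight \<theta> \<Longrightarrow> C_symmetric_on (model_space (singular_inner (submeasure M \<theta>)))
      (model_conj (singular_inner (submeasure M \<theta>))) (\<lambda>f. proj (model_space (singular_inner (submeasure M \<theta>))) (A f))"
    and symu: "C_symmetric_on (model_space (singular_inner M)) (model_conj (singular_inner M)) A"
    and n: "1 \<le> n" "1 \<le> m"
  shows "shift_defect A (shift_vec (singular_inner M) n) (shift_vec (singular_inner M) m) = 0"
proof -
  define u where "u = singular_inner M"
  have u: "inner_function u"
    using singular_submeasure_inner[OF M s weight_one] by (simp add: submeasure_one u_def)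
  note A = A[folded u_def]
  define c where "c = measure M (space M)"
  show ?thesis
  proof (cases "c = 0")
    \<comment> \<open>With zero mass no arc carries anything and the concentration argument is void;
      \<open>u\<close> has boundary function \<open>1\<close> and all the vectors vanish.\<close>
    case True
    have W: "cf (boundary u) 0 = 1"
      using cf_boundary_submeasure(1)[OF M weight_one, of 0] True by (simp add: submeasure_one u_def c_def)
    have "norm (boundary u - ee 0) = 0"
    proof -
      have "cinner (boundary u - ee 0) (boundary u - ee 0) = 0"
        using cinner_commute[of "ee 0" "boundary u"] cinner_self_norm[of "boundary u"] W
        by (simp add: cinner_simps cinner_ee cf_def norm_boundary[OF u])
      then show ?thesis by (simp add: cinner_self_eq_0)
    qed
    then have "bshift 1 (boundary u) = 0" by (simp add: bshift_def taylor_sum_def W zshift_simps cf_ee)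
    then have "shift_vec u k = 0" for k unfolding shift_vec_def[OF u] by simp
    then show ?thesis by (simp add: shift_defect_def u_def zshift_simps)
  next
    case False
    then have c: "0 < c" using measure_nonneg[of M "space M"] by (simp add: c_def order_less_le)
    obtain N0 where "c \<le> real N0" using real_arch_simple by blast
    then have N0: "c \<le> real N0" "0 < N0" using c by (auto intro: gr0I)
    \<comment> \<open>The offset keeps \<delta> at most one from the start, as the exponential
      estimate demands.\<close>
    define L where "L N = N + N0" for N
    have L: "0 < L N" for N using N0 by (simp add: L_def)
    define dl where "dl N = c / real (L N)" for N
    have dl: "0 < dl N" "dl N \<le> 1" for N using c N0 L[of N] by (simp_all add: dl_def L_def divide_le_eq)
    have Linf: "(\<lambda>N. k / real (L N)) \<longlonglongrightarrow> 0" for k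
      unfolding L_def using LIMSEQ_ignore_initial_segment[OF lim_const_over_n[of k], of N0] by simp
    define P where "P N \<theta> \<zeta>\<^sub>0 \<longleftrightarrow> weight \<theta> \<and> cmod \<zeta>\<^sub>0 = 1 \<and> measure (submeasure M \<theta>) (space M) = dl N \<and>
        dl N * (1 - 2 * pi\<^sup>2 / (real (L N))\<^sup>2) \<le> Re (\<zeta>\<^sub>0 * (\<integral>\<zeta>. cnj \<zeta> \<partial>submeasure M \<theta>))" for N \<theta> \<zeta>\<^sub>0
    have "\<exists>\<theta> \<zeta>\<^sub>0. P N \<theta> \<zeta>\<^sub>0" for N
      using concentrated_weight[OF M L] c unfolding P_def dl_def c_def by blast
    then obtain \<theta> z where "\<And>N. P N (\<theta> N) (z N)" by metis
    then have \<theta>: "\<And>N. weight (\<theta> N)" "\<And>N. cmod (z N) = 1" "\<And>N. measure (submeasure M (\<theta> N)) (space M) = dl N"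
      "\<And>N. dl N * (1 - 2 * pi\<^sup>2 / (real (L N))\<^sup>2) \<le> Re (z N * (\<integral>\<zeta>. cnj \<zeta> \<partial>submeasure M (\<theta> N)))"
      unfolding P_def by blast+
    define v where "v N = singular_inner (submeasure M (\<lambda>\<zeta>. 1 - \<theta> N \<zeta>))" for N
    define w where "w N = singular_inner (submeasure M (\<theta> N))" for N
    have fac: "factorization u (v N) (w N)" for N
      unfolding u_def v_def w_def by (rule factorization_submeasure[OF M s \<theta>(1)])
    note i = factorization_inner[OF fac]
    have w0: "cf (boundary (w N)) 0 = of_real (exp (- dl N))" for N
      unfolding w_def by (rule cf_boundary_submeasure(1)[OF M \<theta>(1) \<theta>(3)])
    \<comment> \<open>The bound \<open>6 * \<delta> + 4 * \<kappa> / \<delta>\<close> with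
      \<open>\<delta> = c / L N\<close> and
      \<open>\<kappa> = 2 * pi\<^sup>2 / (L N)\<^sup>2\<close>.\<close>
    define er where "er N = sqrt ((6 * c + 8 * pi\<^sup>2 / c) / real (L N))" for N
    have er: "norm (generator_error (z N) (dl N) (w N)) \<le> er N" for N
    proof -
      let ?I = "\<integral>\<zeta>. cnj \<zeta> \<partial>submeasure M (\<theta> N)" and ?k = "2 * pi\<^sup>2 / (real (L N))\<^sup>2"
      have "Re (z N * cf (boundary (w N)) 1) = - 2 * exp (- dl N) * Re (z N * ?I)"
        unfolding w_def cf_boundary_submeasure(2)[OF M \<theta>(1) \<theta>(3)] by (simp add: algebra_simps)
      also have "\<dots> \<le> - 2 * exp (- dl N) * (dl N * (1 - ?k))"
        by (rule mult_left_mono_neg[OF \<theta>(4)]) simp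
      finally have "(norm (generator_error (z N) (dl N) (w N)))\<^sup>2 \<le> 6 * dl N + 4 * ?k / dl N"
        by (intro norm_generator_error i \<theta> dl w0) (auto simp: mult_ac)
      also have "\<dots> = (6 * c + 8 * pi\<^sup>2 / c) / real (L N)"
        using c L[of N] by (simp add: dl_def field_simps power2_eq_square)
      finally show ?thesis unfolding er_def by (rule real_le_rsqrt)
    qed
    have er0: "er \<longlonglongrightarrow> 0"
    proof -
      have "(\<lambda>N. sqrt ((6 * c + 8 * pi\<^sup>2 / c) / real (L N))) \<longlonglongrightarrow> sqrt 0" by (intro tendsto_intros Linf)
      then show ?thesis by (simp add: er_def[abs_def])
    qed
    have dl0: "dl \<longlonglongrightarrow> 0" unfolding dl_def[abs_def] by (rule Linf)
    have bd: "(\<lambda>N. boundary (v N)) \<longlonglongrightarrow> boundary u"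
    proof (rule LIM_zero_cancel, rule Lim_null_comparison)
      show "\<forall>\<^sub>F N in sequentially. norm (boundary (v N) - boundary u) \<le> sqrt (2 * dl N)"
      proof (rule always_eventually, rule allI)
        fix N
        have "(norm (boundary u - boundary (v N)))\<^sup>2 \<le> 2 * dl N"
          unfolding norm_boundary_diff[OF fac] w0 using exp_ge_add_one_self[of "- dl N"] by simp
        then show "norm (boundary (v N) - boundary u) \<le> sqrt (2 * dl N)"
          by (subst norm_minus_commute) (rule real_le_rsqrt)
      qed
      have "(\<lambda>N. sqrt (2 * dl N)) \<longlonglongrightarrow> sqrt (2 * 0)" by (intro tendsto_intros dl0)
      then show "(\<lambda>N. sqrt (2 * dl N)) \<longlonglongrightarrow> 0" by simp
    qed
    have sv: "shift_vec (v N) k \<in> model_space u \<and> zshift 1 (shift_vec (v N) k) \<in> model_space u" if "1 \<le> k" for N k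
      using shift_vec_in[OF i(2) that] model_space_subset[OF fac] by (auto simp: shift_domain_iff[OF i(2)])
    obtain B where B: "0 \<le> B" "\<And>f. f \<in> model_space u \<Longrightarrow> norm (A f) \<le> B * norm f"
      using bounded_operator_on_bound[OF A] by blast
    define R where "R = 8 * real (Suc n) + 8 * real (Suc m)"
    have bound: "2 * cmod (shift_defect A (shift_vec (v N) n) (shift_vec (v N) m)) \<le> B * R\<^sup>2 * (dl N * (2 + er N)\<^sup>2 + 4 * er N)" for N
    proof (rule shift_defect_bound[OF fac A B])
      show "cinner (A (mult_inner (w N) f)) (mult_inner (w N) h) = cinner (A f) h"
        if "f \<in> model_space (v N)" "h \<in> model_space (v N)" for f h
        by (rule symmetric_imp_invariant[OF fac symu[folded u_def] _ that])
          (unfold v_def, rule sym[OF weight_complement[OF \<theta>(1)]])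
      show "L2_bounded_by (shift_vec (v N) n) R" "L2_bounded_by (shift_vec (v N) m) R"
        unfolding R_def by (rule L2_bounded_by_mono[OF L2_bounded_by_shift_vec[OF i(2)]], simp)+
    qed (use shift_vec_in[OF i(2)] n \<theta> dl er in auto)
    have "(\<lambda>N. 2 * cmod (shift_defect A (shift_vec (v N) n) (shift_vec (v N) m))) \<longlonglongrightarrow> 2 * cmod (shift_defect A (shift_vec u n) (shift_vec u m))"
      using sv n by (intro tendsto_intros tendsto_shift_defect[OF u A] tendsto_shift_vec[OF u i(2) bd]) auto
    moreover have "(\<lambda>N. B * R\<^sup>2 * (dl N * (2 + er N)\<^sup>2 + 4 * er N)) \<longlonglongrightarrow> B * R\<^sup>2 * (0 * (2 + 0)\<^sup>2 + 4 * 0)"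
      by (intro tendsto_intros dl0 er0)
    ultimately have "2 * cmod (shift_defect A (shift_vec u n) (shift_vec u m)) \<le> B * R\<^sup>2 * (0 * (2 + 0)\<^sup>2 + 4 * 0)"
      by (rule LIMSEQ_le) (use bound in auto)
    then show ?thesis by (simp add: u_def)
  qed
qed

text \<open>The defect is sesquilinear and continuous on the domain of the shift, so the slots are
  extended one after the other by the density of the span of the \<open>shift_vec\<close>.\<close>

lemma shift_defect_zero_if_on_shift_vec:
  assumes u: "inner_function u" and A: "bounded_operator_on (model_space u) A"
    and z: "\<And>n m. 1 \<le> n \<Longrightarrow> 1 \<le> m \<Longrightarrow> shift_defect A (shift_vec u n) (shift_vec u m) = 0"
    and F: "F \<in> shift_domain u" and H: "H \<in> shift_domain u"
  shows "shift_defect A F H = 0"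
proof -
  note D = closed_csubspace_shift_domain[OF u]
  note Dm = shift_domain_iff[OF u]
  have closure: "closed_csubspace {F \<in> shift_domain u. \<forall>m\<ge>1. shift_defect A F (shift_vec u m) = 0}"
    unfolding closed_csubspace_def
  proof (intro conjI allI impI ballI; (elim CollectE conjE)?)
    have "A (cscale 0 0) = cscale 0 (A 0)"
      using bounded_operator_onD(3)[OF A closed_csubspaceD(1)[OF closed_csubspace_model_space[OF u]]] .
    then show "0 \<in> {F \<in> shift_domain u. \<forall>m\<ge>1. shift_defect A F (shift_vec u m) = 0}"
      using closed_csubspaceD(1)[OF D] by (simp add: shift_defect_def zshift_simps)
  next
    fix f g assume "f \<in> shift_domain u" "g \<in> shift_domain u"
      "\<forall>m\<ge>1. shift_defect A f (shift_vec u m) = 0" "\<forall>m\<ge>1. shift_defect A g (shift_vec u m) = 0"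
    then show "f + g \<in> {F \<in> shift_domain u. \<forall>m\<ge>1. shift_defect A F (shift_vec u m) = 0}"
      using closed_csubspaceD(2)[OF D] bounded_operator_onD(2)[OF A]
      by (auto simp: shift_defect_def zshift_simps Dm cinner_simps)
  next
    fix c f assume "f \<in> shift_domain u" "\<forall>m\<ge>1. shift_defect A f (shift_vec u m) = 0"
    then show "cscale c f \<in> {F \<in> shift_domain u. \<forall>m\<ge>1. shift_defect A F (shift_vec u m) = 0}"
      using closed_csubspaceD(3)[OF D] bounded_operator_onD(3)[OF A]
      by (auto simp: shift_defect_def zshift_simps Dm cinner_simps)
  next
    fix X :: "nat \<Rightarrow> circle_L2" and f
    assume X: "\<forall>n. X n \<in> {F \<in> shift_domain u. \<forall>m\<ge>1. shift_defect A F (shift_vec u m) = 0}" and lim: "X \<longlonglongrightarrow> f"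
    have "f \<in> shift_domain u" by (rule closed_csubspaceD(5)[OF D _ lim]) (use X in auto)
    moreover have "shift_defect A f (shift_vec u m) = 0" if "1 \<le> m" for m
    proof -
      have "(\<lambda>n. shift_defect A (X n) (shift_vec u m)) \<longlonglongrightarrow> shift_defect A f (shift_vec u m)"
        using X by (intro tendsto_shift_defect[OF u A] lim tendsto_const) (auto simp: Dm)
      moreover have "shift_defect A (X n) (shift_vec u m) = 0" for n using X that by auto
      ultimately show ?thesis by (simp add: LIMSEQ_const_iff)
    qed
    ultimately show "f \<in> {F \<in> shift_domain u. \<forall>m\<ge>1. shift_defect A F (shift_vec u m) = 0}" by simp
  qed
  have "{F \<in> shift_domain u. \<forall>m\<ge>1. shift_defect A F (shift_vec u m) = 0} = shift_domain u"
    by (rule shift_domain_density[OF u closure]) (use z shift_vec_in[OF u] in auto)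
  then have Fm: "shift_defect A F (shift_vec u m) = 0" if "1 \<le> m" for m using F that by blast
  \<comment> \<open>For fixed \<open>F\<close> the defect is an inner product with a fixed vector of
    L^2, so its zero set in the second slot is an annihilator.\<close>
  have eq: "shift_defect A F G = cnj (cinner G (A F - zshift (-1) (A (zshift 1 F))))" for G
  proof -
    have "shift_defect A F G = cinner (A F - zshift (-1) (A (zshift 1 F))) G"
      by (simp add: shift_defect_def cinner_simps cinner_zshift_left)
    then show ?thesis by (metis cinner_commute)
  qed
  have "shift_domain u \<inter> {G. \<forall>w\<in>{A F - zshift (-1) (A (zshift 1 F))}. cinner G w = 0} = shift_domain u"
  proof (rule shift_domain_density[OF u closed_csubspace_Int[OF D closed_csubspace_annihilator]])
    fix m :: nat assume "1 \<le> m"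
    then show "shift_vec u m \<in> shift_domain u \<inter> {G. \<forall>w\<in>{A F - zshift (-1) (A (zshift 1 F))}. cinner G w = 0}"
      using Fm[of m] shift_vec_in[OF u] by (simp add: eq)
  qed simp
  then have "cinner H (A F - zshift (-1) (A (zshift 1 F))) = 0" using H by blast
  then show ?thesis by (simp add: eq)
qed

section \<open>Reconstruction of the symbol\<close>

lemma cf_bshift_all: "cf (bshift n f) k = (if - int n \<le> k \<and> k < 0 then 0 else cf f (k + int n))"
  by (simp add: bshift_def cf_zshift cf_simps cf_taylor_sum)

lemma bshift_linear: "bshift n (f - g) = bshift n f - bshift n g" "bshift n (cscale c f) = cscale c (bshift n f)"
  by (rule cf_eqI, simp add: cf_bshift_all cf_simps)+

text \<open>The triple integral is the common form of two inner products: it lets a product be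
  formed with whichever factor is bounded, since two general elements of L^2 cannot be multiplied
  within L^2.\<close>

lemma cinner_mult_rep_cnj_right:
  assumes "bounded_symbol (rep_circle_L2 g)"
  shows "cinner p (mult_L2 (rep_circle_L2 g) (cnj_L2 q)) =
    (\<integral>\<zeta>. rep_circle_L2 p \<zeta> * rep_circle_L2 q \<zeta> * cnj (rep_circle_L2 g \<zeta>) \<partial>arclength)"
  unfolding cinner.rep_eq
proof (rule integral_cong_AE)
  show "AE \<zeta> in arclength. rep_circle_L2 p \<zeta> * cnj (rep_circle_L2 (mult_L2 (rep_circle_L2 g) (cnj_L2 q)) \<zeta>) =
      rep_circle_L2 p \<zeta> * rep_circle_L2 q \<zeta> * cnj (rep_circle_L2 g \<zeta>)"
    using rep_mult_L2[OF assms, of "cnj_L2 q"] rep_cnj_L2[of q] by eventually_elim simp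
qed measurable

lemma cinner_mult_rep_left:
  assumes "bounded_symbol (rep_circle_L2 p)"
  shows "cinner (mult_L2 (rep_circle_L2 p) q) g =
    (\<integral>\<zeta>. rep_circle_L2 p \<zeta> * rep_circle_L2 q \<zeta> * cnj (rep_circle_L2 g \<zeta>) \<partial>arclength)"
  unfolding cinner.rep_eq
proof (rule integral_cong_AE)
  show "AE \<zeta> in arclength. rep_circle_L2 (mult_L2 (rep_circle_L2 p) q) \<zeta> * cnj (rep_circle_L2 g \<zeta>) =
      rep_circle_L2 p \<zeta> * rep_circle_L2 q \<zeta> * cnj (rep_circle_L2 g \<zeta>)"
    using rep_mult_L2[OF assms, of q] by eventually_elim simp
qed measurable

lemma bounded_symbol_rep_ee: "bounded_symbol (rep_circle_L2 (ee n))"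
  by (rule L2_bounded_by_symbol[OF L2_bounded_by_ee])

lemma mult_L2_rep_ee_left: "mult_L2 (rep_circle_L2 (ee n)) q = zshift n q"
  unfolding zshift_def by (rule mult_L2_cong[OF bounded_symbol_rep_ee bounded_zpow rep_ee])

text \<open>Only the scalar sequence of these pairings occurs in the telescoped sum; the right side
  displays them as conjugated Fourier coefficients of a single vector, so the sum can be
  taken.\<close>

lemma cinner_zshift_symbol:
  assumes "bounded_symbol (rep_circle_L2 g)"
  shows "cinner (zshift n q) g = cinner (ee n) (mult_L2 (rep_circle_L2 g) (cnj_L2 q))"
  unfolding cinner_mult_rep_cnj_right[OF assms] cinner_mult_rep_left[OF bounded_symbol_rep_ee, symmetric] mult_L2_rep_ee_left ..

text \<open>Sarason's argument: with \<open>S\<^sup>*\<close> the backward shift, \<open>\<langle>A f, g\<rangle> - \<langle>A S\<^sup>* f, S\<^sup>* g\<rangle>\<close> vanishes when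
  \<open>f\<close> and \<open>g\<close> vanish at the origin, hence has rank two; summing over the iterates of \<open>S\<^sup>*\<close>, which
  tend to zero strongly, recovers \<open>A\<close> from the two vectors involved.\<close>

lemma shift_invariant_truncated_Toeplitz:
  assumes u: "inner_function u" and A: "bounded_operator_on (model_space u) A"
    and adj: "adjoint_on (model_space u) A A'"
    and inv: "\<And>F H. F \<in> shift_domain u \<Longrightarrow> H \<in> shift_domain u \<Longrightarrow> shift_defect A F H = 0"
  shows "A \<in> truncated_Toeplitz u"
proof -
  define K where "K = model_space u"
  note cK = closed_csubspace_model_space[OF u, folded K_def]
  note A = A[folded K_def]
  have A': "g \<in> K \<Longrightarrow> A' g \<in> K" "f \<in> K \<Longrightarrow> g \<in> K \<Longrightarrow> cinner (A f) g = cinner f (A' g)" for f g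
    using adj by (auto simp: adjoint_on_def K_def)
  have H2: "f \<in> K \<Longrightarrow> f \<in> H2" for f using model_spaceD(3)[OF u] by (simp add: K_def)
  have bK: "f \<in> K \<Longrightarrow> bshift n f \<in> K" for f n using bshift_model_space[OF u] by (simp add: K_def)
  define Q where "Q f g = cinner (A f) g - cinner (A (bshift 1 f)) (bshift 1 g)" for f g
  \<comment> \<open>If \<open>f\<close> and \<open>g\<close> vanish at the origin, they are the
    forward shifts of their backward shifts, which therefore lie in \<open>shift_domain u\<close>;
    \<open>Q f g\<close> is minus the shift defect of these.\<close>
  have Q0: "Q f g = 0" if f: "f \<in> K" "cf f 0 = 0" and g: "g \<in> K" "cf g 0 = 0" for f g
  proof -
    have "zshift 1 (bshift 1 f) = f" "zshift 1 (bshift 1 g) = g"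
      using zshift_bshift_1[of f] zshift_bshift_1[of g] f g by simp_all
    moreover have "bshift 1 f \<in> shift_domain u" "bshift 1 g \<in> shift_domain u"
      unfolding shift_domain_iff[OF u] using f g bK calculation by (auto simp: K_def)
    ultimately show ?thesis using inv[of "bshift 1 f" "bshift 1 g"] by (simp add: Q_def shift_defect_def)
  qed
  have AK: "A (f - g) = A f - A g" "A (cscale c f) = cscale c (A f)" if "f \<in> K" "g \<in> K" for f g c
    using bounded_operator_on_minus[OF A cK that] bounded_operator_onD(3)[OF A] that by auto
  have AinK: "A f \<in> K" if "f \<in> K" for f
    using bounded_operator_onD(1)[OF A that] .
  have Ql: "Q (f - cscale c e) g = Q f g - c * Q e g" if "f \<in> K" "e \<in> K" for f e g c
    using that bK closed_csubspaceD(3)[OF cK]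
    by (simp add: Q_def bshift_linear AK cinner_simps algebra_simps)
  have Qr: "Q f (g - cscale c e) = Q f g - cnj c * Q f e" for f e g c
    by (simp add: Q_def bshift_linear cinner_simps algebra_simps)
  have zsh: "cinner h (bshift 1 g) = cinner (zshift 1 h) g" if "h \<in> K" for g h
    using cinner_bshift[OF H2[OF that], of 1 g] by simp
  obtain \<psi> \<eta> where \<psi>: "\<psi> \<in> H2" and \<eta>: "\<eta> \<in> H2"
    and rank2: "\<And>f g. f \<in> K \<Longrightarrow> g \<in> K \<Longrightarrow> Q f g = cf f 0 * cinner \<psi> g + cnj (cf g 0) * cinner f \<eta>"
  proof (cases "\<exists>e\<in>K. cf e 0 \<noteq> 0")
    \<comment> \<open>If all of the model space vanishes at the origin, then \<open>Q\<close> is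
      zero and zero vectors serve.\<close>
    case False
    then have "Q f g = 0" if "f \<in> K" "g \<in> K" for f g using Q0 that by blast
    then show ?thesis using that[of 0 0] False closed_csubspaceD(1)[OF closed_csubspace_H2] by auto
  next
    case True
    then obtain e0 where e0: "e0 \<in> K" "cf e0 0 \<noteq> 0" by blast
    \<comment> \<open>Normalized to have value one at the origin, so that subtracting
      \<open>cf f 0\<close> times \<open>e\<close> from \<open>f\<close> removes the value at the
      origin.\<close>
    define e where "e = cscale (1 / cf e0 0) e0"
    have e: "e \<in> K" "cf e 0 = 1" using e0 closed_csubspaceD(3)[OF cK] by (auto simp: e_def cf_simps)
    define \<psi> where "\<psi> = A e - zshift 1 (A (bshift 1 e))"
    define \<kappa> where "\<kappa> = A' e - zshift 1 (A' (bshift 1 e))"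
    \<comment> \<open>The entry \<open>Q e e\<close> would otherwise be counted in both terms of the
      rank two formula; it is taken out of the second.\<close>
    define \<eta> where "\<eta> = \<kappa> - cscale (cnj (Q e e)) (ee 0)"
    have \<psi>: "\<psi> \<in> H2" unfolding \<psi>_def
      by (intro closed_csubspaceD(4)[OF closed_csubspace_H2] H2_zshift H2 AinK bK e) simp
    have \<eta>: "\<eta> \<in> H2" unfolding \<eta>_def \<kappa>_def
      by (intro closed_csubspaceD(3,4)[OF closed_csubspace_H2] H2_zshift H2 A' bK e ee_in_H2) simp_all
    have Qe: "Q e g = cinner \<psi> g" if "g \<in> K" for g
      using zsh[OF AinK[OF bK[OF e(1)]]] by (simp add: Q_def \<psi>_def cinner_simps)
    have Qe': "Q f e = cinner f \<kappa>" if f: "f \<in> K" for f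
    proof -
      have "cinner (A (bshift 1 f)) (bshift 1 e) = cinner (bshift 1 f) (A' (bshift 1 e))"
        by (rule A'(2)[OF bK[OF f] bK[OF e(1)]])
      also have "\<dots> = cnj (cinner (A' (bshift 1 e)) (bshift 1 f))" by (rule cinner_commute)
      also have "\<dots> = cnj (cinner (zshift 1 (A' (bshift 1 e))) f)" by (simp only: zsh[OF A'(1)[OF bK[OF e(1)]]])
      also have "\<dots> = cinner f (zshift 1 (A' (bshift 1 e)))" by (rule cinner_commute[symmetric])
      finally show ?thesis using A'(2)[OF f e(1)] by (simp add: Q_def \<kappa>_def cinner_simps)
    qed
    have "Q f g = cf f 0 * cinner \<psi> g + cnj (cf g 0) * cinner f \<eta>" if f: "f \<in> K" and g: "g \<in> K" for f g
    proof -
      have "f - cscale (cf f 0) e \<in> K" "g - cscale (cf g 0) e \<in> K"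
        using f g e closed_csubspaceD(3,4)[OF cK] by auto
      then have "Q (f - cscale (cf f 0) e) (g - cscale (cf g 0) e) = 0"
        by (intro Q0) (simp_all add: cf_simps e)
      then have "Q f g = cf f 0 * Q e g + cnj (cf g 0) * (Q f e - cf f 0 * Q e e)"
        by (simp add: Qr Ql[OF f e(1)] algebra_simps)
      moreover have "Q f e - cf f 0 * Q e e = cinner f \<eta>"
        unfolding Qe'[OF f] \<eta>_def by (simp add: cinner_simps cf_def mult.commute)
      ultimately show ?thesis using Qe[OF g] by simp
    qed
    then show ?thesis using that \<psi> \<eta> by blast
  qed
  obtain B where B: "0 \<le> B" "\<And>f. f \<in> K \<Longrightarrow> norm (A f) \<le> B * norm f"
    using bounded_operator_on_bound[OF A] by blast
  \<comment> \<open>The two vectors of the rank two form become the analytic and the conjugate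
    analytic part of the symbol.\<close>
  define \<phi> where "\<phi> = \<psi> + cnj_L2 \<eta>"
  have form: "cinner (A f) g = cinner (mult_L2 (rep_circle_L2 f) \<phi>) g"
    if f: "f \<in> K" "bounded_symbol (rep_circle_L2 f)" and g: "g \<in> K" "bounded_symbol (rep_circle_L2 g)" for f g
  proof -
    define F where "F = mult_L2 (rep_circle_L2 f) (cnj_L2 \<eta>)"
    define G where "G = mult_L2 (rep_circle_L2 g) (cnj_L2 \<psi>)"
    \<comment> \<open>The values of the iterated backward shifts at the origin are the successive
      Taylor coefficients, so the rank two terms assemble into partial sums of \<open>f\<close> and
      \<open>g\<close> paired with the fixed vectors \<open>G\<close> and \<open>F\<close>.\<close>
    have tele: "cinner (A f) g - cinner (A (bshift N f)) (bshift N g) =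
        cinner (taylor_sum (\<lambda>n. cf f (int n)) N) G + cinner F (taylor_sum (\<lambda>n. cf g (int n)) N)" for N
    proof (induction N)
      case 0
      show ?case by (simp add: taylor_sum_def)
    next
      case (Suc N)
      have "cinner (A (bshift N f)) (bshift N g) - cinner (A (bshift (Suc N) f)) (bshift (Suc N) g) = Q (bshift N f) (bshift N g)"
        using bshift_bshift[OF H2[OF f(1)], of 1 N] bshift_bshift[OF H2[OF g(1)], of 1 N] by (simp add: Q_def)
      also have "\<dots> = cf (bshift N f) 0 * cinner \<psi> (bshift N g) + cnj (cf (bshift N g) 0) * cinner (bshift N f) \<eta>"
        by (rule rank2[OF bK[OF f(1)] bK[OF g(1)]])
      also have "cf (bshift N f) 0 = cf f (int N)" by (simp add: cf_bshift_all)
      also have "cf (bshift N g) 0 = cf g (int N)" by (simp add: cf_bshift_all)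
      also have "cinner \<psi> (bshift N g) = cinner (ee (int N)) G"
        unfolding cinner_bshift[OF \<psi>] G_def by (rule cinner_zshift_symbol[OF g(2)])
      also have "cinner (bshift N f) \<eta> = cinner F (ee (int N))"
      proof -
        have "cinner (bshift N f) \<eta> = cnj (cinner \<eta> (bshift N f))" by (rule cinner_commute)
        also have "\<dots> = cnj (cinner (ee (int N)) F)"
          unfolding cinner_bshift[OF \<eta>] F_def cinner_zshift_symbol[OF f(2)] ..
        also have "\<dots> = cinner F (ee (int N))" by (rule cinner_commute[symmetric])
        finally show ?thesis .
      qed
      finally have "cinner (A (bshift N f)) (bshift N g) - cinner (A (bshift (Suc N) f)) (bshift (Suc N) g) =
          cf f (int N) * cinner (ee (int N)) G + cnj (cf g (int N)) * cinner F (ee (int N))" .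
      then show ?case using Suc by (simp add: taylor_sum_def cinner_simps algebra_simps)
    qed
    have "(\<lambda>N. cinner (A f) g - cinner (A (bshift N f)) (bshift N g)) \<longlonglongrightarrow> cinner (A f) g - cinner (A 0) 0"
      by (intro tendsto_intros bshift_tendsto_0 tendsto_bounded_operator[OF B(2) cK A] bK f g H2 closed_csubspaceD(1)[OF cK])
    moreover have "(\<lambda>N. cinner (taylor_sum (\<lambda>n. cf f (int n)) N) G + cinner F (taylor_sum (\<lambda>n. cf g (int n)) N)) \<longlonglongrightarrow> cinner f G + cinner F g"
      using H2[OF f(1)] H2[OF g(1)] by (intro tendsto_intros taylor_sum_tendsto) (auto simp: H2_iff)
    ultimately have "cinner (A f) g - cinner (A 0) 0 = cinner f G + cinner F g"
      unfolding tele by (rule LIMSEQ_unique)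
    moreover have "cinner f G = cinner (mult_L2 (rep_circle_L2 f) \<psi>) g"
      unfolding G_def cinner_mult_rep_cnj_right[OF g(2)] cinner_mult_rep_left[OF f(2)] ..
    ultimately show ?thesis by (simp add: F_def \<phi>_def mult_L2_add[OF f(2)] cinner_simps)
  qed
  have "A f = proj K (abs_circle_L2 (\<lambda>\<zeta>. rep_circle_L2 \<phi> \<zeta> * rep_circle_L2 f \<zeta>))"
    if f: "f \<in> K" "ess_bounded f" for f
  proof -
    have fb: "bounded_symbol (rep_circle_L2 f)" using f(2) by (simp add: ess_bounded_def bounded_symbol_def)
    have eq: "abs_circle_L2 (\<lambda>\<zeta>. rep_circle_L2 \<phi> \<zeta> * rep_circle_L2 f \<zeta>) = mult_L2 (rep_circle_L2 f) \<phi>"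
      by (simp add: mult_L2_def mult.commute)
    define p where "p = proj K (mult_L2 (rep_circle_L2 f) \<phi>)"
    have p: "p \<in> K" unfolding p_def by (rule proj_in(1)[OF cK])
    have "p - A f = 0"
    \<comment> \<open>The formula for \<open>A\<close> is available for bounded second arguments
      only; the backward shifts of \<open>u\<close> are bounded and total, which is enough to
      identify the projection.\<close>
    proof (rule model_space_orthogonal_bshift_boundary[OF u])
      show "p - A f \<in> model_space u"
        using closed_csubspaceD(4)[OF cK p AinK[OF f(1)]] by (simp add: K_def)
      fix n :: nat assume "1 \<le> n"
      define a where "a = bshift n (boundary u)"
      have a: "a \<in> K" using bshift_boundary_model_space[OF u \<open>1 \<le> n\<close>] by (simp add: a_def K_def)
      have ab: "bounded_symbol (rep_circle_L2 a)"
        unfolding a_def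
        by (rule L2_bounded_by_symbol[OF L2_bounded_by_bshift[OF L2_bounded_by_boundary[OF u] order_eq_refl[OF norm_boundary[OF u]]]])
      have "cinner p a = cinner (mult_L2 (rep_circle_L2 f) \<phi>) a" unfolding p_def by (rule cinner_proj_left[OF cK a])
      then show "cinner (p - A f) (bshift n (boundary u)) = 0"
        using form[OF f(1) fb a ab] by (simp add: cinner_simps a_def[symmetric])
    qed
    then show ?thesis by (simp add: eq p_def)
  qed
  then show ?thesis using A by (auto simp: truncated_Toeplitz_def K_def)
qed

lemma submeasure_less_eq:
  assumes M: "circle_measure M" and w: "weight \<theta>" shows "submeasure M \<theta> \<le> M"
  using submeasure_le[OF M w] by (subst le_measure) (auto simp: le_fun_def)

theorem theorem4p3:
  fixes \<nu> :: "complex measure" and A :: "circle_L2 \<Rightarrow> circle_L2"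
  assumes "sets \<nu> = sets borel_circle"
    and "finite_measure \<nu>"
    and "mutually_singular \<nu> arclength"
    and "bounded_operator_on (model_space (singular_inner \<nu>)) A"
    and "C_symmetric_on (model_space (singular_inner \<nu>)) (model_conj (singular_inner \<nu>)) A"
    and "\<And>\<mu> :: complex measure. sets \<mu> = sets borel_circle \<Longrightarrow> \<mu> \<le> \<nu> \<Longrightarrow>
      C_symmetric_on (model_space (singular_inner \<mu>)) (model_conj (singular_inner \<mu>))
        (\<lambda>f. proj (model_space (singular_inner \<mu>)) (A f))"
  shows "A \<in> truncated_Toeplitz (singular_inner \<nu>)"
proof -
  have M: "circle_measure \<nu>" using assms(1,2) by (simp add: circle_measure_def)
  have u: "inner_function (singular_inner \<nu>)"
    using singular_submeasure_inner[OF M assms(3) weight_one] by (simp add: submeasure_one)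
  \<comment> \<open>Every density with values between zero and one defines an admissible minorant of
    \<nu>.\<close>
  have sym: "C_symmetric_on (model_space (singular_inner (submeasure \<nu> \<theta>)))
      (model_conj (singular_inner (submeasure \<nu> \<theta>))) (\<lambda>f. proj (model_space (singular_inner (submeasure \<nu> \<theta>))) (A f))"
    if "weight \<theta>" for \<theta>
    by (rule assms(6)) (use assms(1) submeasure_less_eq[OF M that] in auto)
  show ?thesis
  proof (rule shift_invariant_truncated_Toeplitz[OF u assms(4)])
    \<comment> \<open>The symmetry with respect to the conjugation exhibits the adjoint explicitly,
      so its existence needs no separate argument.\<close>
    show "adjoint_on (model_space (singular_inner \<nu>)) A (model_conj (singular_inner \<nu>) \<circ> A \<circ> model_conj (singular_inner \<nu>))"
      using assms(5) by (simp add: C_symmetric_on_def)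
    show "shift_defect A F H = 0" if "F \<in> shift_domain (singular_inner \<nu>)" "H \<in> shift_domain (singular_inner \<nu>)" for F H
      by (rule shift_defect_zero_if_on_shift_vec[OF u assms(4) _ that])
        (rule shift_defect_shift_vec[OF M assms(3,4) sym assms(5)])
  qed
qed

end
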